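(* Let $\Phi$ be a quantum interaction on $\mathbb{Z}^d$ with $\|\Phi\|_\kappa<\infty$ for some $\kappa>0$. Then there exists $\beta_{\max}>0$ such that for every $0<\beta\le\beta_{\max}$ and every self-adjoint matrix $X\in\mathcal{B}(\mathcal{H})$, the classical restriction $\mu^{\beta,X}$ of the (unique) quantum equilibrium state $\omega^\beta$ at inverse temperature $\beta$ is Gibbsian.
   Context: Quantum spin system: to each $i\in\mathbb{Z}^d$ attach $\mathcal{H}_i\cong\mathcal{H}=\mathbb{C}^m$ ($m\ge2$); for finite $\Lambda\subset\mathbb{Z}^d$, $\mathcal{H}_\Lambda=\bigotimes_{i\in\Lambda}\mathcal{H}_i$, $\mathcal{A}_\Lambda=\mathcal{B}(\mathcal{H}_\Lambda)$, with the standard embeddings $\mathcal{A}_{\Lambda'}\subset\mathcal{A}_\Lambda$ for $\Lambda'\subset\Lambda$. A quantum interaction is a family $\Phi=\{\Phi(A)\}_{A\subset\mathbb{Z}^d \text{ finite}}$ of self-adjoint $\Phi(A)\in\mathcal{B}(\mathcal{H}_A)$, $\Phi(\emptyset)=0$, translation invariant ($\Phi(A+i)$ is the copy of $\Phi(A)$ on $\mathcal{H}_{A+i}$), and $\Phi(A)=0$ unless $A$ is connected. Norm: $\|\Phi\|_\kappa=\sum_{A\ni0}e^{\kappa|A|}\|\Phi(A)\|$. Local Hamiltonian $H_\Lambda^\Phi=\sum_{A\subset\Lambda}\Phi(A)$; finite-volume Gibbs state $\omega_\Lambda^\beta(\cdot)=\mathrm{Tr}_\Lambda(e^{-\beta H^\Phi_\Lambda}\,\cdot)/\mathrm{Tr}_\Lambda(e^{-\beta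 H^\Phi_\Lambda})$; $\omega^\beta$ is its (unique for $\beta$ small) weak* thermodynamic limit $\Lambda\nearrow\mathbb{Z}^d$. Classical restriction: for self-adjoint $X\in\mathcal{B}(\mathcal{H})$ with spectral decomposition $X=\sum_{x\in\mathrm{sp}(X)}xQ(x)$, let $X_i,Q_i(x)$ be the copies at site $i$, $\Omega_\Lambda=\mathrm{sp}(X)^\Lambda$, $\Omega=\mathrm{sp}(X)^{\mathbb{Z}^d}$, $Q_\Lambda(x_\Lambda)=\prod_{i\in\Lambda}Q_i(x_i)$. The classical restriction of a state $\omega$ is the probability measure $\mu^X$ on $\Omega$ (product topology, Borel $\sigma$-algebra) with $\mu^X(x_\Lambda)=\omega(Q_\Lambda(x_\Lambda))$ for all finite $\Lambda$ and $x_\Lambda\in\Omega_\Lambda$; $\mu^{\beta,X}$ denotes that of $\omega^\beta$. Gibbsian: a classical potential is a translation-invariant family $\Psi=\{\Psi_A\}$, $A\subset\mathbb{Z}^d$ finite, of real functions $\Psi_A:\Omega_A\to\mathbb{R}$ with $\Psi_\emptyset=0$, with norm $\|\Psi\|_\kappa=\sum_{A\ni0}e^{\kappa|A|}\sup|\Psi_A|$. A probability measure $\mu$ on $\Omega$ is Gibbsian if there is a potential $\Psi$ with $\|\Psi\|_0<\infty$ such that for every finite $\Lambda$ and $\mu$-a.e. $x_{\Lambda^c}$, $\mu(x_\Lambda\mid x_{\Lambda^c})=\mathcal{Z}_\Lambda(x_{\Lambda^c})^{-1}\exp[-\sum_{A\cap\Lambda\neq\emptyset}\Psi_A(x)]$,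 with $\mathcal{Z}_\Lambda$ the normalizing sum over $x_\Lambda\in\Omega_\Lambda$. *)

theory Defs
  imports "HOL-Analysis.Analysis" "HOL-Probability.Probability"
begin

section \<open>Finite matrices indexed by a finite set S (kernels)\<close>

definition kmult :: "'a set \<Rightarrow> ('a \<Rightarrow> 'a \<Rightarrow> complex) \<Rightarrow> ('a \<Rightarrow> 'a \<Rightarrow> complex) \<Rightarrow> ('a \<Rightarrow> 'a \<Rightarrow> complex)" where
  "kmult S K L = (\<lambda>\<sigma> \<tau>. \<Sum>\<rho>\<in>S. K \<sigma> \<rho> * L \<rho> \<tau>)"

definition kid :: "'a \<Rightarrow> 'a \<Rightarrow> complex" where
  "kid = (\<lambda>\<sigma> \<tau>. if \<sigma> = \<tau> then 1 else 0)"

definition kpow :: "'a set \<Rightarrow> ('a \<Rightarrow> 'a \<Rightarrow> complex) \<Rightarrow> nat \<Rightarrow> ('a \<Rightarrow> 'a \<Rightarrow> complex)" where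
  "kpow S K n = ((\<lambda>L. kmult S K L) ^^ n) kid"

text \<open>Matrix exponential via its power series.\<close>
definition kexp :: "'a set \<Rightarrow> ('a \<Rightarrow> 'a \<Rightarrow> complex) \<Rightarrow> ('a \<Rightarrow> 'a \<Rightarrow> complex)" where
  "kexp S K = (\<lambda>\<sigma> \<tau>. \<Sum>n. kpow S K n \<sigma> \<tau> / of_nat (fact n))"

definition ktrace :: "'a set \<Rightarrow> ('a \<Rightarrow> 'a \<Rightarrow> complex) \<Rightarrow> complex" where
  "ktrace S K = (\<Sum>\<sigma>\<in>S. K \<sigma> \<sigma>)"

text \<open>Operator norm (w.r.t. the Euclidean norm on the coordinate space indexed by S).\<close>
definition kopnorm :: "'a set \<Rightarrow> ('a \<Rightarrow> 'a \<Rightarrow> complex) \<Rightarrow> real" where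
  "kopnorm S K = (SUP v \<in> {v. (\<Sum>\<tau>\<in>S. (cmod (v \<tau>))\<^sup>2) \<le> 1}.
      sqrt (\<Sum>\<sigma>\<in>S. (cmod (\<Sum>\<tau>\<in>S. K \<sigma> \<tau> * v \<tau>))\<^sup>2))"

section \<open>The lattice Z^d\<close>

definition nn :: "int^'d \<Rightarrow> int^'d \<Rightarrow> bool" where
  "nn a b \<longleftrightarrow> (\<Sum>k\<in>UNIV. \<bar>a$k - b$k\<bar>) = 1"

definition lattice_connected :: "(int^'d) set \<Rightarrow> bool" where
  "lattice_connected A \<longleftrightarrow>
     (\<forall>a\<in>A. \<forall>b\<in>A. (a, b) \<in> {(x, y). x \<in> A \<and> y \<in> A \<and> nn x y}\<^sup>*)"

definition transl :: "int^'d \<Rightarrow> (int^'d) set \<Rightarrow> (int^'d) set" where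
  "transl i A = (\<lambda>j. j + i) ` A"

definition box :: "nat \<Rightarrow> (int^'d) set" where
  "box n = {x. \<forall>k. \<bar>x$k\<bar> \<le> int n}"

section \<open>Quantum spin system\<close>

text \<open>Basis configurations of H_Lambda: elements of Lambda ->E 'm (the local spin
  space C^m is identified with functions 'm => complex, m = CARD('m)).\<close>
definition cfg :: "'s set \<Rightarrow> ('s \<Rightarrow> 'm) set" where
  "cfg \<Lambda> = (\<Lambda> \<rightarrow>\<^sub>E (UNIV :: 'm set))"

definition quantum_interaction ::
  "((int^'d) set \<Rightarrow> ((int^'d) \<Rightarrow> 'm) \<Rightarrow> ((int^'d) \<Rightarrow> 'm) \<Rightarrow> complex) \<Rightarrow> bool" where
  "quantum_interaction \<Phi> \<longleftrightarrow>
     (\<forall>\<sigma>\<in>cfg {}. \<forall>\<tau>\<in>cfg {}. \<Phi> {} \<sigma> \<tau> = 0) \<and>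
     (\<forall>A. finite A \<longrightarrow> (\<forall>\<sigma>\<in>cfg A. \<forall>\<tau>\<in>cfg A. \<Phi> A \<sigma> \<tau> = cnj (\<Phi> A \<tau> \<sigma>))) \<and>
     (\<forall>A i. finite A \<longrightarrow> (\<forall>\<sigma>\<in>cfg (transl i A). \<forall>\<tau>\<in>cfg (transl i A).
        \<Phi> (transl i A) \<sigma> \<tau> = \<Phi> A (\<lambda>j\<in>A. \<sigma> (j + i)) (\<lambda>j\<in>A. \<tau> (j + i)))) \<and>
     (\<forall>A. finite A \<and> \<not> lattice_connected A \<longrightarrow> (\<forall>\<sigma>\<in>cfg A. \<forall>\<tau>\<in>cfg A. \<Phi> A \<sigma> \<tau> = 0))"

text \<open>norm_kappa(Phi) < infinity (sum of nonnegative terms).\<close>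
definition interaction_norm_finite ::
  "real \<Rightarrow> ((int^'d) set \<Rightarrow> ((int^'d) \<Rightarrow> 'm) \<Rightarrow> ((int^'d) \<Rightarrow> 'm) \<Rightarrow> complex) \<Rightarrow> bool" where
  "interaction_norm_finite \<kappa> \<Phi> \<longleftrightarrow>
     (\<lambda>A. exp (\<kappa> * real (card A)) * kopnorm (cfg A) (\<Phi> A)) summable_on {A. finite A \<and> 0 \<in> A}"

text \<open>Standard embedding B(H_A) into B(H_Lambda), A a subset of Lambda: K tensor identity.\<close>
definition emb :: "'s set \<Rightarrow> 's set \<Rightarrow> (('s \<Rightarrow> 'm) \<Rightarrow> ('s \<Rightarrow> 'm) \<Rightarrow> complex)
      \<Rightarrow> (('s \<Rightarrow> 'm) \<Rightarrow> ('s \<Rightarrow> 'm) \<Rightarrow> complex)" where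
  "emb A \<Lambda> K = (\<lambda>\<sigma> \<tau>. K (restrict \<sigma> A) (restrict \<tau> A) *
                         (if \<forall>i\<in>\<Lambda> - A. \<sigma> i = \<tau> i then 1 else 0))"

definition hamiltonian ::
  "((int^'d) set \<Rightarrow> ((int^'d) \<Rightarrow> 'm) \<Rightarrow> ((int^'d) \<Rightarrow> 'm) \<Rightarrow> complex) \<Rightarrow> (int^'d) set
     \<Rightarrow> ((int^'d) \<Rightarrow> 'm) \<Rightarrow> ((int^'d) \<Rightarrow> 'm) \<Rightarrow> complex" where
  "hamiltonian \<Phi> \<Lambda> = (\<lambda>\<sigma> \<tau>. \<Sum>A\<in>Pow \<Lambda>. emb A \<Lambda> (\<Phi> A) \<sigma> \<tau>)"

text \<open>Finite-volume Gibbs state omega_Lambda^beta applied to B in A_Lambda.\<close>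
definition gibbs_state ::
  "real \<Rightarrow> ((int^'d) set \<Rightarrow> ((int^'d) \<Rightarrow> 'm) \<Rightarrow> ((int^'d) \<Rightarrow> 'm) \<Rightarrow> complex) \<Rightarrow> (int^'d) set
     \<Rightarrow> (((int^'d) \<Rightarrow> 'm) \<Rightarrow> ((int^'d) \<Rightarrow> 'm) \<Rightarrow> complex) \<Rightarrow> complex" where
  "gibbs_state \<beta> \<Phi> \<Lambda> B =
     (let E = kexp (cfg \<Lambda>) (\<lambda>\<sigma> \<tau>. - complex_of_real \<beta> * hamiltonian \<Phi> \<Lambda> \<sigma> \<tau>)
      in ktrace (cfg \<Lambda>) (kmult (cfg \<Lambda>) E B) / ktrace (cfg \<Lambda>) E)"

section \<open>Single-site observable X, spectrum and spectral projections\<close>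

definition selfadjoint :: "('m::finite \<Rightarrow> 'm \<Rightarrow> complex) \<Rightarrow> bool" where
  "selfadjoint X \<longleftrightarrow> (\<forall>a b. X a b = cnj (X b a))"

definition eigvec :: "('m::finite \<Rightarrow> 'm \<Rightarrow> complex) \<Rightarrow> real \<Rightarrow> ('m \<Rightarrow> complex) \<Rightarrow> bool" where
  "eigvec X x v \<longleftrightarrow> (\<forall>a. (\<Sum>b\<in>UNIV. X a b * v b) = complex_of_real x * v a)"

text \<open>sp(X) (real since X is self-adjoint).\<close>
definition spec :: "('m::finite \<Rightarrow> 'm \<Rightarrow> complex) \<Rightarrow> real set" where
  "spec X = {x. \<exists>v. v \<noteq> (\<lambda>_. 0) \<and> eigvec X x v}"

text \<open>Q(x): the orthogonal projection onto the eigenspace of X for x.\<close>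
definition specproj :: "('m::finite \<Rightarrow> 'm \<Rightarrow> complex) \<Rightarrow> real \<Rightarrow> ('m \<Rightarrow> 'm \<Rightarrow> complex)" where
  "specproj X x = (THE P. (\<forall>a b. P a b = cnj (P b a)) \<and> kmult UNIV P P = P \<and>
       (\<forall>v. eigvec X x v \<longleftrightarrow> (\<exists>w. v = (\<lambda>a. \<Sum>b\<in>UNIV. P a b * w b))))"

text \<open>Q_Lambda(x_Lambda) = product over i in Lambda of Q_i(x_i), as an operator on H_Lambda.\<close>
definition QLam :: "('m::finite \<Rightarrow> 'm \<Rightarrow> complex) \<Rightarrow> 's set \<Rightarrow> ('s \<Rightarrow> real)
     \<Rightarrow> ('s \<Rightarrow> 'm) \<Rightarrow> ('s \<Rightarrow> 'm) \<Rightarrow> complex" where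
  "QLam X \<Lambda> \<xi> = (\<lambda>\<sigma> \<tau>. \<Prod>i\<in>\<Lambda>. specproj X (\<xi> i) (\<sigma> i) (\<tau> i))"

section \<open>Classical side\<close>

text \<open>Omega = S^(Z^d) with the product sigma-algebra (= Borel sets of the product
  topology, the product being countable and the factors finite discrete).\<close>
definition Omega_alg :: "real set \<Rightarrow> ((int^'d) \<Rightarrow> real) measure" where
  "Omega_alg S = PiM UNIV (\<lambda>_. count_space S)"

definition cyl :: "real set \<Rightarrow> (int^'d) set \<Rightarrow> ((int^'d) \<Rightarrow> real) \<Rightarrow> ((int^'d) \<Rightarrow> real) set" where
  "cyl S \<Lambda> \<xi> = {\<omega> \<in> space (Omega_alg S). \<forall>i\<in>\<Lambda>. \<omega> i = \<xi> i}"

text \<open>sigma-algebra generated by the spins outside Lambda.\<close>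
definition outside_alg :: "real set \<Rightarrow> (int^'d) set \<Rightarrow> ((int^'d) \<Rightarrow> real) measure" where
  "outside_alg S \<Lambda> = vimage_algebra (space (Omega_alg S)) (\<lambda>\<omega>. restrict \<omega> (- \<Lambda>))
       (PiM (- \<Lambda>) (\<lambda>_. count_space S))"

text \<open>Classical potential: Psi A is evaluated on configurations in A ->E S.\<close>
definition classical_potential :: "real set \<Rightarrow> ((int^'d) set \<Rightarrow> ((int^'d) \<Rightarrow> real) \<Rightarrow> real) \<Rightarrow> bool" where
  "classical_potential S \<Psi> \<longleftrightarrow>
     (\<forall>x\<in>{} \<rightarrow>\<^sub>E S. \<Psi> {} x = 0) \<and>
     (\<forall>A i. finite A \<longrightarrow> (\<forall>x\<in>transl i A \<rightarrow>\<^sub>E S. \<Psi> (transl i A) x = \<Psi> A (\<lambda>j\<in>A. x (j + i))))"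

text \<open>norm_0(Psi) < infinity.\<close>
definition potential_norm0_finite :: "real set \<Rightarrow> ((int^'d) set \<Rightarrow> ((int^'d) \<Rightarrow> real) \<Rightarrow> real) \<Rightarrow> bool" where
  "potential_norm0_finite S \<Psi> \<longleftrightarrow>
     (\<lambda>A. SUP x\<in>A \<rightarrow>\<^sub>E S. \<bar>\<Psi> A x\<bar>) summable_on {A. finite A \<and> 0 \<in> A}"

definition energy :: "((int^'d) set \<Rightarrow> ((int^'d) \<Rightarrow> real) \<Rightarrow> real) \<Rightarrow> (int^'d) set \<Rightarrow> ((int^'d) \<Rightarrow> real) \<Rightarrow> real" where
  "energy \<Psi> \<Lambda> x = (\<Sum>\<^sub>\<infinity>A\<in>{A. finite A \<and> A \<inter> \<Lambda> \<noteq> {}}. \<Psi> A (restrict x A))"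

definition merge_cfg :: "(int^'d) set \<Rightarrow> ((int^'d) \<Rightarrow> real) \<Rightarrow> ((int^'d) \<Rightarrow> real) \<Rightarrow> ((int^'d) \<Rightarrow> real)" where
  "merge_cfg \<Lambda> \<xi> \<omega> = (\<lambda>i. if i \<in> \<Lambda> then \<xi> i else \<omega> i)"

definition gibbs_spec :: "real set \<Rightarrow> ((int^'d) set \<Rightarrow> ((int^'d) \<Rightarrow> real) \<Rightarrow> real) \<Rightarrow> (int^'d) set
     \<Rightarrow> ((int^'d) \<Rightarrow> real) \<Rightarrow> ((int^'d) \<Rightarrow> real) \<Rightarrow> real" where
  "gibbs_spec S \<Psi> \<Lambda> \<xi> \<omega> =
     exp (- energy \<Psi> \<Lambda> (merge_cfg \<Lambda> \<xi> \<omega>)) /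
     (\<Sum>\<xi>'\<in>\<Lambda> \<rightarrow>\<^sub>E S. exp (- energy \<Psi> \<Lambda> (merge_cfg \<Lambda> \<xi>' \<omega>)))"

text \<open>Gibbsian measure: DLR equations, conditional probabilities as conditional expectations.\<close>
definition gibbsian :: "real set \<Rightarrow> ((int^'d) \<Rightarrow> real) measure \<Rightarrow> bool" where
  "gibbsian S \<mu> \<longleftrightarrow>
     (\<exists>\<Psi>. classical_potential S \<Psi> \<and> potential_norm0_finite S \<Psi> \<and>
        (\<forall>\<Lambda>. finite \<Lambda> \<longrightarrow> (\<forall>\<xi>\<in>\<Lambda> \<rightarrow>\<^sub>E S.
           AE \<omega> in \<mu>. real_cond_exp \<mu> (outside_alg S \<Lambda>) (indicator (cyl S \<Lambda> \<xi>)) \<omega>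
                        = gibbs_spec S \<Psi> \<Lambda> \<xi> \<omega>)))"

end

theory Submission
  imports Defs
begin

text \<open>
  For labels \<open>y\<close> attaching to every site either a spectral projection of \<open>X\<close> or the identity, the
  normalised weight \<open>Z\<^sub>\<Lambda>(y) = \<rho>\<^sub>y(e\<^bsup>-\<beta>H\<^esup>)\<close> is the expectation of \<open>e\<^bsup>-\<beta>H\<^esup>\<close> in a product state.
  Expectations of products of interaction terms factorise over connected components, so
  \<open>Z\<close> is the partition function of a polymer gas, and at small \<open>\<beta>\<close> a Kotecky-Preiss argument
  shows that the Moebius coefficients \<open>\<psi>\<^sub>A(y)\<close> of \<open>\<Lambda> \<mapsto> ln (Z\<^sub>\<Lambda>(y) \<Prod>\<^sub>i tr P(y\<^sub>i))\<close> are absolutely summable over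
  \<open>A \<ni> 0\<close>, uniformly in \<open>y\<close>. The argument is carried out on Moebius coefficients directly:
  under pointwise multiplication of set functions they are convolved along unions, so the
  sum of their absolute values is submultiplicative.

  The unnormalised weight of a cylinder in the volume \<open>\<Lambda>\<close> is \<open>exp (\<Sum>\<^bsub>A \<subseteq> \<Lambda>\<^esub> \<psi>\<^sub>A(y))\<close>, where \<open>y\<close> is the identity off the
  cylinder base. Summability gives the thermodynamic limit, and comparing two cylinders that
  differ only inside a finite set gives the DLR equations for the potential \<open>-\<psi>\<close>
  restricted to labels that are spectral projections everywhere.
\<close>

section \<open>Set functions and their Moebius coefficients\<close>

text \<open>Their place is taken by Moebius coefficients in the family of retained terms: only words
  that use every member of the family survive, and these are bounded by the coefficients of a
  commuting scalar model, the products of \<open>exp (\<beta> * hnorm A) - 1\<close>. Moebius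
  inversion thus acts on two levels, over families of supports and over sets of sites. The labels
  enter through states: a word of interaction terms, tested in a product state with densities P / tr
  P, is bounded by the product of its norms whatever the projections are. Hence one \<beta> serves
  all X. Dividing by the traces also makes free sites contribute 1; the logarithms of the traces
  return as one-site terms. The identity label turns marginalisation into relabelling: summing over
  a spin is the same as writing \<open>None\<close>. Partition function, cylinder weights and
  conditional weights are then values of one function. \<open>None\<close> disappears from the final
  potential because the coefficient at A sees only the labels in A, and a growing box eventually
  covers A.\<close>

definition mob :: "('a set \<Rightarrow> real) \<Rightarrow> 'a set \<Rightarrow> real" where
  "mob f A = (\<Sum>B\<in>Pow A. (-1) ^ (card A - card B) * f B)"

text \<open>The working form of Moebius inversion: most coefficients below are found by guessing
  \<open>g\<close> and summing it back over subsets.\<close>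

lemma mob_unique:
  assumes "finite A" and "\<And>B. B \<subseteq> A \<Longrightarrow> f B = (\<Sum>C\<in>Pow B. g C)"
  shows "mob f A = g A"
proof -
  have "g A = (\<Sum>T\<in>Pow A. (-1) ^ (card A - card T) * sum g (Pow T))"
    by (rule inclusion_exclusion_mobius) (use assms in auto)
  also have "\<dots> = mob f A"
    unfolding mob_def by (intro sum.cong refl) (use assms in auto)
  finally show ?thesis by simp
qed

lemma sum_mob:
  assumes "finite A"
  shows "(\<Sum>B\<in>Pow A. mob f B) = f A"
proof -
  define g where "g S = (\<Sum>T\<in>Pow S. (-1) ^ card T * f T)" for S :: "'a set"
  have "f A = (\<Sum>T\<in>Pow A. (-1) ^ card T * g T)"
    by (rule inclusion_exclusion_symmetric) (auto simp: g_def assms)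
  also have "\<dots> = (\<Sum>B\<in>Pow A. mob f B)"
  proof (intro sum.cong refl)
    fix T assume "T \<in> Pow A"
    then have T: "finite T" using assms finite_subset by auto
    have "mob f T = (\<Sum>B\<in>Pow T. (-1) ^ card T * ((-1) ^ card B * f B))"
      unfolding mob_def
    proof (intro sum.cong refl)
      fix B assume "B \<in> Pow T"
      then have "card B \<le> card T" using T card_mono by auto
      then show "(-1) ^ (card T - card B) * f B = (-1) ^ card T * ((-1) ^ card B * f B)"
        by (metis mult.assoc neg_one_power_add_eq_neg_one_power_diff power_add)
    qed
    then show "(-1) ^ card T * g T = mob f T"
      by (simp add: g_def sum_distrib_left)
  qed
  finally show ?thesis by simp
qed

lemma mob_cong:
  assumes "\<And>B. B \<subseteq> A \<Longrightarrow> f B = g B"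
  shows "mob f A = mob g A"
  unfolding mob_def by (intro sum.cong refl) (use assms in auto)

lemma mob_add: "mob (\<lambda>B. f B + g B) A = mob f A + mob g A"
  unfolding mob_def by (simp add: sum.distrib algebra_simps)

lemma mob_scale: "mob (\<lambda>B. c * f B) A = c * mob f A"
  unfolding mob_def by (simp add: sum_distrib_left mult_ac)

lemma mob_sum: "mob (\<lambda>B. \<Sum>i\<in>I. f i B) A = (\<Sum>i\<in>I. mob (f i) A)"
  by (induction I rule: infinite_finite_induct) (auto simp: mob_add, auto simp: mob_def)

text \<open>Coefficients at sets through x are those of the discrete derivative in x. For f = ln Z
  this derivative is the logarithm of a ratio of partition functions, which is what the polymer
  recursion controls.\<close>

lemma mob_insert:
  assumes "finite A" "x \<notin> A"
  shows "mob f (insert x A) = mob (\<lambda>B. f (insert x B) - f B) A"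
proof (rule mob_unique[symmetric, OF assms(1)])
  fix B assume "B \<subseteq> A"
  then have B: "finite B" "x \<notin> B" using assms finite_subset by auto
  have "f (insert x B) = (\<Sum>C\<in>Pow (insert x B). mob f C)"
    using B by (subst sum_mob) auto
  also have "\<dots> = (\<Sum>C\<in>Pow B. mob f C) + (\<Sum>C\<in>insert x ` Pow B. mob f C)"
    unfolding Pow_insert using B by (subst sum.union_disjoint) auto
  also have "(\<Sum>C\<in>insert x ` Pow B. mob f C) = (\<Sum>C\<in>Pow B. mob f (insert x C))"
    using B by (subst sum.reindex) (auto simp: inj_on_def)
  finally show "f (insert x B) - f B = (\<Sum>C\<in>Pow B. mob f (insert x C))"
    using sum_mob[OF B(1), of f] by simp
qed

text \<open>Both factors are expanded over subsets of D and the pairs are grouped by their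
  union.\<close>

lemma mob_mult:
  assumes "finite A"
  shows "mob (\<lambda>B. f B * g B) A = (\<Sum>(B, C)\<in>{(B, C). B \<subseteq> A \<and> C \<subseteq> A \<and> B \<union> C = A}. mob f B * mob g C)"
proof (rule mob_unique[OF assms])
  fix D assume "D \<subseteq> A"
  then have D: "finite D" using assms finite_subset by auto
  have "f D * g D = (\<Sum>(B,C)\<in>Pow D \<times> Pow D. mob f B * mob g C)"
    by (subst (1 2) sum_mob[OF D, symmetric]) (simp add: sum_product sum.cartesian_product)
  also have "\<dots> = (\<Sum>E\<in>Pow D. \<Sum>p\<in>{p\<in>Pow D \<times> Pow D. fst p \<union> snd p = E}. case p of (B,C) \<Rightarrow> mob f B * mob g C)"
    by (rule sum.group[symmetric]) (use D in auto)
  also have "\<dots> = (\<Sum>E\<in>Pow D. \<Sum>(B, C)\<in>{(B, C). B \<subseteq> E \<and> C \<subseteq> E \<and> B \<union> C = E}. mob f B * mob g C)"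
    by (intro sum.cong refl) auto
  finally show "f D * g D = \<dots>" .
qed

lemma mob_Diff:
  assumes "finite A"
  shows "mob (\<lambda>B. f (B - Y)) A = (if A \<inter> Y = {} then mob f A else 0)"
proof (rule mob_unique[OF assms])
  fix B assume "B \<subseteq> A"
  then have B: "finite B" using assms finite_subset by auto
  have "f (B - Y) = (\<Sum>C\<in>Pow (B - Y). mob f C)" using B by (simp add: sum_mob)
  also have "\<dots> = (\<Sum>C\<in>Pow B. if C \<inter> Y = {} then mob f C else 0)"
    by (rule sum.mono_neutral_cong_left) (use B in auto)
  finally show "f (B - Y) = \<dots>" .
qed

lemma mob_superset:
  assumes "finite A"
  shows "mob (\<lambda>B. of_bool (C \<subseteq> B)) A = of_bool (A = C)"
proof (rule mob_unique[OF assms])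
  fix B assume "B \<subseteq> A"
  then have B: "finite B" using assms finite_subset by auto
  show "of_bool (C \<subseteq> B) = (\<Sum>D\<in>Pow B. of_bool (D = C))"
    using B by (simp add: of_bool_def sum.delta)
qed

lemma mob_const:
  assumes "finite A"
  shows "mob (\<lambda>B. c) A = (if A = {} then c else 0)"
proof (rule mob_unique[OF assms])
  fix B assume "B \<subseteq> A"
  then have B: "finite B" using assms finite_subset by auto
  show "c = (\<Sum>D\<in>Pow B. if D = {} then c else 0)"
    using B by (simp add: sum.delta)
qed

lemma mob_additive:
  assumes "finite A"
  shows "mob (\<lambda>B. \<Sum>i\<in>B. c i) A = (if is_singleton A then c (the_elem A) else 0)"
proof (rule mob_unique[OF assms])
  fix B assume "B \<subseteq> A"
  then have B: "finite B" using assms finite_subset by auto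
  have "(\<Sum>D\<in>Pow B. if is_singleton D then c (the_elem D) else 0)
      = (\<Sum>D\<in>(\<lambda>i. {i}) ` B. c (the_elem D))"
    by (rule sum.mono_neutral_cong_right) (use B in \<open>auto simp: is_singleton_def\<close>)
  also have "\<dots> = (\<Sum>i\<in>B. c i)" by (subst sum.reindex) auto
  finally show "(\<Sum>i\<in>B. c i) = (\<Sum>D\<in>Pow B. if is_singleton D then c (the_elem D) else 0)" by simp
qed

text \<open>Moebius coefficients multiply by union-convolution, so this majorization is preserved by
  products and power series; the value of the majorant at \<open>L\<close> bounds the sum of the
  absolute values of the coefficients over the subsets of \<open>L\<close>.\<close>

definition maj :: "'a set \<Rightarrow> ('a set \<Rightarrow> real) \<Rightarrow> ('a set \<Rightarrow> real) \<Rightarrow> bool" where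
  "maj L f g \<longleftrightarrow> (\<forall>A\<subseteq>L. \<bar>mob f A\<bar> \<le> mob g A)"

lemma maj_cong:
  assumes "maj L f g" and "\<And>B. B \<subseteq> L \<Longrightarrow> f' B = f B" and "\<And>B. B \<subseteq> L \<Longrightarrow> g' B = g B"
  shows "maj L f' g'"
  unfolding maj_def
proof (intro allI impI)
  fix A assume A: "A \<subseteq> L"
  have "mob f' A = mob f A" "mob g' A = mob g A"
    by (rule mob_cong, use assms A in auto)+
  then show "\<bar>mob f' A\<bar> \<le> mob g' A" using assms(1) A by (simp add: maj_def)
qed

lemma maj_abs_le:
  assumes "maj L f g" "finite L" "B \<subseteq> L"
  shows "\<bar>f B\<bar> \<le> g B"
proof -
  have B: "finite B" using assms finite_subset by auto
  have "\<bar>\<Sum>A\<in>Pow B. mob f A\<bar> \<le> (\<Sum>A\<in>Pow B. mob g A)"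
    by (rule order_trans[OF sum_abs]) (rule sum_mono, use assms in \<open>auto simp: maj_def\<close>)
  then show ?thesis using B by (simp add: sum_mob)
qed

text \<open>A majorant has nonnegative coefficients inside L, so its value grows with the set. A
  single bound at L therefore ensures convergence of the power series below on all subsets of
  L.\<close>

lemma maj_mono_value:
  assumes "maj L f g" "finite L" "B \<subseteq> L"
  shows "g B \<le> g L"
proof -
  have B: "finite B" using assms finite_subset by auto
  have "(\<Sum>A\<in>Pow B. mob g A) \<le> (\<Sum>A\<in>Pow L. mob g A)"
  proof (rule sum_mono2)
    show "0 \<le> mob g A" if "A \<in> Pow L - Pow B" for A
      using that assms(1) unfolding maj_def by (meson DiffD1 PowD abs_ge_zero order_trans)
  qed (use assms in auto)
  then show ?thesis using B assms by (simp add: sum_mob)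
qed

lemma maj_sum:
  assumes "\<And>i. i \<in> I \<Longrightarrow> maj L (f i) (g i)"
  shows "maj L (\<lambda>B. \<Sum>i\<in>I. f i B) (\<lambda>B. \<Sum>i\<in>I. g i B)"
  unfolding maj_def mob_sum
proof (intro allI impI)
  fix A assume "A \<subseteq> L"
  then show "\<bar>\<Sum>i\<in>I. mob (f i) A\<bar> \<le> (\<Sum>i\<in>I. mob (g i) A)"
    by (intro order_trans[OF sum_abs] sum_mono) (use assms in \<open>auto simp: maj_def\<close>)
qed

lemma maj_scale:
  assumes "maj L f g" "\<bar>c\<bar> \<le> d"
  shows "maj L (\<lambda>B. c * f B) (\<lambda>B. d * g B)"
  unfolding maj_def mob_scale abs_mult
proof (intro allI impI)
  fix A assume "A \<subseteq> L"
  then have "\<bar>mob f A\<bar> \<le> mob g A" using assms by (auto simp: maj_def)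
  then show "\<bar>c\<bar> * \<bar>mob f A\<bar> \<le> d * mob g A"
    using assms(2) by (intro mult_mono) auto
qed

lemma maj_mult:
  assumes "finite L" "maj L f g" "maj L f' g'"
  shows "maj L (\<lambda>B. f B * f' B) (\<lambda>B. g B * g' B)"
  unfolding maj_def
proof (intro allI impI)
  fix A assume A: "A \<subseteq> L"
  then have fA: "finite A" using assms(1) finite_subset by blast
  show "\<bar>mob (\<lambda>B. f B * f' B) A\<bar> \<le> mob (\<lambda>B. g B * g' B) A"
    unfolding mob_mult[OF fA]
  proof (intro order_trans[OF sum_abs] sum_mono)
    fix p assume "p \<in> {(B, C). B \<subseteq> A \<and> C \<subseteq> A \<and> B \<union> C = A}"
    then obtain B C where p: "p = (B, C)" "B \<subseteq> L" "C \<subseteq> L" using A by auto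
    then have "\<bar>mob f B\<bar> \<le> mob g B" "\<bar>mob f' C\<bar> \<le> mob g' C"
      using assms(2,3) by (auto simp: maj_def)
    then have "\<bar>mob f B\<bar> * \<bar>mob f' C\<bar> \<le> mob g B * mob g' C"
      by (intro mult_mono) auto
    then show "\<bar>case p of (B, C) \<Rightarrow> mob f B * mob f' C\<bar> \<le> (case p of (B, C) \<Rightarrow> mob g B * mob g' C)"
      by (simp add: p abs_mult)
  qed
qed

lemma maj_one: "finite L \<Longrightarrow> maj L (\<lambda>B. 1) (\<lambda>B. 1)"
  unfolding maj_def by (auto simp: mob_const finite_subset)

lemma maj_superset: "finite L \<Longrightarrow> maj L (\<lambda>B. of_bool (C \<subseteq> B)) (\<lambda>B. of_bool (C \<subseteq> B))"
  unfolding maj_def by (auto simp: mob_superset finite_subset)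

text \<open>Coefficients of \<open>f (B - Y)\<close> at sets meeting Y vanish, so a majorization on
  \<open>L - Y\<close> is enough. This is how the induction hypothesis for a smaller set is lifted
  back to L.\<close>

lemma maj_Diff:
  assumes "finite L" "maj (L - Y) f g"
  shows "maj L (\<lambda>B. f (B - Y)) (\<lambda>B. g (B - Y))"
  using assms unfolding maj_def by (auto simp: mob_Diff finite_subset)

lemma maj_power:
  assumes "finite L" "maj L f g"
  shows "maj L (\<lambda>B. f B ^ n) (\<lambda>B. g B ^ n)"
  by (induction n) (use assms in \<open>auto intro: maj_one maj_mult\<close>)

lemma mob_sums:
  assumes "finite A" "\<And>B. B \<subseteq> A \<Longrightarrow> (\<lambda>n. f n B) sums F B"
  shows "(\<lambda>n. mob (f n) A) sums mob F A"
  unfolding mob_def by (intro sums_sum sums_mult) (use assms in auto)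

lemma maj_sums:
  assumes "finite L" and "\<And>n. maj L (f n) (g n)"
    and "\<And>B. B \<subseteq> L \<Longrightarrow> (\<lambda>n. f n B) sums F B" and "\<And>B. B \<subseteq> L \<Longrightarrow> (\<lambda>n. g n B) sums G B"
  shows "maj L F G"
  unfolding maj_def
proof (intro allI impI)
  fix A assume A: "A \<subseteq> L"
  then have fA: "finite A" using assms(1) finite_subset by blast
  have F: "(\<lambda>n. mob (f n) A) sums mob F A" by (rule mob_sums[OF fA]) (use A assms in auto)
  have G: "(\<lambda>n. mob (g n) A) sums mob G A" by (rule mob_sums[OF fA]) (use A assms in auto)
  have le: "\<bar>mob (f n) A\<bar> \<le> mob (g n) A" for n using assms(2) A by (auto simp: maj_def)
  have "norm (suminf (\<lambda>n. mob (f n) A)) \<le> suminf (\<lambda>n. mob (g n) A)"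
    by (rule norm_suminf_le) (use le G in \<open>auto simp: sums_iff\<close>)
  then show "\<bar>mob F A\<bar> \<le> mob G A" using F G by (simp add: sums_iff)
qed

text \<open>Geometric series on both sides: the alternating sign of the n-th term has absolute value
  1 and disappears in the majorant.\<close>

lemma maj_inverse_one_plus:
  assumes "finite L" "maj L f g" "g L < 1"
  shows "maj L (\<lambda>B. 1 / (1 + f B)) (\<lambda>B. 1 / (1 - g B))"
proof (rule maj_sums[OF assms(1), where f = "\<lambda>n B. (-1) ^ n * f B ^ n" and g = "\<lambda>n B. 1 * g B ^ n"])
  show "maj L (\<lambda>B. (-1) ^ n * f B ^ n) (\<lambda>B. 1 * g B ^ n)" for n
    by (intro maj_scale maj_power assms) simp
  fix B assume B: "B \<subseteq> L"
  then have g: "\<bar>f B\<bar> \<le> g B" "g B < 1"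
    using maj_abs_le[OF assms(2,1) B] maj_mono_value[OF assms(2,1) B] assms(3) by auto
  show "(\<lambda>n. (-1) ^ n * f B ^ n) sums (1 / (1 + f B))"
    using geometric_sums[of "- f B"] g by (simp add: power_mult_distrib[symmetric])
  show "(\<lambda>n. 1 * g B ^ n) sums (1 / (1 - g B))"
    using geometric_sums[of "g B"] g by simp
qed

lemma maj_ln_one_plus:
  assumes "finite L" "maj L f g" "g L < 1"
  shows "maj L (\<lambda>B. ln (1 + f B)) (\<lambda>B. - ln (1 - g B))"
\<comment> \<open>For n = 0 the coefficient is a division by 0, which is 0, so both logarithmic
  series really start at n = 1.\<close>
proof (rule maj_sums[OF assms(1), where f = "\<lambda>n B. ((-1) ^ Suc n / of_nat n) * f B ^ n"
      and g = "\<lambda>n B. (1 / of_nat n) * g B ^ n"])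
  show "maj L (\<lambda>B. ((-1) ^ Suc n / of_nat n) * f B ^ n) (\<lambda>B. (1 / of_nat n) * g B ^ n)" for n
    by (intro maj_scale maj_power assms) (simp add: power_abs)
  fix B assume B: "B \<subseteq> L"
  then have g: "\<bar>f B\<bar> \<le> g B" "g B < 1"
    using maj_abs_le[OF assms(2,1) B] maj_mono_value[OF assms(2,1) B] assms(3) by auto
  show "(\<lambda>n. ((-1) ^ Suc n / of_nat n) * f B ^ n) sums ln (1 + f B)"
    using ln_series'[of "f B"] g by (simp add: power_minus[of "f B"])
  show "(\<lambda>n. (1 / of_nat n) * g B ^ n) sums (- ln (1 - g B))"
    using sums_minus[OF ln_series'[of "- g B"]] g by simp
qed

section \<open>Polymer gases\<close>

text \<open>\<open>Z_insert\<close> sorts configurations by the cluster of x: \<open>G\<close> is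
  the rest of that cluster, and the bare term \<open>Z i L\<close> stands for an x that belongs to
  none. \<open>W_sum\<close> is the Kotecky-Preiss condition. Its right-hand side reproduces itself:
  if the ratio minus 1 is at most 1 - exp(-a), its inverse is at most exp(a), so deleting the sites
  of \<open>G\<close> costs at most \<open>exp (a * card G)\<close>, the factor in the
  condition.\<close>

locale polymer_gas =
  fixes Z :: "'i \<Rightarrow> 'a set \<Rightarrow> real" and w :: "'i \<Rightarrow> 'a \<Rightarrow> 'a set \<Rightarrow> real"
    and W :: "'a \<Rightarrow> 'a set \<Rightarrow> real" and a :: real
  assumes Z_empty: "Z i {} = 1"
    and Z_insert: "finite L \<Longrightarrow> x \<notin> L \<Longrightarrow>
          Z i (insert x L) = Z i L + (\<Sum>G\<in>Pow L. w i x G * Z i (L - G))"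
    and w_le: "finite G \<Longrightarrow> x \<notin> G \<Longrightarrow> \<bar>w i x G\<bar> \<le> W x G"
    and W_sum: "finite L \<Longrightarrow> x \<notin> L \<Longrightarrow> (\<Sum>G\<in>Pow L. W x G * exp (a * card G)) \<le> 1 - exp (- a)"
begin

text \<open>The majorant must not depend on \<open>i\<close>: this is what makes the final bound uniform in the labels.\<close>

lemma ratio_majorant:
  assumes "finite L"
  shows "(\<forall>i. \<forall>B\<subseteq>L. Z i B > 0) \<and>
    (\<forall>x. x \<notin> L \<longrightarrow> (\<exists>u. (\<forall>i. maj L (\<lambda>B. Z i (insert x B) / Z i B - 1) u) \<and> u L \<le> 1 - exp (- a)))"
  using assms
proof (induction L rule: finite_psubset_induct)
  case (psubset L)
  \<comment> \<open>One site y is taken off L; by induction the ratio of the two partition functions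
    differs from 1 by less than 1, so positivity is inherited from \<open>L'\<close>.\<close>
  have pos: "Z i B > 0" if B: "B \<subseteq> L" for i B
  proof (cases "B = L")
    case False
    then show ?thesis using B psubset.IH[of B] by blast
  next
    case True
    show ?thesis
    proof (cases "L = {}")
      case True
      then show ?thesis using \<open>B = L\<close> by (simp add: Z_empty)
    next
      case False
      then obtain y L' where y: "L = insert y L'" "y \<notin> L'" by (meson Set.set_insert ex_in_conv)
      then have L': "L' \<subset> L" "finite L'" using psubset.hyps by auto
      obtain u where u: "maj L' (\<lambda>B. Z i (insert y B) / Z i B - 1) u" "u L' \<le> 1 - exp (- a)"
        using psubset.IH[OF L'(1)] y(2) by blast
      have "\<bar>Z i L / Z i L' - 1\<bar> \<le> u L'" using maj_abs_le[OF u(1) L'(2) order_refl] y by simp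
      also have "\<dots> < 1" using u(2) exp_gt_zero[of "- a"] by linarith
      finally have "0 < Z i L / Z i L'" by linarith
      moreover have "0 < Z i L'" using psubset.IH[OF L'(1)] by blast
      ultimately show ?thesis using \<open>B = L\<close> by (simp add: zero_less_divide_iff)
    qed
  qed
  \<comment> \<open>Removing G from B telescopes over the sites of G, each step costing a factor
    exp(a). The indicator makes the ratio a function on all subsets of L, to which union-convolution
    applies.\<close>
  have q: "\<exists>q. (\<forall>i. maj L (\<lambda>B. of_bool (G \<subseteq> B) * (Z i (B - G) / Z i B)) q) \<and> q L \<le> exp (a * card G)"
    if G: "G \<subseteq> L" for G
    using finite_subset[OF G psubset.hyps] G
  proof (induction G rule: finite_induct)
    case empty
    have "maj L (\<lambda>B. of_bool ({} \<subseteq> B) * (Z i (B - {}) / Z i B)) (\<lambda>B. 1)" for i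
      by (rule maj_cong[OF maj_one[OF psubset.hyps]]) (use pos in \<open>auto simp: less_imp_neq[symmetric]\<close>)
    then show ?case by (intro exI[of _ "\<lambda>B. 1"]) auto
  next
    case (insert y G)
    then obtain q where q: "\<And>i. maj L (\<lambda>B. of_bool (G \<subseteq> B) * (Z i (B - G) / Z i B)) q"
      "q L \<le> exp (a * card G)" by auto
    let ?Y = "insert y G"
    have Lp: "L - ?Y \<subset> L" "finite (L - ?Y)" "y \<notin> L - ?Y" using insert psubset.hyps by auto
    obtain u where u: "\<And>i. maj (L - ?Y) (\<lambda>B. Z i (insert y B) / Z i B - 1) u"
      "u (L - ?Y) \<le> 1 - exp (- a)"
      using psubset.IH[OF Lp(1)] Lp(3) by blast
    have u1: "u (L - ?Y) < 1" using u(2) exp_gt_zero[of "- a"] by linarith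
    \<comment> \<open>\<open>?F\<close> at \<open>B - ?Y\<close> is the inverse ratio for putting y
      back: numerator without \<open>?Y\<close>, denominator without G. Its majorant comes from the
      induction hypothesis on \<open>L - ?Y\<close>, a proper subset of L because y is in L.\<close>
    let ?F = "\<lambda>i B. 1 / (1 + (Z i (insert y B) / Z i B - 1))" and ?g = "\<lambda>B. 1 / (1 - u B)"
    have mF: "maj (L - ?Y) (?F i) ?g" for i
      by (rule maj_inverse_one_plus[OF Lp(2) u(1) u1])
    let ?q = "\<lambda>B. of_bool ({y} \<subseteq> B) * (?g (B - ?Y) * q B)"
    have "maj L (\<lambda>B. of_bool (?Y \<subseteq> B) * (Z i (B - ?Y) / Z i B)) ?q" for i
    proof (rule maj_cong[where f = "\<lambda>B. of_bool ({y} \<subseteq> B) *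
          (?F i (B - ?Y) * (of_bool (G \<subseteq> B) * (Z i (B - G) / Z i B)))" and g = ?q])
      show "maj L (\<lambda>B. of_bool ({y} \<subseteq> B) *
          (?F i (B - ?Y) * (of_bool (G \<subseteq> B) * (Z i (B - G) / Z i B)))) ?q"
        by (intro maj_mult maj_superset maj_Diff[where f = "?F i" and g = ?g] mF q psubset.hyps)
      fix B assume B: "B \<subseteq> L"
      show "of_bool (?Y \<subseteq> B) * (Z i (B - ?Y) / Z i B) = of_bool ({y} \<subseteq> B) *
          (?F i (B - ?Y) * (of_bool (G \<subseteq> B) * (Z i (B - G) / Z i B)))"
      proof (cases "y \<in> B \<and> G \<subseteq> B")
        case True
        then have "insert y (B - ?Y) = B - G" using insert.hyps by auto
        moreover have "Z i (B - ?Y) > 0" "Z i B > 0" "Z i (B - G) > 0" by (rule pos, use B in blast)+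
        ultimately show ?thesis using True by (simp add: field_simps)
      qed auto
    qed simp
    moreover have "?q L \<le> exp (a * card ?Y)"
    proof -
      have "?g (L - ?Y) \<le> 1 / exp (- a)"
        using u(2) u1 by (intro divide_left_mono) (auto simp: mult_pos_pos)
      then have 1: "?g (L - ?Y) \<le> exp a" by (simp add: exp_minus field_simps)
      have 2: "0 \<le> q L" using maj_abs_le[OF q(1) psubset.hyps order_refl] abs_ge_zero order_trans by blast
      have "?q L = ?g (L - ?Y) * q L" using insert.prems by simp
      also have "\<dots> \<le> exp a * exp (a * card G)"
        using 1 2 q(2) by (intro mult_mono) auto
      also have "\<dots> = exp (a * card ?Y)" using insert.hyps by (simp add: exp_add[symmetric] algebra_simps)
      finally show ?thesis .
    qed
    ultimately show ?case by blast
  qed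
  then obtain q where q: "\<And>G i. G \<subseteq> L \<Longrightarrow> maj L (\<lambda>B. of_bool (G \<subseteq> B) * (Z i (B - G) / Z i B)) (q G)"
    "\<And>G. G \<subseteq> L \<Longrightarrow> q G L \<le> exp (a * card G)"
    by metis
  have "\<exists>u. (\<forall>i. maj L (\<lambda>B. Z i (insert x B) / Z i B - 1) u) \<and> u L \<le> 1 - exp (- a)" if x: "x \<notin> L" for x
  proof (intro exI conjI allI)
    \<comment> \<open>This is the recursion \<open>Z_insert\<close> divided by \<open>Z i B\<close>,
      with \<open>w\<close> replaced by its bound and each ratio by its majorant. The sum runs over
      all G in L; the indicator inside the ratio keeps only those in B.\<close>
    let ?u = "\<lambda>B. \<Sum>G\<in>Pow L. W x G * q G B"
    have fin: "finite G" if "G \<subseteq> L" for G using that psubset.hyps finite_subset by blast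
    have W: "\<bar>w i x G\<bar> \<le> W x G" if "G \<subseteq> L" for i G using w_le[of G x i] fin[OF that] that x by blast
    show "maj L (\<lambda>B. Z i (insert x B) / Z i B - 1) ?u" for i
    proof (rule maj_cong[where f = "\<lambda>B. \<Sum>G\<in>Pow L. w i x G * (of_bool (G \<subseteq> B) * (Z i (B - G) / Z i B))" and g = ?u])
      show "maj L (\<lambda>B. \<Sum>G\<in>Pow L. w i x G * (of_bool (G \<subseteq> B) * (Z i (B - G) / Z i B))) ?u"
        by (intro maj_sum maj_scale q W) auto
      fix B assume B: "B \<subseteq> L"
      have "(\<Sum>G\<in>Pow L. w i x G * (of_bool (G \<subseteq> B) * (Z i (B - G) / Z i B)))
          = (\<Sum>G\<in>Pow B. w i x G * Z i (B - G) / Z i B)"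
        by (rule sum.mono_neutral_cong_right) (use B psubset.hyps in auto)
      also have "\<dots> = (Z i (insert x B) - Z i B) / Z i B"
      proof -
        have "x \<notin> B" using x B by blast
        then show ?thesis by (simp add: Z_insert[OF fin[OF B]] sum_divide_distrib)
      qed
      also have "\<dots> = Z i (insert x B) / Z i B - 1"
        using pos[OF B, of i] by (simp add: diff_divide_distrib)
      finally show "Z i (insert x B) / Z i B - 1 =
          (\<Sum>G\<in>Pow L. w i x G * (of_bool (G \<subseteq> B) * (Z i (B - G) / Z i B)))" by simp
    qed simp
    have "?u L \<le> (\<Sum>G\<in>Pow L. W x G * exp (a * card G))"
      using W q(2) by (intro sum_mono mult_left_mono) (auto intro: order_trans[OF abs_ge_zero])
    also have "\<dots> \<le> 1 - exp (- a)" using W_sum[OF psubset.hyps x] .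
    finally show "?u L \<le> 1 - exp (- a)" .
  qed
  with pos show ?case by blast
qed

lemma Z_pos: "finite L \<Longrightarrow> Z i L > 0"
  using ratio_majorant by blast

text \<open>By \<open>mob_insert\<close> the coefficients at sets through x are those of ln (1 +
  (ratio - 1)). The logarithmic series majorizes them by -ln (1 - u), whose coefficients sum to -ln
  (1 - u L), and u L \<le> 1 - exp(-a) makes this at most a.\<close>

theorem mob_ln_majorant:
  assumes "finite L" "x \<notin> L"
  obtains g where "\<And>i A. A \<subseteq> L \<Longrightarrow> \<bar>mob (\<lambda>B. ln (Z i B)) (insert x A)\<bar> \<le> g A" "(\<Sum>A\<in>Pow L. g A) \<le> a"
proof -
  obtain u where u: "\<And>i. maj L (\<lambda>B. Z i (insert x B) / Z i B - 1) u" "u L \<le> 1 - exp (- a)"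
    using ratio_majorant[OF assms(1)] assms(2) by blast
  have u1: "u L < 1" using u(2) exp_gt_zero[of "- a"] by linarith
  let ?g = "\<lambda>B. - ln (1 - u B)"
  show thesis
  proof
    fix i A assume A: "A \<subseteq> L"
    have fA: "finite A" "x \<notin> A" using A assms finite_subset by auto
    have "maj L (\<lambda>B. ln (1 + (Z i (insert x B) / Z i B - 1))) ?g"
      by (rule maj_ln_one_plus[OF assms(1) u(1) u1])
    then have "\<bar>mob (\<lambda>B. ln (1 + (Z i (insert x B) / Z i B - 1))) A\<bar> \<le> mob ?g A"
      using A by (auto simp: maj_def)
    moreover have "mob (\<lambda>B. ln (1 + (Z i (insert x B) / Z i B - 1))) A
        = mob (\<lambda>B. ln (Z i (insert x B)) - ln (Z i B)) A"
    proof (rule mob_cong)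
      fix B assume "B \<subseteq> A"
      then have "finite B" "finite (insert x B)" using fA finite_subset by auto
      then have "Z i B > 0" "Z i (insert x B) > 0" by (auto intro: Z_pos)
      then show "ln (1 + (Z i (insert x B) / Z i B - 1)) = ln (Z i (insert x B)) - ln (Z i B)"
        by (simp add: ln_div)
    qed
    ultimately show "\<bar>mob (\<lambda>B. ln (Z i B)) (insert x A)\<bar> \<le> mob ?g A"
      using mob_insert[OF fA, of "\<lambda>B. ln (Z i B)"] by simp
  next
    have "(\<Sum>A\<in>Pow L. mob ?g A) = - ln (1 - u L)" by (simp add: sum_mob assms)
    moreover have "ln (exp (- a)) \<le> ln (1 - u L)" using u(2) u1 by (subst ln_le_cancel_iff) auto
    ultimately show "(\<Sum>A\<in>Pow L. mob ?g A) \<le> a" by simp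
  qed
qed

end

section \<open>Families of sets and connected clusters\<close>

text \<open>Connectedness is expressed by sets whose boundary no member crosses, not by chains of
  overlapping members; hulls are then plain intersections.\<close>

definition saturated :: "'a set \<Rightarrow> 'a set set \<Rightarrow> bool" where
  "saturated G \<A> \<longleftrightarrow> (\<forall>A\<in>\<A>. A \<subseteq> G \<or> A \<inter> G = {})"

text \<open>If \<open>{} \<notin> \<A>\<close>, the saturated hull of \<open>Y\<close> consists of \<open>Y\<close> and the connected components of \<open>\<A>\<close>
  that meet \<open>Y\<close>.\<close>

definition sat_hull :: "'a set \<Rightarrow> 'a set set \<Rightarrow> 'a set" where
  "sat_hull Y \<A> = \<Inter>{G. Y \<subseteq> G \<and> saturated G \<A>}"

text \<open>For families without {} this means that every connected component meets Y.\<close>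

definition anchored :: "'a set \<Rightarrow> 'a set set \<Rightarrow> bool" where
  "anchored Y \<A> \<longleftrightarrow> \<Union>\<A> \<subseteq> sat_hull Y \<A>"

text \<open>The supports of all possible interaction terms in L. {} is left out because it is
  disjoint from itself: it could occur in two families with disjoint unions and spoil
  factorisation.\<close>

definition nePow :: "'a set \<Rightarrow> 'a set set" where
  "nePow L = Pow L - {{}}"

lemma finite_nePow [simp]: "finite L \<Longrightarrow> finite (nePow L)"
  by (simp add: nePow_def)

lemma subset_sat_hull: "Y \<subseteq> sat_hull Y \<A>"
  unfolding sat_hull_def by auto

lemma sat_hull_least: "Y \<subseteq> G \<Longrightarrow> saturated G \<A> \<Longrightarrow> sat_hull Y \<A> \<subseteq> G"
  unfolding sat_hull_def by auto

lemma saturated_sat_hull: "saturated (sat_hull Y \<A>) \<A>"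
  unfolding saturated_def
proof
  fix A assume A: "A \<in> \<A>"
  show "A \<subseteq> sat_hull Y \<A> \<or> A \<inter> sat_hull Y \<A> = {}"
  proof (cases "\<exists>G. Y \<subseteq> G \<and> saturated G \<A> \<and> A \<inter> G = {}")
    case True
    then show ?thesis using sat_hull_least by blast
  next
    case False
    then show ?thesis using A unfolding sat_hull_def saturated_def by blast
  qed
qed

lemma saturated_mono: "saturated G \<A> \<Longrightarrow> \<B> \<subseteq> \<A> \<Longrightarrow> saturated G \<B>"
  unfolding saturated_def by auto

lemma sat_hull_mono: "\<B> \<subseteq> \<A> \<Longrightarrow> sat_hull Y \<B> \<subseteq> sat_hull Y \<A>"
  by (meson sat_hull_least saturated_mono saturated_sat_hull subset_sat_hull)

lemma anchored_empty:
  assumes "anchored {} \<A>" "{} \<notin> \<A>"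
  shows "\<A> = {}"
proof -
  have "sat_hull {} \<A> \<subseteq> {}" by (rule sat_hull_least) (auto simp: saturated_def)
  with assms show ?thesis unfolding anchored_def by (metis Sup_bot_conv(1) equals0I subset_empty)
qed

text \<open>A component that hung on y alone now hangs on the other points of the removed sets, so
  these become anchors.\<close>

lemma anchored_peel:
  assumes "anchored Y \<A>"
  shows "anchored ((Y \<union> \<Union>{A\<in>\<A>. y \<in> A}) - {y}) {A\<in>\<A>. y \<notin> A}"
proof -
  let ?B = "{A\<in>\<A>. y \<notin> A}" and ?Y = "(Y \<union> \<Union>{A\<in>\<A>. y \<in> A}) - {y}"
  let ?G = "sat_hull ?Y ?B"
  have s: "saturated ?G ?B" "?Y \<subseteq> ?G" by (rule saturated_sat_hull, rule subset_sat_hull)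
  have "saturated (insert y ?G) \<A>"
    unfolding saturated_def
  proof
    fix A assume A: "A \<in> \<A>"
    show "A \<subseteq> insert y ?G \<or> A \<inter> insert y ?G = {}"
    proof (cases "y \<in> A")
      case True
      then have "A - {y} \<subseteq> ?Y" using A by auto
      then show ?thesis using s(2) by blast
    next
      case False
      then show ?thesis using A s(1) unfolding saturated_def by blast
    qed
  qed
  moreover have "Y \<subseteq> insert y ?G" using s(2) by blast
  ultimately have "\<Union>\<A> \<subseteq> insert y ?G"
    using assms sat_hull_least unfolding anchored_def by blast
  then show ?thesis unfolding anchored_def by blast
qed

section \<open>Summation over anchored families\<close>

lemma sum_Pow_prod:
  fixes f :: "'a \<Rightarrow> real"
  assumes "finite U"
  shows "(\<Sum>S\<in>Pow U. \<Prod>A\<in>S. f A) = (\<Prod>A\<in>U. 1 + f A)"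
  using assms
proof (induction U rule: finite_induct)
  case (insert x U)
  have "(\<Sum>S\<in>Pow (insert x U). \<Prod>A\<in>S. f A) = (\<Sum>S\<in>Pow U. \<Prod>A\<in>S. f A) + (\<Sum>S\<in>insert x ` Pow U. \<Prod>A\<in>S. f A)"
    unfolding Pow_insert using insert by (subst sum.union_disjoint) auto
  also have "(\<Sum>S\<in>insert x ` Pow U. \<Prod>A\<in>S. f A) = (\<Sum>S\<in>Pow U. \<Prod>A\<in>insert x S. f A)"
    using insert by (subst sum.reindex) (auto simp: inj_on_def)
  also have "\<dots> = f x * (\<Sum>S\<in>Pow U. \<Prod>A\<in>S. f A)"
    unfolding sum_distrib_left
  proof (intro sum.cong refl)
    fix S assume "S \<in> Pow U"
    then have "finite S" "x \<notin> S" using insert finite_subset by auto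
    then show "(\<Prod>A\<in>insert x S. f A) = f x * (\<Prod>A\<in>S. f A)" by simp
  qed
  finally show ?case using insert by (simp add: algebra_simps)
qed simp

lemma prod_one_plus_le_exp:
  fixes f :: "'a \<Rightarrow> real"
  assumes "\<And>A. A \<in> U \<Longrightarrow> 0 \<le> f A"
  shows "(\<Prod>A\<in>U. 1 + f A) \<le> exp (\<Sum>A\<in>U. f A)"
proof (cases "finite U")
  case True
  have "(\<Prod>A\<in>U. 1 + f A) \<le> (\<Prod>A\<in>U. exp (f A))"
    by (intro prod_mono) (use assms exp_ge_add_one_self in \<open>auto simp: add_nonneg_nonneg\<close>)
  then show ?thesis using True by (simp add: exp_sum)
qed simp

lemma prod_exp_card:
  fixes c :: real
  assumes "finite \<A>"
  shows "(\<Prod>A\<in>\<A>. exp (c * card A)) = exp (c * (\<Sum>A\<in>\<A>. real (card A)))"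
  using assms by (simp add: exp_sum sum_distrib_left)

text \<open>Peeling off a vertex \<open>y \<in> Y\<close> with the sets containing it leaves a family in \<open>L - {y}\<close>
  anchored at the other vertices of \<open>Y\<close> and of the removed sets.\<close>

lemma anchored_sum_le:
  fixes u :: "'a set \<Rightarrow> real" and e :: real
  assumes u: "\<And>A. 0 \<le> u A" and e: "0 \<le> e"
    and small: "\<And>L y. finite L \<Longrightarrow> (\<Sum>A\<in>{A\<in>Pow L. y \<in> A}. u A * exp (e * card A)) \<le> e"
    and "finite L" "Y \<subseteq> L"
  shows "(\<Sum>\<A>\<in>{\<A>. \<A> \<subseteq> nePow L \<and> anchored Y \<A>}. \<Prod>A\<in>\<A>. u A) \<le> exp (e * card Y)"
  using assms(4,5)
proof (induction L arbitrary: Y rule: finite_psubset_induct)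
  case (psubset L)
  let ?S = "\<lambda>L Y. {\<A>. \<A> \<subseteq> nePow L \<and> anchored Y \<A>}"
  have finY: "finite Y" using finite_subset[OF psubset.prems psubset.hyps] .
  show ?case
  proof (cases "Y = {}")
    case True
    have "?S L Y = {{}}"
      using anchored_empty unfolding True nePow_def by (auto simp: anchored_def)
    then show ?thesis using True by simp
  next
    case False
    then obtain y where y: "y \<in> Y" by auto
    let ?L = "L - {y}"
    have L: "?L \<subset> L" "finite ?L" using y psubset.prems psubset.hyps by auto
    let ?U = "{A\<in>Pow L. y \<in> A}"
    have finU: "finite ?U" using psubset.hyps by auto
    let ?Y = "\<lambda>\<A>1. (Y \<union> \<Union>\<A>1) - {y}"
    let ?T = "SIGMA \<A>1:Pow ?U. ?S ?L (?Y \<A>1)"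
    have finS: "finite (?S L Y)" if "finite L" for L Y :: "'a set"
      by (rule finite_subset[of _ "Pow (nePow L)"]) (use that in auto)
    have finT: "finite ?T" using finU L finS by (intro finite_SigmaI) auto
    let ?j = "\<lambda>\<A>. ({A\<in>\<A>. y \<in> A}, {A\<in>\<A>. y \<notin> A})"
    have "(\<Sum>\<A>\<in>?S L Y. \<Prod>A\<in>\<A>. u A) = (\<Sum>p\<in>?j ` ?S L Y. \<Prod>A\<in>fst p \<union> snd p. u A)"
    proof (subst sum.reindex)
      show "inj_on ?j (?S L Y)" by (rule inj_onI) auto
      have "{A\<in>\<A>. y \<in> A} \<union> {A\<in>\<A>. y \<notin> A} = \<A>" for \<A> by auto
      then show "(\<Sum>\<A>\<in>?S L Y. \<Prod>A\<in>\<A>. u A) = (\<Sum>\<A>\<in>?S L Y. ((\<lambda>p. \<Prod>A\<in>fst p \<union> snd p. u A) \<circ> ?j) \<A>)" by simp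
    qed
    also have "\<dots> \<le> (\<Sum>p\<in>?T. \<Prod>A\<in>fst p \<union> snd p. u A)"
    proof (rule sum_mono2[OF finT])
      show "?j ` ?S L Y \<subseteq> ?T"
      proof (rule image_subsetI)
        fix \<A> assume A: "\<A> \<in> ?S L Y"
        have "anchored (?Y {A\<in>\<A>. y \<in> A}) {A\<in>\<A>. y \<notin> A}" by (rule anchored_peel) (use A in auto)
        moreover have "{A\<in>\<A>. y \<notin> A} \<subseteq> nePow ?L" "{A\<in>\<A>. y \<in> A} \<subseteq> ?U" using A unfolding nePow_def by auto
        ultimately show "?j \<A> \<in> ?T" by blast
      qed
    qed (use u in \<open>auto intro: prod_nonneg\<close>)
    also have "\<dots> = (\<Sum>\<A>1\<in>Pow ?U. \<Sum>\<B>\<in>?S ?L (?Y \<A>1). \<Prod>A\<in>\<A>1 \<union> \<B>. u A)"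
      by (subst sum.Sigma) (use finU L finS in \<open>auto simp: split_def\<close>)
    also have "\<dots> \<le> (\<Sum>\<A>1\<in>Pow ?U. (\<Prod>A\<in>\<A>1. u A * exp (e * card A)) * exp (e * real (card Y - 1)))"
    proof (rule sum_mono)
      fix \<A>1 assume A1: "\<A>1 \<in> Pow ?U"
      have fin1: "finite \<A>1" using A1 finU finite_subset by auto
      have "(\<Sum>\<B>\<in>?S ?L (?Y \<A>1). \<Prod>A\<in>\<A>1 \<union> \<B>. u A) = (\<Sum>\<B>\<in>?S ?L (?Y \<A>1). (\<Prod>A\<in>\<A>1. u A) * (\<Prod>A\<in>\<B>. u A))"
      proof (intro sum.cong refl)
        fix \<B> assume B: "\<B> \<in> ?S ?L (?Y \<A>1)"
        have "finite \<B>" using B L finite_nePow finite_subset by blast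
        moreover have "\<A>1 \<inter> \<B> = {}" using A1 B unfolding nePow_def by auto
        ultimately show "(\<Prod>A\<in>\<A>1 \<union> \<B>. u A) = (\<Prod>A\<in>\<A>1. u A) * (\<Prod>A\<in>\<B>. u A)"
          using fin1 by (simp add: prod.union_disjoint)
      qed
      also have "\<dots> = (\<Prod>A\<in>\<A>1. u A) * (\<Sum>\<B>\<in>?S ?L (?Y \<A>1). \<Prod>A\<in>\<B>. u A)"
        by (simp add: sum_distrib_left)
      also have "\<dots> \<le> (\<Prod>A\<in>\<A>1. u A) * exp (e * card (?Y \<A>1))"
      proof (rule mult_left_mono)
        show "(\<Sum>\<B>\<in>?S ?L (?Y \<A>1). \<Prod>A\<in>\<B>. u A) \<le> exp (e * card (?Y \<A>1))"
          by (rule psubset.IH[OF L(1)]) (use A1 psubset.prems in auto)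
      qed (simp add: prod_nonneg u)
      \<comment> \<open>The new anchors are the old ones without y and at most \<open>card A\<close>
        points for each removed A. Each removed set thus carries its own factor
        \<open>exp (e * card A)\<close>, the one present in the smallness assumption.\<close>
      also have "\<dots> \<le> (\<Prod>A\<in>\<A>1. u A) * exp (e * ((\<Sum>A\<in>\<A>1. real (card A)) + real (card Y - 1)))"
      proof -
        have "card (?Y \<A>1) \<le> card ((Y - {y}) \<union> \<Union>\<A>1)"
        proof (rule card_mono)
          have "finite (\<Union>\<A>1)" by (rule finite_subset[OF _ psubset.hyps]) (use A1 in auto)
          then show "finite ((Y - {y}) \<union> \<Union>\<A>1)" using finY by simp
        qed auto
        also have "\<dots> \<le> card (Y - {y}) + card (\<Union>\<A>1)" by (rule card_Un_le)
        also have "\<dots> \<le> (card Y - 1) + (\<Sum>A\<in>\<A>1. card A)"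
          using y finY card_Union_le_sum_card[of \<A>1] by simp
        finally have "card (?Y \<A>1) \<le> (card Y - 1) + (\<Sum>A\<in>\<A>1. card A)" .
        then have "real (card (?Y \<A>1)) \<le> real ((card Y - 1) + (\<Sum>A\<in>\<A>1. card A))"
          by (simp only: of_nat_le_iff)
        then have "e * card (?Y \<A>1) \<le> e * ((\<Sum>A\<in>\<A>1. real (card A)) + real (card Y - 1))"
          by (intro mult_left_mono[OF _ e]) simp
        then show ?thesis by (intro mult_left_mono) (auto simp: prod_nonneg u)
      qed
      also have "\<dots> = (\<Prod>A\<in>\<A>1. u A * exp (e * card A)) * exp (e * real (card Y - 1))"
        by (simp add: prod.distrib prod_exp_card[OF fin1] exp_add ring_distribs)
      finally show "(\<Sum>\<B>\<in>?S ?L (?Y \<A>1). \<Prod>A\<in>\<A>1 \<union> \<B>. u A) \<le> \<dots>" .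
    qed
    \<comment> \<open>The sets through y may be chosen independently, so their sum is a product;
      smallness at y bounds it by exp(e), which pays for the anchor y.\<close>
    also have "\<dots> = (\<Prod>A\<in>?U. 1 + u A * exp (e * card A)) * exp (e * real (card Y - 1))"
      by (simp only: sum_distrib_right[symmetric] sum_Pow_prod[OF finU])
    also have "\<dots> \<le> exp (\<Sum>A\<in>?U. u A * exp (e * card A)) * exp (e * real (card Y - 1))"
      by (intro mult_right_mono prod_one_plus_le_exp) (use u in auto)
    also have "\<dots> \<le> exp e * exp (e * real (card Y - 1))"
      by (intro mult_right_mono) (use small[OF psubset.hyps] in auto)
    also have "\<dots> = exp (e * card Y)"
    proof -
      have "card Y > 0" using y finY card_gt_0_iff by blast
      then show ?thesis by (simp add: exp_add[symmetric] algebra_simps of_nat_diff)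
    qed
    finally show ?thesis .
  qed
qed

text \<open>The families that together with x form one cluster with site set
  \<open>insert x G\<close>. For x outside G, the empty family belongs to the case G = {} only, and
  so does the family whose single member is {x}.\<close>

definition conn :: "'a \<Rightarrow> 'a set \<Rightarrow> 'a set set set" where
  "conn x G = {\<A>. \<A> \<subseteq> nePow (insert x G) \<and> sat_hull {x} \<A> = insert x G}"

lemma finite_conn: "finite G \<Longrightarrow> finite (conn x G)"
  by (rule finite_subset[of _ "Pow (nePow (insert x G))"]) (auto simp: conn_def)

lemma empty_in_conn: "x \<notin> G \<Longrightarrow> {} \<in> conn x G \<longleftrightarrow> G = {}"
proof -
  assume x: "x \<notin> G"
  have "sat_hull {x} {} = {x}"
    using sat_hull_least[of "{x}" "{x}" "{}"] subset_sat_hull[of "{x}" "{}"] by (auto simp: saturated_def)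
  then show ?thesis using x by (auto simp: conn_def)
qed

lemma conn_anchored: "\<A> \<in> conn x G \<Longrightarrow> anchored {x} \<A>"
  unfolding conn_def anchored_def nePow_def by auto

lemma conn_subset_Union:
  assumes "\<A> \<in> conn x G"
  shows "G \<subseteq> insert x (\<Union>\<A>)"
proof -
  have "sat_hull {x} \<A> \<subseteq> insert x (\<Union>\<A>)"
    by (rule sat_hull_least) (auto simp: saturated_def)
  then show ?thesis using assms unfolding conn_def by auto
qed

lemma sat_hull_conn_union:
  assumes "x \<notin> L" "G \<subseteq> L" "\<A> \<in> conn x G" "\<B> \<subseteq> nePow (L - G)"
  shows "sat_hull {x} (\<A> \<union> \<B>) = insert x G"
proof
  show "sat_hull {x} (\<A> \<union> \<B>) \<subseteq> insert x G"
    by (rule sat_hull_least) (use assms in \<open>auto simp: saturated_def conn_def nePow_def\<close>)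
  show "insert x G \<subseteq> sat_hull {x} (\<A> \<union> \<B>)"
    using assms(3) sat_hull_mono[of \<A> "\<A> \<union> \<B>" "{x}"] unfolding conn_def by auto
qed

text \<open>Members outside the hull do not help to build it: the hull of the members inside H is
  already saturated for the whole family. With \<open>sat_hull_conn_union\<close> this gives the
  bijection behind \<open>polymer_expansion\<close>.\<close>

lemma sat_hull_restrict:
  assumes "sat_hull {x} \<A> = H"
  shows "sat_hull {x} {A\<in>\<A>. A \<subseteq> H} = H"
proof
  let ?H = "sat_hull {x} {A\<in>\<A>. A \<subseteq> H}"
  show 1: "?H \<subseteq> H" using sat_hull_mono[of "{A\<in>\<A>. A \<subseteq> H}" \<A> "{x}"] assms by auto
  have "saturated ?H \<A>"
    unfolding saturated_def
  proof
    fix A assume A: "A \<in> \<A>"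
    show "A \<subseteq> ?H \<or> A \<inter> ?H = {}"
    proof (cases "A \<subseteq> H")
      case True
      then show ?thesis using A saturated_sat_hull[of "{x}" "{A\<in>\<A>. A \<subseteq> H}"] by (auto simp: saturated_def)
    next
      case False
      then have "A \<inter> H = {}" using A saturated_sat_hull[of "{x}" \<A>] assms by (auto simp: saturated_def)
      then show ?thesis using 1 by blast
    qed
  qed
  then have "sat_hull {x} \<A> \<subseteq> ?H" by (intro sat_hull_least subset_sat_hull)
  then show "H \<subseteq> ?H" using assms by simp
qed

text \<open>\<open>E i \<A>\<close> abstracts the expectation of the Boltzmann factor with only the
  terms in \<open>\<A>\<close> switched on, and \<open>v\<close> bounds the activities. Of the
  exponent a + e, the part a pays for the sites of a cluster in the Kotecky-Preiss sum and e for new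
  anchors in \<open>anchored_sum_le\<close>. \<open>a_e\<close> says exp(e) - 1 \<le> 1 -
  exp(-a).\<close>

locale family_gas =
  fixes E :: "'i \<Rightarrow> 'a set set \<Rightarrow> real" and v :: "'a set \<Rightarrow> real" and a e :: real
  assumes E_empty: "E i {} = 1"
    and E_union: "finite \<A> \<Longrightarrow> finite \<B> \<Longrightarrow> finite (\<Union>(\<A> \<union> \<B>)) \<Longrightarrow> {} \<notin> \<A> \<union> \<B> \<Longrightarrow> \<Union>\<A> \<inter> \<Union>\<B> = {} \<Longrightarrow>
          E i (\<A> \<union> \<B>) = E i \<A> * E i \<B>"
    and mob_E_le: "finite \<A> \<Longrightarrow> finite (\<Union>\<A>) \<Longrightarrow> {} \<notin> \<A> \<Longrightarrow> \<bar>mob (E i) \<A>\<bar> \<le> (\<Prod>A\<in>\<A>. v A)"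
    and v_nonneg: "0 \<le> v A"
    and a_nonneg: "0 \<le> a" and e_nonneg: "0 \<le> e"
    and v_sum: "finite L \<Longrightarrow> (\<Sum>A\<in>{A\<in>Pow L. y \<in> A}. v A * exp ((a + e) * card A)) \<le> e"
    and a_e: "exp e \<le> 2 - exp (- a)"
begin

text \<open>When a function of families splits into two factors depending on disjoint parts, its
  coefficients split as well; \<open>mob_unique\<close> is applied to the product of the
  coefficients of the two parts.\<close>

lemma mob_E_union:
  assumes "finite \<A>" "finite \<B>" "finite (\<Union>(\<A> \<union> \<B>))" "{} \<notin> \<A> \<union> \<B>" "\<Union>\<A> \<inter> \<Union>\<B> = {}"
  shows "mob (E i) (\<A> \<union> \<B>) = mob (E i) \<A> * mob (E i) \<B>"
proof -
  have disj: "\<A> \<inter> \<B> = {}"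
  proof (rule ccontr)
    assume "\<A> \<inter> \<B> \<noteq> {}"
    then obtain A where A: "A \<in> \<A>" "A \<in> \<B>" by blast
    then have "A \<subseteq> \<Union>\<A> \<inter> \<Union>\<B>" by blast
    then have "A = {}" using assms(5) by simp
    then show False using A assms(4) by blast
  qed
  have "mob (E i) (\<A> \<union> \<B>) = mob (E i) ((\<A> \<union> \<B>) \<inter> \<A>) * mob (E i) ((\<A> \<union> \<B>) \<inter> \<B>)"
  proof (rule mob_unique)
    fix \<D> assume D: "\<D> \<subseteq> \<A> \<union> \<B>"
    let ?A = "\<D> \<inter> \<A>" and ?B = "\<D> \<inter> \<B>"
    have fin: "finite ?A" "finite ?B" using assms by auto
    have D': "\<D> = ?A \<union> ?B" using D by blast
    have "E i \<D> = E i ?A * E i ?B"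
    proof (subst D', rule E_union)
      show "finite (\<Union>(?A \<union> ?B))" by (rule finite_subset[OF _ assms(3)]) auto
    qed (use assms in auto)
    also have "\<dots> = (\<Sum>(C, C')\<in>Pow ?A \<times> Pow ?B. mob (E i) C * mob (E i) C')"
      unfolding sum.cartesian_product[symmetric] sum_product[symmetric] by (simp only: sum_mob fin)
    also have "\<dots> = (\<Sum>C\<in>Pow \<D>. mob (E i) (C \<inter> \<A>) * mob (E i) (C \<inter> \<B>))"
    proof (rule sum.reindex_bij_witness[where i = "\<lambda>C. (C \<inter> \<A>, C \<inter> \<B>)" and j = "\<lambda>(C, C'). C \<union> C'"])
      fix p assume p: "p \<in> Pow ?A \<times> Pow ?B"
      then obtain C C' where C: "p = (C, C')" "C \<subseteq> ?A" "C' \<subseteq> ?B" by auto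
      then have eq: "(C \<union> C') \<inter> \<A> = C" "(C \<union> C') \<inter> \<B> = C'" using disj by auto
      show "((case p of (C, C') \<Rightarrow> C \<union> C') \<inter> \<A>, (case p of (C, C') \<Rightarrow> C \<union> C') \<inter> \<B>) = p"
        using C eq by simp
      show "mob (E i) ((case p of (C, C') \<Rightarrow> C \<union> C') \<inter> \<A>) * mob (E i) ((case p of (C, C') \<Rightarrow> C \<union> C') \<inter> \<B>)
          = (case p of (C, C') \<Rightarrow> mob (E i) C * mob (E i) C')"
        using C eq by simp
    qed (use D in auto)
    finally show "E i \<D> = (\<Sum>C\<in>Pow \<D>. mob (E i) (C \<inter> \<A>) * mob (E i) (C \<inter> \<B>))" .
  qed (use assms in auto)
  moreover have "(\<A> \<union> \<B>) \<inter> \<A> = \<A>" "(\<A> \<union> \<B>) \<inter> \<B> = \<B>" by auto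
  ultimately show ?thesis by simp
qed

text \<open>Expand \<open>E\<close> over families and sort them by the cluster of x. A family with
  cluster \<open>insert x G\<close> is a family in \<open>conn x G\<close> plus an arbitrary one
  inside L - G; coefficients factorise and the second part sums back to \<open>E\<close>.\<close>

lemma polymer_expansion:
  assumes L: "finite L" "x \<notin> L"
  shows "E i (nePow (insert x L)) =
    (\<Sum>G\<in>Pow L. (\<Sum>\<A>\<in>conn x G. mob (E i) \<A>) * E i (nePow (L - G)))"
proof -
  let ?P = "Pow (nePow (insert x L))"
  have finP: "finite ?P" using L by simp
  have "E i (nePow (insert x L)) = (\<Sum>\<A>\<in>?P. mob (E i) \<A>)"
    using L by (simp add: sum_mob)
  also have "\<dots> = (\<Sum>G\<in>Pow L. \<Sum>\<A>\<in>{\<A>\<in>?P. sat_hull {x} \<A> - {x} = G}. mob (E i) \<A>)"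
  proof (rule sum.group[symmetric, OF finP])
    show "(\<lambda>\<A>. sat_hull {x} \<A> - {x}) ` ?P \<subseteq> Pow L"
    proof (rule image_subsetI)
      fix \<A> assume "\<A> \<in> ?P"
      then have "sat_hull {x} \<A> \<subseteq> insert x L"
        by (intro sat_hull_least) (auto simp: saturated_def nePow_def)
      then show "sat_hull {x} \<A> - {x} \<in> Pow L" by auto
    qed
  qed (use L in simp)
  also have "\<dots> = (\<Sum>G\<in>Pow L. (\<Sum>\<A>\<in>conn x G. mob (E i) \<A>) * E i (nePow (L - G)))"
  proof (intro sum.cong refl)
    fix G assume "G \<in> Pow L"
    then have G: "G \<subseteq> L" "finite G" "x \<notin> G" "finite (L - G)" using L finite_subset by auto
    have "(\<Sum>\<A>\<in>conn x G. mob (E i) \<A>) * E i (nePow (L - G))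
        = (\<Sum>(\<A>, \<B>)\<in>conn x G \<times> Pow (nePow (L - G)). mob (E i) \<A> * mob (E i) \<B>)"
      using G by (simp add: sum_mob[of "nePow (L - G)", symmetric] sum_product sum.cartesian_product del: Pow_iff)
    also have "\<dots> = (\<Sum>\<A>\<in>{\<A>\<in>?P. sat_hull {x} \<A> - {x} = G}. mob (E i) \<A>)"
    proof (rule sum.reindex_bij_witness[where i = "\<lambda>\<A>. ({A\<in>\<A>. A \<subseteq> insert x G}, {A\<in>\<A>. \<not> A \<subseteq> insert x G})"
          and j = "\<lambda>(\<A>, \<B>). \<A> \<union> \<B>"])
      fix p assume p: "p \<in> conn x G \<times> Pow (nePow (L - G))"
      then obtain \<A> \<B> where AB: "p = (\<A>, \<B>)" "\<A> \<in> conn x G" "\<B> \<subseteq> nePow (L - G)" by auto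
      have A: "A \<subseteq> insert x G" "A \<noteq> {}" if "A \<in> \<A>" for A using that AB by (auto simp: conn_def nePow_def)
      have B: "A \<subseteq> L - G" "A \<noteq> {}" if "A \<in> \<B>" for A using that AB by (auto simp: nePow_def)
      have UA: "\<Union>\<A> \<subseteq> insert x G" and UB: "\<Union>\<B> \<subseteq> L - G" using A(1) B(1) by blast+
      have nB: "\<not> A \<subseteq> insert x G" if "A \<in> \<B>" for A using B[OF that] L by blast
      have "{A \<in> \<A> \<union> \<B>. A \<subseteq> insert x G} = \<A>" "{A \<in> \<A> \<union> \<B>. \<not> A \<subseteq> insert x G} = \<B>"
        using A nB by auto
      then show "(case case p of (\<A>, \<B>) \<Rightarrow> \<A> \<union> \<B> of \<A> \<Rightarrow> ({A\<in>\<A>. A \<subseteq> insert x G}, {A\<in>\<A>. \<not> A \<subseteq> insert x G})) = p"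
        by (simp add: AB)
      show "(case p of (\<A>, \<B>) \<Rightarrow> \<A> \<union> \<B>) \<in> {\<A>\<in>?P. sat_hull {x} \<A> - {x} = G}"
      proof -
        have "\<A> \<union> \<B> \<subseteq> nePow (insert x L)" using AB(2,3) G(1) unfolding conn_def nePow_def by blast
        then show ?thesis using sat_hull_conn_union[OF L(2) G(1) AB(2,3)] G by (simp add: AB(1))
      qed
      have "mob (E i) (\<A> \<union> \<B>) = mob (E i) \<A> * mob (E i) \<B>"
      proof (rule mob_E_union)
        show "finite \<A>" by (rule finite_subset[of _ "nePow (insert x G)"]) (use AB G in \<open>auto simp: conn_def\<close>)
        show "finite \<B>" by (rule finite_subset[OF AB(3)]) (use G in auto)
        show "finite (\<Union>(\<A> \<union> \<B>))" by (rule finite_subset[of _ "insert x L"]) (use UA UB G(1) L in auto)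
        show "{} \<notin> \<A> \<union> \<B>" using AB by (auto simp: conn_def nePow_def)
        show "\<Union>\<A> \<inter> \<Union>\<B> = {}" using UA UB L by blast
      qed
      then show "mob (E i) (case p of (\<A>, \<B>) \<Rightarrow> \<A> \<union> \<B>) = (case p of (\<A>, \<B>) \<Rightarrow> mob (E i) \<A> * mob (E i) \<B>)"
        by (simp add: AB)
    next
      fix \<A> assume A: "\<A> \<in> {\<A>\<in>?P. sat_hull {x} \<A> - {x} = G}"
      then have h: "sat_hull {x} \<A> = insert x G" using subset_sat_hull[of "{x}" \<A>] by auto
      show "(case ({A\<in>\<A>. A \<subseteq> insert x G}, {A\<in>\<A>. \<not> A \<subseteq> insert x G}) of (\<A>, \<B>) \<Rightarrow> \<A> \<union> \<B>) = \<A>" by auto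
      have "{A\<in>\<A>. A \<subseteq> insert x G} \<in> conn x G"
        using sat_hull_restrict[OF h] A by (auto simp: conn_def nePow_def)
      moreover have "{A\<in>\<A>. \<not> A \<subseteq> insert x G} \<subseteq> nePow (L - G)"
        using A saturated_sat_hull[of "{x}" \<A>] unfolding h saturated_def nePow_def by blast
      ultimately show "({A\<in>\<A>. A \<subseteq> insert x G}, {A\<in>\<A>. \<not> A \<subseteq> insert x G}) \<in> conn x G \<times> Pow (nePow (L - G))"
        by auto
    qed
    finally show "(\<Sum>\<A>\<in>{\<A>\<in>?P. sat_hull {x} \<A> - {x} = G}. mob (E i) \<A>) =
        (\<Sum>\<A>\<in>conn x G. mob (E i) \<A>) * E i (nePow (L - G))" by simp
  qed
  finally show ?thesis .
qed

text \<open>G is covered by the members of the family, so \<open>exp (a * card G)\<close> can be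
  distributed over them; what remains is a sum over nonempty families anchored at x.\<close>

lemma conn_sum_le:
  assumes L: "finite L" "x \<notin> L"
  shows "(\<Sum>G\<in>Pow L. (\<Sum>\<A>\<in>conn x G - {{}}. \<Prod>A\<in>\<A>. v A) * exp (a * card G)) \<le> 1 - exp (- a)"
proof -
  let ?u = "\<lambda>A. v A * exp (a * card A)"
  let ?S = "{\<A>. \<A> \<subseteq> nePow (insert x L) \<and> anchored {x} \<A>}"
  have finS: "finite ?S" by (rule finite_subset[of _ "Pow (nePow (insert x L))"]) (use L in auto)
  have "(\<Sum>G\<in>Pow L. (\<Sum>\<A>\<in>conn x G - {{}}. \<Prod>A\<in>\<A>. v A) * exp (a * card G))
      \<le> (\<Sum>G\<in>Pow L. \<Sum>\<A>\<in>conn x G - {{}}. \<Prod>A\<in>\<A>. ?u A)"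
    unfolding sum_distrib_right
  proof (intro sum_mono)
    fix G \<A> assume "G \<in> Pow L" "\<A> \<in> conn x G - {{}}"
    then have G: "G \<subseteq> L" "finite G" "x \<notin> G" and A: "\<A> \<in> conn x G" using L finite_subset by auto
    have A': "\<A> \<subseteq> nePow (insert x G)" using A by (auto simp: conn_def)
    have fA: "finite \<A>" by (rule finite_subset[OF A']) (use G in simp)
    have fU: "finite (\<Union>\<A>)" by (rule finite_subset[of _ "insert x G"]) (use A' G in \<open>auto simp: nePow_def\<close>)
    have "card G \<le> card (\<Union>\<A>)" by (rule card_mono) (use fU conn_subset_Union[OF A] G in auto)
    also have "\<dots> \<le> (\<Sum>A\<in>\<A>. card A)" by (rule card_Union_le_sum_card)
    finally have "real (card G) \<le> real (\<Sum>A\<in>\<A>. card A)" by (simp only: of_nat_le_iff)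
    then have "a * card G \<le> a * (\<Sum>A\<in>\<A>. real (card A))"
      using a_nonneg by (intro mult_left_mono) auto
    then have "(\<Prod>A\<in>\<A>. v A) * exp (a * card G) \<le> (\<Prod>A\<in>\<A>. v A) * exp (a * (\<Sum>A\<in>\<A>. real (card A)))"
      by (intro mult_left_mono) (auto simp: prod_nonneg v_nonneg)
    then show "(\<Prod>A\<in>\<A>. v A) * exp (a * card G) \<le> (\<Prod>A\<in>\<A>. ?u A)"
      unfolding prod.distrib prod_exp_card[OF fA] .
  qed
  \<comment> \<open>A family determines its hull, and x is not in G, so it occurs for one G
    only.\<close>
  also have "\<dots> = (\<Sum>\<A>\<in>(\<Union>G\<in>Pow L. conn x G - {{}}). \<Prod>A\<in>\<A>. ?u A)"
  proof (rule sum.UNION_disjoint[symmetric])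
    show "\<forall>G\<in>Pow L. finite (conn x G - {{}})"
    proof
      fix G assume "G \<in> Pow L"
      then have "finite G" using finite_subset[OF _ L(1)] by simp
      then show "finite (conn x G - {{}})" by (simp add: finite_conn)
    qed
    show "\<forall>G\<in>Pow L. \<forall>G'\<in>Pow L. G \<noteq> G' \<longrightarrow> (conn x G - {{}}) \<inter> (conn x G' - {{}}) = {}"
    proof (intro ballI impI)
      fix G G' assume "G \<in> Pow L" "G' \<in> Pow L" "G \<noteq> G'"
      then have "insert x G \<noteq> insert x G'" using L(2) by (metis PowD insert_ident subsetD)
      then show "(conn x G - {{}}) \<inter> (conn x G' - {{}}) = {}" unfolding conn_def by auto
    qed
  qed (use L in simp)
  also have "\<dots> \<le> (\<Sum>\<A>\<in>?S - {{}}. \<Prod>A\<in>\<A>. ?u A)"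
  proof (rule sum_mono2)
    show "(\<Union>G\<in>Pow L. conn x G - {{}}) \<subseteq> ?S - {{}}"
    proof
      fix \<A> assume "\<A> \<in> (\<Union>G\<in>Pow L. conn x G - {{}})"
      then obtain G where G: "G \<subseteq> L" "\<A> \<in> conn x G" "\<A> \<noteq> {}" by auto
      then have "\<A> \<subseteq> nePow (insert x L)" unfolding conn_def nePow_def by blast
      then show "\<A> \<in> ?S - {{}}" using conn_anchored[OF G(2)] G(3) by simp
    qed
  qed (use finS v_nonneg in \<open>auto intro!: prod_nonneg\<close>)
  \<comment> \<open>The empty family is anchored and has weight 1. Subtracting it leaves exp(e) - 1,
    which \<open>a_e\<close> compares with 1 - exp(-a).\<close>
  also have "\<dots> = (\<Sum>\<A>\<in>?S. \<Prod>A\<in>\<A>. ?u A) - 1"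
    using finS by (subst sum_diff1) (auto simp: anchored_def)
  also have "(\<Sum>\<A>\<in>?S. \<Prod>A\<in>\<A>. ?u A) \<le> exp (e * card {x})"
  proof (rule anchored_sum_le)
    show "(\<Sum>A\<in>{A\<in>Pow L. y \<in> A}. ?u A * exp (e * card A)) \<le> e" if "finite L" for L y
      using v_sum[OF that, of y] by (simp add: mult.assoc exp_add[symmetric] distrib_right)
  qed (use v_nonneg e_nonneg L in auto)
  finally show ?thesis using a_e by simp
qed

text \<open>The empty family is taken out of each cluster weight: it supplies the bare term
  \<open>Z i L\<close> of the recursion.\<close>

sublocale polymer_gas "\<lambda>i L. E i (nePow L)" "\<lambda>i x G. \<Sum>\<A>\<in>conn x G - {{}}. mob (E i) \<A>"
  "\<lambda>x G. \<Sum>\<A>\<in>conn x G - {{}}. \<Prod>A\<in>\<A>. v A" a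
proof
  show "E i (nePow {}) = 1" for i by (simp add: nePow_def E_empty)
  show "(\<Sum>G\<in>Pow L. (\<Sum>\<A>\<in>conn x G - {{}}. \<Prod>A\<in>\<A>. v A) * exp (a * card G)) \<le> 1 - exp (- a)"
    if "finite L" "x \<notin> L" for L x using conn_sum_le that .
  fix i x G assume G: "finite G" "x \<notin> (G :: 'a set)"
  show "\<bar>\<Sum>\<A>\<in>conn x G - {{}}. mob (E i) \<A>\<bar> \<le> (\<Sum>\<A>\<in>conn x G - {{}}. \<Prod>A\<in>\<A>. v A)"
  proof (intro order_trans[OF sum_abs] sum_mono mob_E_le)
    fix \<A> assume "\<A> \<in> conn x G - {{}}"
    then have A: "\<A> \<subseteq> nePow (insert x G)" by (auto simp: conn_def)
    then show "{} \<notin> \<A>" by (auto simp: nePow_def)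
    show "finite \<A>" by (rule finite_subset[OF A]) (use G in simp)
    show "finite (\<Union>\<A>)" by (rule finite_subset[of _ "insert x G"]) (use A G in \<open>auto simp: nePow_def\<close>)
  qed
next
  fix i x L assume L: "finite L" "x \<notin> (L :: 'a set)"
  have eq: "(\<Sum>\<A>\<in>conn x G. mob (E i) \<A>) = of_bool (G = {}) + (\<Sum>\<A>\<in>conn x G - {{}}. mob (E i) \<A>)"
    if "G \<in> Pow L" for G
  proof -
    have G: "finite G" "x \<notin> G" using that L finite_subset by auto
    have "mob (E i) {} = 1" by (simp add: mob_def E_empty)
    then show ?thesis
      using G by (simp add: sum_diff1 finite_conn empty_in_conn)
  qed
  have "E i (nePow (insert x L)) =
      (\<Sum>G\<in>Pow L. (of_bool (G = {}) + (\<Sum>\<A>\<in>conn x G - {{}}. mob (E i) \<A>)) * E i (nePow (L - G)))"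
    unfolding polymer_expansion[OF L] by (intro sum.cong refl) (simp only: eq)
  also have "\<dots> = (\<Sum>G\<in>Pow L. if G = {} then E i (nePow L) else 0)
      + (\<Sum>G\<in>Pow L. (\<Sum>\<A>\<in>conn x G - {{}}. mob (E i) \<A>) * E i (nePow (L - G)))"
    unfolding sum.distrib[symmetric] by (intro sum.cong refl) (auto simp: distrib_right)
  also have "(\<Sum>G\<in>Pow L. if G = {} then E i (nePow L) else 0) = E i (nePow L)"
    using L by (simp add: sum.delta)
  finally show "E i (nePow (insert x L)) = E i (nePow L)
      + (\<Sum>G\<in>Pow L. (\<Sum>\<A>\<in>conn x G - {{}}. mob (E i) \<A>) * E i (nePow (L - G)))" .
qed

end

section \<open>Matrices indexed by finite sets\<close>

lemma kmult_cong:
  assumes "\<And>\<rho>. \<rho> \<in> S \<Longrightarrow> K \<sigma> \<rho> = K' \<sigma> \<rho>" "\<And>\<rho>. \<rho> \<in> S \<Longrightarrow> L \<rho> \<tau> = L' \<rho> \<tau>"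
  shows "kmult S K L \<sigma> \<tau> = kmult S K' L' \<sigma> \<tau>"
  unfolding kmult_def by (intro sum.cong refl) (simp add: assms)

lemma kmult_assoc: "kmult S (kmult S K L) M = kmult S K (kmult S L M)"
proof (intro ext)
  fix \<sigma> \<tau>
  have "kmult S (kmult S K L) M \<sigma> \<tau> = (\<Sum>\<rho>\<in>S. \<Sum>\<nu>\<in>S. K \<sigma> \<nu> * L \<nu> \<rho> * M \<rho> \<tau>)"
    by (simp add: kmult_def sum_distrib_right)
  also have "\<dots> = (\<Sum>\<nu>\<in>S. \<Sum>\<rho>\<in>S. K \<sigma> \<nu> * L \<nu> \<rho> * M \<rho> \<tau>)" by (rule sum.swap)
  also have "\<dots> = kmult S K (kmult S L M) \<sigma> \<tau>"
    by (simp add: kmult_def sum_distrib_left mult.assoc)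
  finally show "kmult S (kmult S K L) M \<sigma> \<tau> = kmult S K (kmult S L M) \<sigma> \<tau>" .
qed

lemma kmult_kid_left: "finite S \<Longrightarrow> \<sigma> \<in> S \<Longrightarrow> kmult S kid K \<sigma> \<tau> = K \<sigma> \<tau>"
  by (simp add: kmult_def kid_def if_distrib[of "\<lambda>x. x * _"] sum.delta cong: if_cong)

lemma kmult_kid_right: "finite S \<Longrightarrow> \<tau> \<in> S \<Longrightarrow> kmult S K kid \<sigma> \<tau> = K \<sigma> \<tau>"
  by (simp add: kmult_def kid_def if_distrib[of "\<lambda>x. _ * x"] sum.delta' cong: if_cong)

lemma kpow_0: "kpow S K 0 = kid"
  by (simp add: kpow_def)

lemma kpow_Suc: "kpow S K (Suc n) = kmult S K (kpow S K n)"
  by (simp add: kpow_def)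

lemma kpow_cong:
  assumes "\<And>\<sigma> \<tau>. \<sigma> \<in> S \<Longrightarrow> \<tau> \<in> S \<Longrightarrow> K \<sigma> \<tau> = K' \<sigma> \<tau>" "\<sigma> \<in> S"
  shows "kpow S K n \<sigma> \<tau> = kpow S K' n \<sigma> \<tau>"
  using assms(2)
proof (induction n arbitrary: \<sigma>)
  case (Suc n)
  then show ?case unfolding kpow_Suc by (intro kmult_cong) (use assms in auto)
qed (simp add: kpow_0)

lemma kpow_scale:
  assumes "\<sigma> \<in> S"
  shows "kpow S (\<lambda>\<sigma> \<tau>. c * K \<sigma> \<tau>) n \<sigma> \<tau> = c ^ n * kpow S K n \<sigma> \<tau>"
  using assms
proof (induction n arbitrary: \<sigma>)
  case (Suc n)
  then show ?case
    by (simp add: kpow_Suc kmult_def sum_distrib_left mult_ac cong: sum.cong)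
qed (simp add: kpow_0)

lemma kpow_commute:
  assumes "finite S" "\<sigma> \<in> S" "\<tau> \<in> S"
  shows "kmult S (kpow S K n) K \<sigma> \<tau> = kpow S K (Suc n) \<sigma> \<tau>"
  using assms(2,3)
proof (induction n arbitrary: \<sigma> \<tau>)
  case 0
  then show ?case using assms(1) by (simp add: kpow_0 kpow_Suc kmult_kid_left kmult_kid_right)
next
  case (Suc n)
  have "kmult S (kpow S K (Suc n)) K \<sigma> \<tau> = kmult S K (kmult S (kpow S K n) K) \<sigma> \<tau>"
    by (simp add: kpow_Suc kmult_assoc)
  also have "\<dots> = kmult S K (kpow S K (Suc n)) \<sigma> \<tau>"
    by (intro kmult_cong) (use Suc in auto)
  finally show ?case by (simp add: kpow_Suc[of S K "Suc n"])
qed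

text \<open>Conjugation reverses products, while powers are built by multiplication from the left;
  \<open>kpow_commute\<close> supplies the factor on the other side.\<close>

lemma kpow_hermitian:
  assumes "finite S" and h: "\<And>\<sigma> \<tau>. \<sigma> \<in> S \<Longrightarrow> \<tau> \<in> S \<Longrightarrow> K \<sigma> \<tau> = cnj (K \<tau> \<sigma>)" and "\<sigma> \<in> S" "\<tau> \<in> S"
  shows "kpow S K n \<sigma> \<tau> = cnj (kpow S K n \<tau> \<sigma>)"
  using assms(3,4)
proof (induction n arbitrary: \<sigma> \<tau>)
  case 0
  then show ?case by (simp add: kpow_0 kid_def)
next
  case (Suc n)
  have "cnj (kpow S K (Suc n) \<tau> \<sigma>) = (\<Sum>\<rho>\<in>S. cnj (K \<tau> \<rho>) * cnj (kpow S K n \<rho> \<sigma>))"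
    by (simp add: kpow_Suc kmult_def)
  also have "\<dots> = (\<Sum>\<rho>\<in>S. kpow S K n \<sigma> \<rho> * K \<rho> \<tau>)"
  proof (intro sum.cong refl)
    fix \<rho> assume "\<rho> \<in> S"
    then have "kpow S K n \<sigma> \<rho> = cnj (kpow S K n \<rho> \<sigma>)" "K \<rho> \<tau> = cnj (K \<tau> \<rho>)"
      using Suc h by blast+
    then show "cnj (K \<tau> \<rho>) * cnj (kpow S K n \<rho> \<sigma>) = kpow S K n \<sigma> \<rho> * K \<rho> \<tau>" by simp
  qed
  also have "\<dots> = kpow S K (Suc n) \<sigma> \<tau>"
    using kpow_commute[OF assms(1) Suc.prems, of K n] by (simp add: kmult_def)
  finally show ?case by simp
qed

lemma ktrace_kmult_real:
  assumes "\<And>\<sigma> \<tau>. \<sigma> \<in> S \<Longrightarrow> \<tau> \<in> S \<Longrightarrow> K \<sigma> \<tau> = cnj (K \<tau> \<sigma>)" "\<And>\<sigma> \<tau>. \<sigma> \<in> S \<Longrightarrow> \<tau> \<in> S \<Longrightarrow> L \<sigma> \<tau> = cnj (L \<tau> \<sigma>)"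
  shows "complex_of_real (Re (ktrace S (kmult S K L))) = ktrace S (kmult S K L)"
proof -
  have "cnj (ktrace S (kmult S K L)) = (\<Sum>\<sigma>\<in>S. \<Sum>\<rho>\<in>S. cnj (K \<sigma> \<rho>) * cnj (L \<rho> \<sigma>))"
    by (simp add: ktrace_def kmult_def)
  also have "\<dots> = (\<Sum>\<sigma>\<in>S. \<Sum>\<rho>\<in>S. K \<rho> \<sigma> * L \<sigma> \<rho>)"
    by (intro sum.cong refl) (metis assms)
  also have "\<dots> = ktrace S (kmult S K L)"
    unfolding ktrace_def kmult_def by (rule sum.swap)
  finally show ?thesis by (metis Reals_cnj_iff of_real_Re)
qed

text \<open>An operator norm bound stated as an inequality for all vectors, so that products and
  embeddings can be treated without handling the supremum in \<open>kopnorm\<close>.\<close>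

definition kbound :: "'a set \<Rightarrow> ('a \<Rightarrow> 'a \<Rightarrow> complex) \<Rightarrow> real \<Rightarrow> bool" where
  "kbound S K c \<longleftrightarrow> (\<forall>v. L2_set (\<lambda>\<sigma>. cmod (\<Sum>\<tau>\<in>S. K \<sigma> \<tau> * v \<tau>)) S \<le> c * L2_set (\<lambda>\<tau>. cmod (v \<tau>)) S)"

lemma kbound_kid: "finite S \<Longrightarrow> kbound S kid 1"
  unfolding kbound_def
proof
  fix v :: "'a \<Rightarrow> complex" assume S: "finite S"
  have "L2_set (\<lambda>\<sigma>. cmod (\<Sum>\<tau>\<in>S. kid \<sigma> \<tau> * v \<tau>)) S = L2_set (\<lambda>\<tau>. cmod (v \<tau>)) S"
    by (intro L2_set_cong refl)
       (use S in \<open>simp add: kid_def if_distrib[of "\<lambda>x. x * _"] sum.delta cong: if_cong\<close>)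
  then show "L2_set (\<lambda>\<sigma>. cmod (\<Sum>\<tau>\<in>S. kid \<sigma> \<tau> * v \<tau>)) S \<le> 1 * L2_set (\<lambda>\<tau>. cmod (v \<tau>)) S" by simp
qed

lemma kbound_kmult:
  assumes "kbound S K c" "kbound S L d" "0 \<le> c"
  shows "kbound S (kmult S K L) (c * d)"
  unfolding kbound_def
proof
  fix v
  have "(\<Sum>\<tau>\<in>S. kmult S K L \<sigma> \<tau> * v \<tau>) = (\<Sum>\<rho>\<in>S. K \<sigma> \<rho> * (\<Sum>\<tau>\<in>S. L \<rho> \<tau> * v \<tau>))" for \<sigma>
  proof -
    have "(\<Sum>\<tau>\<in>S. kmult S K L \<sigma> \<tau> * v \<tau>) = (\<Sum>\<tau>\<in>S. \<Sum>\<rho>\<in>S. K \<sigma> \<rho> * (L \<rho> \<tau> * v \<tau>))"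
      by (simp add: kmult_def sum_distrib_right mult.assoc)
    also have "\<dots> = (\<Sum>\<rho>\<in>S. \<Sum>\<tau>\<in>S. K \<sigma> \<rho> * (L \<rho> \<tau> * v \<tau>))" by (rule sum.swap)
    finally show ?thesis by (simp add: sum_distrib_left)
  qed
  then have "L2_set (\<lambda>\<sigma>. cmod (\<Sum>\<tau>\<in>S. kmult S K L \<sigma> \<tau> * v \<tau>)) S
      \<le> c * L2_set (\<lambda>\<rho>. cmod (\<Sum>\<tau>\<in>S. L \<rho> \<tau> * v \<tau>)) S"
    using assms(1) by (simp add: kbound_def)
  also have "\<dots> \<le> c * (d * L2_set (\<lambda>\<tau>. cmod (v \<tau>)) S)"
    using assms(2,3) by (intro mult_left_mono) (auto simp: kbound_def)
  finally show "L2_set (\<lambda>\<sigma>. cmod (\<Sum>\<tau>\<in>S. kmult S K L \<sigma> \<tau> * v \<tau>)) S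
      \<le> c * d * L2_set (\<lambda>\<tau>. cmod (v \<tau>)) S" by (simp add: mult.assoc)
qed

lemma kbound_entry:
  assumes "finite S" "kbound S K c" "\<sigma> \<in> S" "\<tau> \<in> S"
  shows "cmod (K \<sigma> \<tau>) \<le> c"
proof -
  let ?v = "\<lambda>\<rho>. if \<rho> = \<tau> then 1 else 0 :: complex"
  have "cmod (K \<sigma> \<tau>) = cmod (\<Sum>\<rho>\<in>S. K \<sigma> \<rho> * ?v \<rho>)"
    using assms by (simp add: if_distrib[of "\<lambda>x. _ * x"] sum.delta' cong: if_cong)
  also have "\<dots> \<le> L2_set (\<lambda>\<sigma>. cmod (\<Sum>\<rho>\<in>S. K \<sigma> \<rho> * ?v \<rho>)) S"
    using assms by (intro member_le_L2_set)
  also have "\<dots> \<le> c * L2_set (\<lambda>\<rho>. cmod (?v \<rho>)) S"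
    using assms(2) by (simp only: kbound_def)
  also have "L2_set (\<lambda>\<rho>. cmod (?v \<rho>)) S = 1"
    using assms by (simp add: L2_set_def if_distrib[of cmod] if_distrib[of "\<lambda>x. x\<^sup>2"] sum.delta cong: if_cong)
  finally show ?thesis by simp
qed

lemma bdd_above_kopnorm:
  assumes "finite S"
  shows "bdd_above ((\<lambda>v. sqrt (\<Sum>\<sigma>\<in>S. (cmod (\<Sum>\<tau>\<in>S. K \<sigma> \<tau> * v \<tau>))\<^sup>2)) ` {v. (\<Sum>\<tau>\<in>S. (cmod (v \<tau>))\<^sup>2) \<le> 1})"
proof (rule bdd_aboveI2)
  fix v assume v: "v \<in> {v. (\<Sum>\<tau>\<in>S. (cmod (v \<tau>))\<^sup>2) \<le> 1}"
  have v1: "cmod (v \<tau>) \<le> 1" if "\<tau> \<in> S" for \<tau>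
  proof -
    have "(cmod (v \<tau>))\<^sup>2 \<le> (\<Sum>\<tau>\<in>S. (cmod (v \<tau>))\<^sup>2)"
      by (rule member_le_sum) (use that assms in auto)
    also have "\<dots> \<le> 1" using v by simp
    finally show ?thesis by (simp add: abs_square_le_1)
  qed
  have "sqrt (\<Sum>\<sigma>\<in>S. (cmod (\<Sum>\<tau>\<in>S. K \<sigma> \<tau> * v \<tau>))\<^sup>2) \<le> (\<Sum>\<sigma>\<in>S. cmod (\<Sum>\<tau>\<in>S. K \<sigma> \<tau> * v \<tau>))"
    using L2_set_le_sum[of S "\<lambda>\<sigma>. cmod (\<Sum>\<tau>\<in>S. K \<sigma> \<tau> * v \<tau>)"] by (simp add: L2_set_def)
  also have "\<dots> \<le> (\<Sum>\<sigma>\<in>S. \<Sum>\<tau>\<in>S. cmod (K \<sigma> \<tau>))"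
  proof (intro sum_mono order_trans[OF norm_sum])
    fix \<sigma> \<tau> assume "\<tau> \<in> S"
    then show "cmod (K \<sigma> \<tau> * v \<tau>) \<le> cmod (K \<sigma> \<tau>)"
      using v1 by (simp add: norm_mult mult_left_le)
  qed
  finally show "sqrt (\<Sum>\<sigma>\<in>S. (cmod (\<Sum>\<tau>\<in>S. K \<sigma> \<tau> * v \<tau>))\<^sup>2) \<le> (\<Sum>\<sigma>\<in>S. \<Sum>\<tau>\<in>S. cmod (K \<sigma> \<tau>))" .
qed

lemma kopnorm_nonneg:
  assumes "finite S"
  shows "0 \<le> kopnorm S K"
  unfolding kopnorm_def by (rule cSUP_upper2[OF bdd_above_kopnorm[OF assms], of "\<lambda>_. 0"]) auto

lemma kbound_kopnorm:
  assumes "finite S"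
  shows "kbound S K (kopnorm S K)"
  unfolding kbound_def
proof
  fix v
  let ?n = "L2_set (\<lambda>\<tau>. cmod (v \<tau>)) S"
  show "L2_set (\<lambda>\<sigma>. cmod (\<Sum>\<tau>\<in>S. K \<sigma> \<tau> * v \<tau>)) S \<le> kopnorm S K * ?n"
  proof (cases "?n = 0")
    case True
    then have "v \<tau> = 0" if "\<tau> \<in> S" for \<tau> using that assms by (simp add: L2_set_eq_0_iff)
    then show ?thesis by (simp add: L2_set_def)
  next
    case False
    then have n: "?n > 0" using L2_set_nonneg[of "\<lambda>\<tau>. cmod (v \<tau>)" S] by linarith
    let ?w = "\<lambda>\<tau>. v \<tau> / of_real ?n"
    have "L2_set (\<lambda>\<sigma>. cmod (\<Sum>\<tau>\<in>S. K \<sigma> \<tau> * v \<tau>)) S = ?n * L2_set (\<lambda>\<sigma>. cmod (\<Sum>\<tau>\<in>S. K \<sigma> \<tau> * ?w \<tau>)) S"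
    proof -
      have "(\<Sum>\<tau>\<in>S. K \<sigma> \<tau> * ?w \<tau>) = (\<Sum>\<tau>\<in>S. K \<sigma> \<tau> * v \<tau>) / of_real ?n" for \<sigma>
        by (simp add: sum_divide_distrib)
      then show ?thesis
        using n by (simp add: L2_set_right_distrib norm_divide)
    qed
    also have "L2_set (\<lambda>\<sigma>. cmod (\<Sum>\<tau>\<in>S. K \<sigma> \<tau> * ?w \<tau>)) S \<le> kopnorm S K"
      unfolding kopnorm_def L2_set_def
    proof (rule cSUP_upper[OF _ bdd_above_kopnorm[OF assms]])
      have "(\<Sum>\<tau>\<in>S. (cmod (?w \<tau>))\<^sup>2) = (\<Sum>\<tau>\<in>S. (cmod (v \<tau>))\<^sup>2) / ?n\<^sup>2"
        using n by (simp add: norm_divide power_divide sum_divide_distrib)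
      also have "\<dots> = 1"
        using n by (simp add: L2_set_def sum_nonneg)
      finally show "(\<lambda>\<tau>. v \<tau> / of_real (sqrt (\<Sum>i\<in>S. (cmod (v i))\<^sup>2))) \<in> {v. (\<Sum>\<tau>\<in>S. (cmod (v \<tau>))\<^sup>2) \<le> 1}"
        by (simp add: L2_set_def)
    qed
    finally show ?thesis using n by (simp add: mult.commute)
  qed
qed

lemma kopnorm_le:
  assumes "kbound S K c" "0 \<le> c"
  shows "kopnorm S K \<le> c"
  unfolding kopnorm_def
proof (rule cSUP_least)
  fix v assume v: "v \<in> {v. (\<Sum>\<tau>\<in>S. (cmod (v \<tau>))\<^sup>2) \<le> 1}"
  have "sqrt (\<Sum>\<sigma>\<in>S. (cmod (\<Sum>\<tau>\<in>S. K \<sigma> \<tau> * v \<tau>))\<^sup>2) \<le> c * L2_set (\<lambda>\<tau>. cmod (v \<tau>)) S"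
    using assms(1) by (simp add: kbound_def L2_set_def)
  also have "\<dots> \<le> c * 1"
    using v assms(2) by (intro mult_left_mono) (auto simp: L2_set_def)
  finally show "sqrt (\<Sum>\<sigma>\<in>S. (cmod (\<Sum>\<tau>\<in>S. K \<sigma> \<tau> * v \<tau>))\<^sup>2) \<le> c" by simp
qed (auto intro: exI[of _ "\<lambda>_. 0"])

lemma kbound_reindex:
  assumes "bij_betw g S S'" "kbound S' K c" "\<And>\<sigma> \<tau>. \<sigma> \<in> S \<Longrightarrow> \<tau> \<in> S \<Longrightarrow> K' \<sigma> \<tau> = K (g \<sigma>) (g \<tau>)"
  shows "kbound S K' c"
  unfolding kbound_def
proof
  fix v :: "'a \<Rightarrow> complex"
  let ?w = "\<lambda>\<tau>. v (inv_into S g \<tau>)"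
  have inv: "inv_into S g (g \<tau>) = \<tau>" if "\<tau> \<in> S" for \<tau>
    using assms(1) that by (meson bij_betw_inv_into_left)
  have "L2_set (\<lambda>\<sigma>. cmod (\<Sum>\<tau>\<in>S. K' \<sigma> \<tau> * v \<tau>)) S = L2_set (\<lambda>\<sigma>. cmod (\<Sum>\<tau>\<in>S'. K \<sigma> \<tau> * ?w \<tau>)) S'"
    unfolding L2_set_def sum.reindex_bij_betw[OF assms(1), symmetric]
    by (intro arg_cong[where f = sqrt] sum.cong refl arg_cong[where f = "\<lambda>x. (cmod x)\<^sup>2"])
       (simp add: assms(3) inv)
  also have "\<dots> \<le> c * L2_set (\<lambda>\<tau>. cmod (?w \<tau>)) S'" using assms(2) by (simp only: kbound_def)
  also have "L2_set (\<lambda>\<tau>. cmod (?w \<tau>)) S' = L2_set (\<lambda>\<tau>. cmod (v \<tau>)) S"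
    unfolding L2_set_def sum.reindex_bij_betw[OF assms(1), symmetric]
    by (intro arg_cong[where f = sqrt] sum.cong refl) (simp add: inv)
  finally show "L2_set (\<lambda>\<sigma>. cmod (\<Sum>\<tau>\<in>S. K' \<sigma> \<tau> * v \<tau>)) S \<le> c * L2_set (\<lambda>\<tau>. cmod (v \<tau>)) S" .
qed

text \<open>For an orthogonal projection \<open>P\<close> the trace of \<open>K P\<close> is the sum of the
  quadratic form of \<open>K\<close> over the columns of \<open>P\<close>.\<close>
lemma ktrace_projection_le:
  assumes "kbound S K c"
    and h: "\<And>\<sigma> \<tau>. \<sigma> \<in> S \<Longrightarrow> \<tau> \<in> S \<Longrightarrow> P \<sigma> \<tau> = cnj (P \<tau> \<sigma>)"
    and p: "\<And>\<sigma> \<tau>. \<sigma> \<in> S \<Longrightarrow> \<tau> \<in> S \<Longrightarrow> kmult S P P \<sigma> \<tau> = P \<sigma> \<tau>"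
  shows "cmod (ktrace S (kmult S K P)) \<le> c * Re (ktrace S P)"
proof -
  let ?K = "\<lambda>\<tau> \<sigma>. \<Sum>\<rho>\<in>S. K \<sigma> \<rho> * P \<rho> \<tau>"
  let ?n = "\<lambda>\<tau>. L2_set (\<lambda>\<sigma>. cmod (P \<sigma> \<tau>)) S"
  have "ktrace S (kmult S K P) = (\<Sum>\<sigma>\<in>S. \<Sum>\<rho>\<in>S. K \<sigma> \<rho> * (\<Sum>\<tau>\<in>S. P \<rho> \<tau> * P \<tau> \<sigma>))"
    unfolding ktrace_def kmult_def by (intro sum.cong refl) (simp add: p[unfolded kmult_def])
  also have "\<dots> = (\<Sum>\<sigma>\<in>S. \<Sum>\<rho>\<in>S. \<Sum>\<tau>\<in>S. P \<tau> \<sigma> * (K \<sigma> \<rho> * P \<rho> \<tau>))"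
    by (simp add: sum_distrib_left mult_ac)
  also have "\<dots> = (\<Sum>\<sigma>\<in>S. \<Sum>\<tau>\<in>S. \<Sum>\<rho>\<in>S. P \<tau> \<sigma> * (K \<sigma> \<rho> * P \<rho> \<tau>))"
    by (intro sum.cong refl sum.swap)
  also have "\<dots> = (\<Sum>\<tau>\<in>S. \<Sum>\<sigma>\<in>S. P \<tau> \<sigma> * ?K \<tau> \<sigma>)"
    unfolding sum_distrib_left by (rule sum.swap)
  finally have tr: "ktrace S (kmult S K P) = (\<Sum>\<tau>\<in>S. \<Sum>\<sigma>\<in>S. P \<tau> \<sigma> * ?K \<tau> \<sigma>)" .
  have "cmod (ktrace S (kmult S K P)) \<le> (\<Sum>\<tau>\<in>S. c * (?n \<tau>)\<^sup>2)"
    unfolding tr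
  proof (rule order_trans[OF norm_sum], rule sum_mono)
    fix \<tau> assume \<tau>: "\<tau> \<in> S"
    have "cmod (\<Sum>\<sigma>\<in>S. P \<tau> \<sigma> * ?K \<tau> \<sigma>) \<le> (\<Sum>\<sigma>\<in>S. cmod (P \<sigma> \<tau>) * cmod (?K \<tau> \<sigma>))"
    proof (rule order_trans[OF norm_sum], rule sum_mono)
      fix \<sigma> assume "\<sigma> \<in> S"
      then have "cmod (P \<tau> \<sigma>) = cmod (P \<sigma> \<tau>)" using h[OF \<tau>] by (metis complex_mod_cnj)
      then show "cmod (P \<tau> \<sigma> * ?K \<tau> \<sigma>) \<le> cmod (P \<sigma> \<tau>) * cmod (?K \<tau> \<sigma>)" by (simp add: norm_mult)
    qed
    also have "\<dots> \<le> ?n \<tau> * L2_set (\<lambda>\<sigma>. cmod (?K \<tau> \<sigma>)) S"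
      using L2_set_mult_ineq[of "\<lambda>\<sigma>. cmod (P \<sigma> \<tau>)" "\<lambda>\<sigma>. cmod (?K \<tau> \<sigma>)" S] by simp
    also have "\<dots> \<le> ?n \<tau> * (c * ?n \<tau>)"
      using assms(1) by (intro mult_left_mono) (auto simp: kbound_def)
    finally show "cmod (\<Sum>\<sigma>\<in>S. P \<tau> \<sigma> * ?K \<tau> \<sigma>) \<le> c * (?n \<tau>)\<^sup>2" by (simp add: power2_eq_square mult_ac)
  qed
  also have "\<dots> = c * Re (ktrace S P)"
  proof -
    have "Re (P \<tau> \<tau>) = (?n \<tau>)\<^sup>2" if \<tau>: "\<tau> \<in> S" for \<tau>
    proof -
      have "P \<tau> \<tau> = (\<Sum>\<sigma>\<in>S. P \<tau> \<sigma> * P \<sigma> \<tau>)" using p[OF \<tau> \<tau>] by (simp add: kmult_def)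
      also have "\<dots> = (\<Sum>\<sigma>\<in>S. of_real ((cmod (P \<sigma> \<tau>))\<^sup>2))"
      proof (intro sum.cong refl)
        fix \<sigma> assume "\<sigma> \<in> S"
        then have "P \<tau> \<sigma> = cnj (P \<sigma> \<tau>)" using h \<tau> by blast
        then show "P \<tau> \<sigma> * P \<sigma> \<tau> = of_real ((cmod (P \<sigma> \<tau>))\<^sup>2)"
          using complex_norm_square[of "P \<sigma> \<tau>"] by (simp add: mult.commute)
      qed
      finally show ?thesis by (simp add: L2_set_def sum_nonneg)
    qed
    then show ?thesis by (simp add: ktrace_def sum_distrib_left)
  qed
  finally show ?thesis .
qed

section \<open>Tensor products over disjoint regions\<close>

lemma finite_cfg [simp]: "finite \<Lambda> \<Longrightarrow> finite (cfg \<Lambda> :: ('s \<Rightarrow> 'm::finite) set)"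
  by (simp add: cfg_def finite_PiE)

lemma restrict_in_cfg [simp]: "restrict \<sigma> A \<in> cfg A"
  by (simp add: cfg_def)

text \<open>Configurations of the union stand for pairs via restriction, so no isomorphism between
  the product space and the tensor product has to be carried along.\<close>

definition tens :: "'s set \<Rightarrow> 's set \<Rightarrow> (('s \<Rightarrow> 'm) \<Rightarrow> ('s \<Rightarrow> 'm) \<Rightarrow> complex) \<Rightarrow> (('s \<Rightarrow> 'm) \<Rightarrow> ('s \<Rightarrow> 'm) \<Rightarrow> complex)
    \<Rightarrow> ('s \<Rightarrow> 'm) \<Rightarrow> ('s \<Rightarrow> 'm) \<Rightarrow> complex" where
  "tens G G' K L = (\<lambda>\<sigma> \<tau>. K (restrict \<sigma> G) (restrict \<tau> G) * L (restrict \<sigma> G') (restrict \<tau> G'))"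

lemma sum_PiE_split:
  fixes f :: "('s \<Rightarrow> 'm) \<Rightarrow> ('s \<Rightarrow> 'm) \<Rightarrow> 'b::comm_monoid_add"
  assumes "G \<inter> G' = {}"
  shows "(\<Sum>\<rho>\<in>(G \<union> G') \<rightarrow>\<^sub>E T. f (restrict \<rho> G) (restrict \<rho> G'))
    = (\<Sum>\<alpha>\<in>G \<rightarrow>\<^sub>E T. \<Sum>\<beta>\<in>G' \<rightarrow>\<^sub>E T. f \<alpha> \<beta>)"
  unfolding sum.cartesian_product
proof (rule sum.reindex_bij_witness[where j = "\<lambda>\<rho>. (restrict \<rho> G, restrict \<rho> G')" and i = "merge G G'"])
  fix \<rho> :: "'s \<Rightarrow> 'm" assume "\<rho> \<in> (G \<union> G') \<rightarrow>\<^sub>E T"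
  then show "merge G G' (restrict \<rho> G, restrict \<rho> G') = \<rho>"
    by (auto simp: PiE_def extensional_def merge_def fun_eq_iff)
next
  fix p :: "('s \<Rightarrow> 'm) \<times> ('s \<Rightarrow> 'm)" assume "p \<in> (G \<rightarrow>\<^sub>E T) \<times> (G' \<rightarrow>\<^sub>E T)"
  then obtain \<alpha> \<beta> where p: "p = (\<alpha>, \<beta>)" "\<alpha> \<in> G \<rightarrow>\<^sub>E T" "\<beta> \<in> G' \<rightarrow>\<^sub>E T" by auto
  then have "restrict \<alpha> G = \<alpha>" "restrict \<beta> G' = \<beta>" by (auto intro: PiE_restrict)
  then show "(restrict (merge G G' p) G, restrict (merge G G' p) G') = p"
    using assms by (simp add: p(1))
  show "merge G G' p \<in> (G \<union> G') \<rightarrow>\<^sub>E T" using p assms by (auto simp: PiE_def Pi_def extensional_def merge_def)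
qed auto

lemmas sum_cfg_split = sum_PiE_split[where T = UNIV, folded cfg_def]

lemma kmult_tens:
  assumes "G \<inter> G' = {}"
  shows "kmult (cfg (G \<union> G')) (tens G G' K L) (tens G G' K' L') =
    tens G G' (kmult (cfg G) K K') (kmult (cfg G') L L')"
proof (intro ext)
  fix \<sigma> \<tau> :: "'a \<Rightarrow> 'b"
  have "kmult (cfg (G \<union> G')) (tens G G' K L) (tens G G' K' L') \<sigma> \<tau> =
    (\<Sum>\<rho>\<in>cfg (G \<union> G'). (\<lambda>\<alpha> \<beta>. K (restrict \<sigma> G) \<alpha> * K' \<alpha> (restrict \<tau> G) *
       (L (restrict \<sigma> G') \<beta> * L' \<beta> (restrict \<tau> G'))) (restrict \<rho> G) (restrict \<rho> G'))"
    by (simp add: kmult_def tens_def mult_ac)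
  also have "\<dots> = (\<Sum>\<alpha>\<in>cfg G. \<Sum>\<beta>\<in>cfg G'. K (restrict \<sigma> G) \<alpha> * K' \<alpha> (restrict \<tau> G) *
       (L (restrict \<sigma> G') \<beta> * L' \<beta> (restrict \<tau> G')))"
    by (rule sum_cfg_split[OF assms])
  also have "\<dots> = tens G G' (kmult (cfg G) K K') (kmult (cfg G') L L') \<sigma> \<tau>"
    by (simp add: kmult_def tens_def sum_product)
  finally show "kmult (cfg (G \<union> G')) (tens G G' K L) (tens G G' K' L') \<sigma> \<tau> = \<dots>" .
qed

lemma ktrace_tens:
  assumes "G \<inter> G' = {}"
  shows "ktrace (cfg (G \<union> G')) (tens G G' K L) = ktrace (cfg G) K * ktrace (cfg G') L"
  using sum_cfg_split[OF assms, of "\<lambda>\<alpha> \<beta>. K \<alpha> \<alpha> * L \<beta> \<beta>"]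
  by (simp add: ktrace_def tens_def sum_product)

lemma restrict_eq_iff: "restrict \<sigma> G = restrict \<tau> G \<longleftrightarrow> (\<forall>i\<in>G. \<sigma> i = \<tau> i)"
  by (metis restrict_apply' restrict_ext)

lemma kid_tens:
  assumes "\<sigma> \<in> cfg (G \<union> G')" "\<tau> \<in> cfg (G \<union> G')"
  shows "kid \<sigma> \<tau> = tens G G' kid kid \<sigma> \<tau>"
proof -
  have "\<sigma> = \<tau> \<longleftrightarrow> restrict \<sigma> (G \<union> G') = restrict \<tau> (G \<union> G')"
    using assms PiE_restrict unfolding cfg_def by metis
  then show ?thesis by (auto simp: kid_def tens_def restrict_eq_iff)
qed

lemma emb_eq_tens: "emb A \<Lambda> K = tens A (\<Lambda> - A) K kid"
  by (intro ext) (simp add: emb_def tens_def kid_def restrict_eq_iff)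

lemma emb_Un_left:
  assumes "A \<subseteq> G" "G \<inter> G' = {}"
  shows "emb A (G \<union> G') K = tens G G' (emb A G K) kid"
proof (intro ext)
  fix \<sigma> \<tau> :: "'a \<Rightarrow> 'b"
  have "restrict (restrict \<sigma> G) A = restrict \<sigma> A" for \<sigma> :: "'a \<Rightarrow> 'b"
    using assms by (auto simp: Int_absorb1)
  moreover have "(\<forall>i\<in>G \<union> G' - A. \<sigma> i = \<tau> i) \<longleftrightarrow> (\<forall>i\<in>G - A. restrict \<sigma> G i = restrict \<tau> G i) \<and> (\<forall>i\<in>G'. \<sigma> i = \<tau> i)"
    using assms by auto
  ultimately show "emb A (G \<union> G') K \<sigma> \<tau> = tens G G' (emb A G K) kid \<sigma> \<tau>"
    by (simp add: emb_def tens_def kid_def restrict_eq_iff)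
qed

lemma tens_commute: "tens G G' K L = tens G' G L K"
  by (intro ext) (simp add: tens_def mult.commute)

lemma emb_Un_right:
  assumes "A \<subseteq> G'" "G \<inter> G' = {}"
  shows "emb A (G \<union> G') K = tens G G' kid (emb A G' K)"
  using emb_Un_left[OF assms(1), of G K] assms(2) by (simp add: Un_commute Int_commute tens_commute)

text \<open>The embedded matrix is block diagonal: for every fixed configuration outside A it acts
  as K on the spins in A. Squared norms add over the blocks.\<close>

lemma kbound_emb:
  fixes K :: "('s \<Rightarrow> 'm::finite) \<Rightarrow> ('s \<Rightarrow> 'm) \<Rightarrow> complex"
  assumes "A \<subseteq> \<Lambda>" "finite \<Lambda>" "kbound (cfg A) K c" "0 \<le> c"
  shows "kbound (cfg \<Lambda>) (emb A \<Lambda> K) c"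
  unfolding kbound_def
proof
  fix v :: "('s \<Rightarrow> 'm) \<Rightarrow> complex"
  let ?G = "\<Lambda> - A"
  have \<Lambda>: "\<Lambda> = A \<union> ?G" and disj: "A \<inter> ?G = {}" using assms by auto
  have fin: "finite ?G" "finite A" using assms finite_subset by auto
  let ?v = "\<lambda>\<alpha> \<beta>. v (merge A ?G (\<alpha>, \<beta>))"
  have split: "(\<Sum>\<rho>\<in>cfg \<Lambda>. f \<rho>) = (\<Sum>\<beta>\<in>cfg ?G. \<Sum>\<alpha>\<in>cfg A. f (merge A ?G (\<alpha>, \<beta>)))"
    for f :: "('s \<Rightarrow> 'm) \<Rightarrow> 'c::comm_monoid_add"
  proof -
    have "(\<Sum>\<rho>\<in>cfg (A \<union> ?G). f (merge A ?G (restrict \<rho> A, restrict \<rho> ?G)))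
        = (\<Sum>\<alpha>\<in>cfg A. \<Sum>\<beta>\<in>cfg ?G. f (merge A ?G (\<alpha>, \<beta>)))"
      by (rule sum_cfg_split[OF disj])
    moreover have "merge A ?G (restrict \<rho> A, restrict \<rho> ?G) = \<rho>" if "\<rho> \<in> cfg (A \<union> ?G)" for \<rho> :: "'s \<Rightarrow> 'm"
      using that by (auto simp: cfg_def PiE_def extensional_def merge_def fun_eq_iff)
    ultimately show ?thesis
      using \<Lambda> sum.swap[of "\<lambda>\<alpha> \<beta>. f (merge A ?G (\<alpha>, \<beta>))" "cfg ?G" "cfg A"] by (simp cong: sum.cong)
  qed
  have cfgr: "restrict \<alpha> A = \<alpha>" if "\<alpha> \<in> cfg A" for \<alpha> :: "'s \<Rightarrow> 'm" and A
    using that by (auto simp: cfg_def intro: PiE_restrict)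
  have app: "(\<Sum>\<tau>\<in>cfg \<Lambda>. emb A \<Lambda> K (merge A ?G (\<alpha>, \<beta>)) \<tau> * v \<tau>) = (\<Sum>\<alpha>'\<in>cfg A. K \<alpha> \<alpha>' * ?v \<alpha>' \<beta>)"
    if \<alpha>\<beta>: "\<alpha> \<in> cfg A" "\<beta> \<in> cfg ?G" for \<alpha> \<beta>
  proof -
    have "(\<Sum>\<tau>\<in>cfg \<Lambda>. emb A \<Lambda> K (merge A ?G (\<alpha>, \<beta>)) \<tau> * v \<tau>)
        = (\<Sum>\<beta>'\<in>cfg ?G. \<Sum>\<alpha>'\<in>cfg A. K \<alpha> \<alpha>' * kid \<beta> \<beta>' * ?v \<alpha>' \<beta>')"
      unfolding split emb_eq_tens tens_def
      by (intro sum.cong refl) (use \<alpha>\<beta> disj in \<open>simp add: cfgr\<close>)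
    also have "\<dots> = (\<Sum>\<beta>'\<in>cfg ?G. if \<beta>' = \<beta> then \<Sum>\<alpha>'\<in>cfg A. K \<alpha> \<alpha>' * ?v \<alpha>' \<beta>' else 0)"
      by (intro sum.cong refl) (simp add: kid_def)
    also have "\<dots> = (\<Sum>\<alpha>'\<in>cfg A. K \<alpha> \<alpha>' * ?v \<alpha>' \<beta>)"
      using fin \<alpha>\<beta> by (simp add: sum.delta)
    finally show ?thesis .
  qed
  have sq: "(\<Sum>\<sigma>\<in>cfg A. (cmod (\<Sum>\<tau>\<in>cfg A. K \<sigma> \<tau> * w \<tau>))\<^sup>2) \<le> c\<^sup>2 * (\<Sum>\<tau>\<in>cfg A. (cmod (w \<tau>))\<^sup>2)" for w
  proof -
    have "(L2_set (\<lambda>\<sigma>. cmod (\<Sum>\<tau>\<in>cfg A. K \<sigma> \<tau> * w \<tau>)) (cfg A))\<^sup>2 \<le> (c * L2_set (\<lambda>\<tau>. cmod (w \<tau>)) (cfg A))\<^sup>2"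
      by (rule power_mono) (use assms(3) in \<open>auto simp: kbound_def\<close>)
    then show ?thesis by (simp add: L2_set_def power_mult_distrib sum_nonneg)
  qed
  have "(\<Sum>\<sigma>\<in>cfg \<Lambda>. (cmod (\<Sum>\<tau>\<in>cfg \<Lambda>. emb A \<Lambda> K \<sigma> \<tau> * v \<tau>))\<^sup>2)
      = (\<Sum>\<beta>\<in>cfg ?G. \<Sum>\<alpha>\<in>cfg A. (cmod (\<Sum>\<alpha>'\<in>cfg A. K \<alpha> \<alpha>' * ?v \<alpha>' \<beta>))\<^sup>2)"
    by (subst split) (intro sum.cong refl, simp add: app)
  also have "\<dots> \<le> (\<Sum>\<beta>\<in>cfg ?G. c\<^sup>2 * (\<Sum>\<alpha>\<in>cfg A. (cmod (?v \<alpha> \<beta>))\<^sup>2))"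
    by (intro sum_mono sq)
  also have "\<dots> = c\<^sup>2 * (\<Sum>\<tau>\<in>cfg \<Lambda>. (cmod (v \<tau>))\<^sup>2)"
    by (subst split) (simp add: sum_distrib_left)
  finally have "sqrt (\<Sum>\<sigma>\<in>cfg \<Lambda>. (cmod (\<Sum>\<tau>\<in>cfg \<Lambda>. emb A \<Lambda> K \<sigma> \<tau> * v \<tau>))\<^sup>2)
      \<le> sqrt (c\<^sup>2 * (\<Sum>\<tau>\<in>cfg \<Lambda>. (cmod (v \<tau>))\<^sup>2))" by simp
  then show "L2_set (\<lambda>\<sigma>. cmod (\<Sum>\<tau>\<in>cfg \<Lambda>. emb A \<Lambda> K \<sigma> \<tau> * v \<tau>)) (cfg \<Lambda>) \<le> c * L2_set (\<lambda>\<tau>. cmod (v \<tau>)) (cfg \<Lambda>)"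
    using assms(4) by (simp add: L2_set_def real_sqrt_mult)
qed

lemma binomial_step:
  fixes f :: "nat \<Rightarrow> nat \<Rightarrow> 'b::comm_semiring_1"
  shows "(\<Sum>k\<le>n. of_nat (n choose k) * (f (Suc k) (n - k) + f k (Suc (n - k))))
    = (\<Sum>k\<le>Suc n. of_nat (Suc n choose k) * f k (Suc n - k))"
proof -
  have "(\<Sum>k\<le>Suc n. of_nat (Suc n choose k) * f k (Suc n - k))
      = f 0 (Suc n) + (\<Sum>k\<le>n. of_nat (Suc n choose Suc k) * f (Suc k) (n - k))"
    by (subst sum.atMost_Suc_shift) simp
  also have "\<dots> = (\<Sum>k\<le>n. of_nat (n choose k) * f (Suc k) (n - k)) +
      (f 0 (Suc n) + (\<Sum>k\<le>n. of_nat (n choose Suc k) * f (Suc k) (n - k)))"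
    by (simp add: algebra_simps sum.distrib)
  also have "f 0 (Suc n) + (\<Sum>k\<le>n. of_nat (n choose Suc k) * f (Suc k) (n - k))
      = (\<Sum>k\<le>Suc n. of_nat (n choose k) * f k (Suc n - k))"
    by (subst sum.atMost_Suc_shift) simp
  also have "\<dots> = (\<Sum>k\<le>n. of_nat (n choose k) * f k (Suc (n - k)))"
    by (simp add: binomial_eq_0, intro sum.cong refl) (simp add: Suc_diff_le)
  finally show ?thesis by (simp add: sum.distrib algebra_simps)
qed

text \<open>The two summands act on disjoint regions and commute, so the powers of their sum follow
  the binomial formula; \<open>binomial_step\<close> is Pascal's rule.\<close>

lemma kpow_tens_sum:
  fixes K L :: "('s \<Rightarrow> 'm::finite) \<Rightarrow> ('s \<Rightarrow> 'm) \<Rightarrow> complex"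
  assumes fin: "finite G" "finite G'" and disj: "G \<inter> G' = {}"
    and \<sigma>\<tau>: "\<sigma> \<in> cfg (G \<union> G')" "\<tau> \<in> cfg (G \<union> G')"
  shows "kpow (cfg (G \<union> G')) (\<lambda>\<sigma> \<tau>. tens G G' K kid \<sigma> \<tau> + tens G G' kid L \<sigma> \<tau>) n \<sigma> \<tau>
    = (\<Sum>k\<le>n. of_nat (n choose k) * tens G G' (kpow (cfg G) K k) (kpow (cfg G') L (n - k)) \<sigma> \<tau>)"
  using \<sigma>\<tau>
proof (induction n arbitrary: \<sigma>)
  case 0
  then show ?case by (simp add: kpow_0 kid_tens)
next
  case (Suc n)
  let ?S = "cfg (G \<union> G') :: ('s \<Rightarrow> 'm) set"
  let ?T = "\<lambda>k j. tens G G' (kpow (cfg G) K k) (kpow (cfg G') L j)"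
  have 1: "kmult ?S (tens G G' K kid) (?T k j) \<sigma> \<tau> = ?T (Suc k) j \<sigma> \<tau>" for k j
    unfolding kmult_tens[OF disj] kpow_Suc using fin by (simp add: tens_def kmult_kid_left)
  have 2: "kmult ?S (tens G G' kid L) (?T k j) \<sigma> \<tau> = ?T k (Suc j) \<sigma> \<tau>" for k j
    unfolding kmult_tens[OF disj] kpow_Suc using fin by (simp add: tens_def kmult_kid_left)
  have "kpow ?S (\<lambda>\<sigma> \<tau>. tens G G' K kid \<sigma> \<tau> + tens G G' kid L \<sigma> \<tau>) (Suc n) \<sigma> \<tau> =
    (\<Sum>\<rho>\<in>?S. (tens G G' K kid \<sigma> \<rho> + tens G G' kid L \<sigma> \<rho>) * (\<Sum>k\<le>n. of_nat (n choose k) * ?T k (n - k) \<rho> \<tau>))"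
    unfolding kpow_Suc kmult_def[of ?S "\<lambda>\<sigma> \<tau>. tens G G' K kid \<sigma> \<tau> + tens G G' kid L \<sigma> \<tau>"]
    by (intro sum.cong refl) (simp add: Suc)
  also have "\<dots> = (\<Sum>\<rho>\<in>?S. \<Sum>k\<le>n. of_nat (n choose k) *
      (tens G G' K kid \<sigma> \<rho> * ?T k (n - k) \<rho> \<tau> + tens G G' kid L \<sigma> \<rho> * ?T k (n - k) \<rho> \<tau>))"
    by (simp add: sum_distrib_left algebra_simps)
  also have "\<dots> = (\<Sum>k\<le>n. \<Sum>\<rho>\<in>?S. of_nat (n choose k) *
      (tens G G' K kid \<sigma> \<rho> * ?T k (n - k) \<rho> \<tau> + tens G G' kid L \<sigma> \<rho> * ?T k (n - k) \<rho> \<tau>))"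
    by (rule sum.swap)
  also have "\<dots> = (\<Sum>k\<le>n. of_nat (n choose k) * (kmult ?S (tens G G' K kid) (?T k (n - k)) \<sigma> \<tau>
      + kmult ?S (tens G G' kid L) (?T k (n - k)) \<sigma> \<tau>))"
    by (simp add: kmult_def sum_distrib_left[symmetric] sum.distrib[symmetric])
  also have "\<dots> = (\<Sum>k\<le>Suc n. of_nat (Suc n choose k) * ?T k (Suc n - k) \<sigma> \<tau>)"
    unfolding 1 2 by (rule binomial_step)
  finally show ?case .
qed

section \<open>Product states of a spin system\<close>

lemma sum_words_Suc:
  assumes "finite U"
  shows "(\<Sum>ws\<in>{ws. set ws \<subseteq> U \<and> length ws = Suc n}. f ws)
    = (\<Sum>A\<in>U. \<Sum>ws\<in>{ws. set ws \<subseteq> U \<and> length ws = n}. f (A # ws))"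
proof -
  have "(\<Sum>ws\<in>{ws. set ws \<subseteq> U \<and> length ws = Suc n}. f ws)
      = (\<Sum>(ws, A)\<in>{ws. set ws \<subseteq> U \<and> length ws = n} \<times> U. f (A # ws))"
    unfolding lists_length_Suc_eq by (subst sum.reindex) (auto simp: inj_on_def split_def intro!: sum.cong)
  also have "\<dots> = (\<Sum>ws\<in>{ws. set ws \<subseteq> U \<and> length ws = n}. \<Sum>A\<in>U. f (A # ws))"
    by (simp add: sum.cartesian_product)
  finally show ?thesis by (subst sum.swap) simp
qed

text \<open>Every word uses exactly one set of letters, so summing over subsets of B gives all words
  over B. This replaces the multinomial formula, which needs commuting factors.\<close>

lemma mob_words:
  fixes f :: "'a list \<Rightarrow> real"
  assumes "finite A"
  shows "mob (\<lambda>B. \<Sum>ws\<in>{ws. set ws \<subseteq> B \<and> length ws = n}. f ws) A = (\<Sum>ws\<in>{ws. set ws = A \<and> length ws = n}. f ws)"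
proof (rule mob_unique[OF assms])
  fix B assume "B \<subseteq> A"
  then have B: "finite B" using finite_subset[OF _ assms] by blast
  have "(\<Sum>ws\<in>{ws. set ws \<subseteq> B \<and> length ws = n}. f ws) =
      (\<Sum>C\<in>Pow B. \<Sum>ws\<in>{ws \<in> {ws. set ws \<subseteq> B \<and> length ws = n}. set ws = C}. f ws)"
    by (rule sum.group[symmetric]) (use B in \<open>auto simp: finite_lists_length_eq\<close>)
  also have "\<dots> = (\<Sum>C\<in>Pow B. \<Sum>ws\<in>{ws. set ws = C \<and> length ws = n}. f ws)"
    by (intro sum.cong refl) auto
  finally show "(\<Sum>ws\<in>{ws. set ws \<subseteq> B \<and> length ws = n}. f ws) = \<dots>" .
qed

lemma maj_words:
  fixes f g :: "'a list \<Rightarrow> real"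
  assumes "finite L" "\<And>ws. set ws \<subseteq> L \<Longrightarrow> \<bar>f ws\<bar> \<le> g ws"
  shows "maj L (\<lambda>B. \<Sum>ws\<in>{ws. set ws \<subseteq> B \<and> length ws = n}. f ws) (\<lambda>B. \<Sum>ws\<in>{ws. set ws \<subseteq> B \<and> length ws = n}. g ws)"
  unfolding maj_def
proof (intro allI impI)
  fix A assume A: "A \<subseteq> L"
  have fA: "finite A" using finite_subset[OF A assms(1)] .
  show "\<bar>mob (\<lambda>B. \<Sum>ws\<in>{ws. set ws \<subseteq> B \<and> length ws = n}. f ws) A\<bar> \<le>
      mob (\<lambda>B. \<Sum>ws\<in>{ws. set ws \<subseteq> B \<and> length ws = n}. g ws) A"
    unfolding mob_words[OF fA]
    by (rule order_trans[OF sum_abs], rule sum_mono) (use A assms(2) in auto)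
qed

lemma power_eq_sum_words:
  fixes h :: "'a \<Rightarrow> real"
  assumes "finite U"
  shows "(\<Sum>A\<in>U. h A) ^ n = (\<Sum>ws\<in>{ws. set ws \<subseteq> U \<and> length ws = n}. prod_list (map h ws))"
proof (induction n)
  case 0
  have "{ws. set ws \<subseteq> U \<and> length ws = 0} = {[]}" by auto
  then show ?case by simp
next
  case (Suc n)
  then show ?case
    by (simp add: sum_words_Suc[OF assms] sum_product)
qed

text \<open>The exponential is the product of 1 + (exp (h A) - 1), which expands over subfamilies.
  It serves as the commuting comparison model.\<close>

lemma mob_exp_additive:
  fixes h :: "'a \<Rightarrow> real"
  assumes "finite U"
  shows "mob (\<lambda>B. exp (\<Sum>A\<in>B. h A)) U = (\<Prod>A\<in>U. exp (h A) - 1)"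
proof (rule mob_unique[OF assms])
  fix B assume "B \<subseteq> U"
  then have B: "finite B" using finite_subset[OF _ assms] by blast
  then show "exp (\<Sum>A\<in>B. h A) = (\<Sum>C\<in>Pow B. \<Prod>A\<in>C. exp (h A) - 1)"
    by (simp add: sum_Pow_prod exp_sum)
qed

text \<open>Each label stands for a nonzero orthogonal projection, so that dividing it by its trace
  gives a density matrix.\<close>

locale spin_system =
  fixes \<Phi> :: "'s set \<Rightarrow> ('s \<Rightarrow> 'm::finite) \<Rightarrow> ('s \<Rightarrow> 'm) \<Rightarrow> complex"
    and P :: "'l \<Rightarrow> 'm \<Rightarrow> 'm \<Rightarrow> complex"
  assumes Phi_hermitian: "finite A \<Longrightarrow> \<sigma> \<in> cfg A \<Longrightarrow> \<tau> \<in> cfg A \<Longrightarrow> \<Phi> A \<sigma> \<tau> = cnj (\<Phi> A \<tau> \<sigma>)"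
    and P_hermitian: "P l a b = cnj (P l b a)"
    and P_idem: "kmult UNIV (P l) (P l) = P l"
    and P_nonzero: "\<exists>a b. P l a b \<noteq> 0"
begin

definition tr :: "'l \<Rightarrow> real" where
  "tr l = Re (ktrace UNIV (P l))"

definition fam_ham :: "'s set \<Rightarrow> 's set set \<Rightarrow> ('s \<Rightarrow> 'm) \<Rightarrow> ('s \<Rightarrow> 'm) \<Rightarrow> complex" where
  "fam_ham \<Lambda> \<A> = (\<lambda>\<sigma> \<tau>. \<Sum>A\<in>\<A>. emb A \<Lambda> (\<Phi> A) \<sigma> \<tau>)"

definition local_proj :: "('s \<Rightarrow> 'l) \<Rightarrow> 's set \<Rightarrow> ('s \<Rightarrow> 'm) \<Rightarrow> ('s \<Rightarrow> 'm) \<Rightarrow> complex" where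
  "local_proj y \<Lambda> = (\<lambda>\<sigma> \<tau>. \<Prod>i\<in>\<Lambda>. P (y i) (\<sigma> i) (\<tau> i))"

text \<open>The n-th moment of the family Hamiltonian in the product state. The volume is a separate
  argument so that different families can be compared in one volume; \<open>moment_ambient\<close>
  removes the dependence.\<close>

definition moment :: "('s \<Rightarrow> 'l) \<Rightarrow> nat \<Rightarrow> 's set \<Rightarrow> 's set set \<Rightarrow> real" where
  "moment y n \<Lambda> \<A> = Re (ktrace (cfg \<Lambda>) (kmult (cfg \<Lambda>) (kpow (cfg \<Lambda>) (fam_ham \<Lambda> \<A>) n) (local_proj y \<Lambda>))) / (\<Prod>i\<in>\<Lambda>. tr (y i))"

definition hnorm :: "'s set \<Rightarrow> real" where
  "hnorm A = kopnorm (cfg A) (\<Phi> A)"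

text \<open>The expectation of \<open>exp (- \<beta> (\<Sum>A\<in>\<A>. \<Phi> A))\<close> in the product state with densities \<open>P (y i) / tr (y i)\<close>.\<close>

definition fam_weight :: "real \<Rightarrow> ('s \<Rightarrow> 'l) \<Rightarrow> 's set set \<Rightarrow> real" where
  "fam_weight \<beta> y \<A> = (\<Sum>n. (- \<beta>) ^ n / fact n * moment y n (\<Union>\<A>) \<A>)"

text \<open>For an orthogonal projection the trace is the squared Hilbert-Schmidt norm, hence real
  and, for a nonzero one, positive.\<close>

lemma P_trace: "ktrace UNIV (P l) = complex_of_real (\<Sum>a\<in>UNIV. \<Sum>b\<in>UNIV. (cmod (P l a b))\<^sup>2)"
proof -
  have "P l a a = (\<Sum>b\<in>UNIV. complex_of_real ((cmod (P l a b))\<^sup>2))" for a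
  proof -
    have "P l a a = (\<Sum>b\<in>UNIV. P l a b * P l b a)"
      using fun_cong[OF fun_cong[OF P_idem[of l]], of a a] by (simp add: kmult_def)
    also have "\<dots> = (\<Sum>b\<in>UNIV. complex_of_real ((cmod (P l a b))\<^sup>2))"
    proof (intro sum.cong refl)
      fix b
      show "P l a b * P l b a = complex_of_real ((cmod (P l a b))\<^sup>2)"
        using complex_norm_square[of "P l a b"] P_hermitian[of l b a] by simp
    qed
    finally show ?thesis .
  qed
  then show ?thesis unfolding ktrace_def of_real_sum by (intro sum.cong refl) simp
qed

lemma tr_pos: "tr l > 0"
proof -
  obtain a b where ab: "P l a b \<noteq> 0" using P_nonzero by blast
  have "0 < (cmod (P l a b))\<^sup>2" using ab by simp
  also have "\<dots> \<le> (\<Sum>b\<in>UNIV. (cmod (P l a b))\<^sup>2)" by (rule member_le_sum) auto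
  also have "\<dots> \<le> (\<Sum>a\<in>UNIV. \<Sum>b\<in>UNIV. (cmod (P l a b))\<^sup>2)"
    by (rule member_le_sum) (auto intro: sum_nonneg)
  finally show ?thesis by (simp add: tr_def P_trace)
qed

lemma ktrace_P: "ktrace UNIV (P l) = complex_of_real (tr l)"
  by (simp add: tr_def P_trace)

lemma ktrace_local_proj:
  assumes "finite \<Lambda>"
  shows "ktrace (cfg \<Lambda>) (local_proj y \<Lambda>) = complex_of_real (\<Prod>i\<in>\<Lambda>. tr (y i))"
proof -
  have "(\<Prod>i\<in>\<Lambda>. \<Sum>a\<in>UNIV. P (y i) a a) = (\<Sum>\<sigma>\<in>PiE \<Lambda> (\<lambda>_. UNIV). \<Prod>i\<in>\<Lambda>. P (y i) (\<sigma> i) (\<sigma> i))"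
    by (rule prod_sum_PiE) (use assms in auto)
  then show ?thesis
    using ktrace_P by (simp add: ktrace_def local_proj_def cfg_def)
qed

lemma local_proj_hermitian: "local_proj y \<Lambda> \<sigma> \<tau> = cnj (local_proj y \<Lambda> \<tau> \<sigma>)"
  unfolding local_proj_def cnj_prod by (intro prod.cong refl P_hermitian)

lemma local_proj_idem:
  assumes "finite \<Lambda>"
  shows "kmult (cfg \<Lambda>) (local_proj y \<Lambda>) (local_proj y \<Lambda>) \<sigma> \<tau> = local_proj y \<Lambda> \<sigma> \<tau>"
proof -
  have "(\<Prod>i\<in>\<Lambda>. \<Sum>a\<in>UNIV. P (y i) (\<sigma> i) a * P (y i) a (\<tau> i))
      = (\<Sum>\<rho>\<in>PiE \<Lambda> (\<lambda>_. UNIV). \<Prod>i\<in>\<Lambda>. P (y i) (\<sigma> i) (\<rho> i) * P (y i) (\<rho> i) (\<tau> i))"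
    by (rule prod_sum_PiE) (use assms in auto)
  moreover have "(\<Sum>a\<in>UNIV. P l b a * P l a c) = P l b c" for l b c
    using fun_cong[OF fun_cong[OF P_idem[of l]], of b c] by (simp add: kmult_def)
  ultimately show ?thesis
    by (simp add: kmult_def local_proj_def cfg_def prod.distrib)
qed

lemma local_proj_tens:
  assumes "finite G" "finite G'" "G \<inter> G' = {}"
  shows "local_proj y (G \<union> G') = tens G G' (local_proj y G) (local_proj y G')"
  by (intro ext) (simp add: local_proj_def tens_def prod.union_disjoint[OF assms])

lemma fam_ham_hermitian:
  assumes "finite \<Lambda>" "\<Union>\<A> \<subseteq> \<Lambda>" "\<sigma> \<in> cfg \<Lambda>" "\<tau> \<in> cfg \<Lambda>"
  shows "fam_ham \<Lambda> \<A> \<sigma> \<tau> = cnj (fam_ham \<Lambda> \<A> \<tau> \<sigma>)"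
  unfolding fam_ham_def cnj_sum
proof (intro sum.cong refl)
  fix A assume "A \<in> \<A>"
  then have "finite A" using assms(1,2) by (meson Sup_le_iff finite_subset)
  then have "\<Phi> A (restrict \<sigma> A) (restrict \<tau> A) = cnj (\<Phi> A (restrict \<tau> A) (restrict \<sigma> A))"
    by (intro Phi_hermitian) auto
  then show "emb A \<Lambda> (\<Phi> A) \<sigma> \<tau> = cnj (emb A \<Lambda> (\<Phi> A) \<tau> \<sigma>)" by (auto simp: emb_def)
qed

lemma moment_real:
  assumes "finite \<Lambda>" "\<Union>\<A> \<subseteq> \<Lambda>"
  shows "ktrace (cfg \<Lambda>) (kmult (cfg \<Lambda>) (kpow (cfg \<Lambda>) (fam_ham \<Lambda> \<A>) n) (local_proj y \<Lambda>))
    = complex_of_real (moment y n \<Lambda> \<A> * (\<Prod>i\<in>\<Lambda>. tr (y i)))"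
proof -
  have "(\<Prod>i\<in>\<Lambda>. tr (y i)) \<noteq> 0" using tr_pos assms(1) by (simp add: less_imp_neq[symmetric])
  then have "moment y n \<Lambda> \<A> * (\<Prod>i\<in>\<Lambda>. tr (y i))
      = Re (ktrace (cfg \<Lambda>) (kmult (cfg \<Lambda>) (kpow (cfg \<Lambda>) (fam_ham \<Lambda> \<A>) n) (local_proj y \<Lambda>)))"
    by (simp add: moment_def)
  moreover have "complex_of_real (Re (ktrace (cfg \<Lambda>) (kmult (cfg \<Lambda>) (kpow (cfg \<Lambda>) (fam_ham \<Lambda> \<A>) n) (local_proj y \<Lambda>))))
      = ktrace (cfg \<Lambda>) (kmult (cfg \<Lambda>) (kpow (cfg \<Lambda>) (fam_ham \<Lambda> \<A>) n) (local_proj y \<Lambda>))"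
    by (rule ktrace_kmult_real) (auto intro!: kpow_hermitian finite_cfg fam_ham_hermitian local_proj_hermitian assms)
  ultimately show ?thesis by simp
qed

lemma fam_ham_Un:
  assumes "finite \<A>" "finite \<B>" "\<A> \<inter> \<B> = {}" "\<Union>\<A> \<subseteq> G" "\<Union>\<B> \<subseteq> G'" "G \<inter> G' = {}"
  shows "fam_ham (G \<union> G') (\<A> \<union> \<B>) = (\<lambda>\<sigma> \<tau>. tens G G' (fam_ham G \<A>) kid \<sigma> \<tau> + tens G G' kid (fam_ham G' \<B>) \<sigma> \<tau>)"
proof (intro ext)
  fix \<sigma> \<tau>
  have "(\<Sum>A\<in>\<A>. emb A (G \<union> G') (\<Phi> A) \<sigma> \<tau>) = tens G G' (fam_ham G \<A>) kid \<sigma> \<tau>"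
    unfolding tens_def fam_ham_def sum_distrib_right
  proof (intro sum.cong refl)
    fix A assume "A \<in> \<A>"
    then have "A \<subseteq> G" using assms by auto
    then show "emb A (G \<union> G') (\<Phi> A) \<sigma> \<tau> = emb A G (\<Phi> A) (restrict \<sigma> G) (restrict \<tau> G) * kid (restrict \<sigma> G') (restrict \<tau> G')"
      by (simp add: emb_Un_left assms(6) tens_def)
  qed
  moreover have "(\<Sum>A\<in>\<B>. emb A (G \<union> G') (\<Phi> A) \<sigma> \<tau>) = tens G G' kid (fam_ham G' \<B>) \<sigma> \<tau>"
    unfolding tens_def fam_ham_def sum_distrib_left
  proof (intro sum.cong refl)
    fix A assume "A \<in> \<B>"
    then have "A \<subseteq> G'" using assms by auto
    then show "emb A (G \<union> G') (\<Phi> A) \<sigma> \<tau> = kid (restrict \<sigma> G) (restrict \<tau> G) * emb A G' (\<Phi> A) (restrict \<sigma> G') (restrict \<tau> G')"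
      by (simp add: emb_Un_right assms(6) tens_def)
  qed
  ultimately show "fam_ham (G \<union> G') (\<A> \<union> \<B>) \<sigma> \<tau> = tens G G' (fam_ham G \<A>) kid \<sigma> \<tau> + tens G G' kid (fam_ham G' \<B>) \<sigma> \<tau>"
    using sum.union_disjoint[OF assms(1,2,3), of "\<lambda>A. emb A (G \<union> G') (\<Phi> A) \<sigma> \<tau>"] by (simp add: fam_ham_def)
qed

text \<open>Independence of disjoint regions in a product state: the power expands binomially over
  commuting parts, and trace and projections factorise over the tensor product.\<close>

lemma moment_Un:
  assumes "finite \<A>" "finite \<B>" "\<A> \<inter> \<B> = {}" "\<Union>\<A> \<subseteq> G" "\<Union>\<B> \<subseteq> G'" "G \<inter> G' = {}"
    and fin: "finite G" "finite G'"
  shows "moment y n (G \<union> G') (\<A> \<union> \<B>) = (\<Sum>k\<le>n. of_nat (n choose k) * (moment y k G \<A> * moment y (n - k) G' \<B>))"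
proof -
  let ?S = "cfg (G \<union> G') :: ('s \<Rightarrow> 'm) set"
  let ?K = "fam_ham G \<A>" and ?L = "fam_ham G' \<B>"
  let ?T = "\<lambda>k. tens G G' (kpow (cfg G) ?K k) (kpow (cfg G') ?L (n - k))"
  have "ktrace ?S (kmult ?S (kpow ?S (fam_ham (G \<union> G') (\<A> \<union> \<B>)) n) (local_proj y (G \<union> G')))
      = (\<Sum>\<sigma>\<in>?S. \<Sum>\<rho>\<in>?S. (\<Sum>k\<le>n. of_nat (n choose k) * ?T k \<sigma> \<rho>) * local_proj y (G \<union> G') \<rho> \<sigma>)"
    unfolding ktrace_def kmult_def fam_ham_Un[OF assms(1-6)]
    by (intro sum.cong refl) (simp add: kpow_tens_sum[OF fin assms(6)])
  also have "\<dots> = (\<Sum>\<sigma>\<in>?S. \<Sum>k\<le>n. \<Sum>\<rho>\<in>?S. of_nat (n choose k) * (?T k \<sigma> \<rho> * local_proj y (G \<union> G') \<rho> \<sigma>))"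
    unfolding sum_distrib_right mult.assoc by (intro sum.cong refl sum.swap)
  also have "\<dots> = (\<Sum>k\<le>n. of_nat (n choose k) * ktrace ?S (kmult ?S (?T k) (local_proj y (G \<union> G'))))"
    unfolding ktrace_def kmult_def sum_distrib_left by (rule sum.swap)
  also have "\<dots> = (\<Sum>k\<le>n. of_nat (n choose k) *
      (ktrace (cfg G) (kmult (cfg G) (kpow (cfg G) ?K k) (local_proj y G)) *
       ktrace (cfg G') (kmult (cfg G') (kpow (cfg G') ?L (n - k)) (local_proj y G'))))"
    unfolding local_proj_tens[OF fin assms(6)] kmult_tens[OF assms(6)] ktrace_tens[OF assms(6)] ..
  also have "\<dots> = complex_of_real (\<Sum>k\<le>n. of_nat (n choose k) *
      (moment y k G \<A> * (\<Prod>i\<in>G. tr (y i)) * (moment y (n - k) G' \<B> * (\<Prod>i\<in>G'. tr (y i)))))"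
    by (simp add: moment_real[OF fin(1) assms(4)] moment_real[OF fin(2) assms(5)])
  finally have "moment y n (G \<union> G') (\<A> \<union> \<B>) * (\<Prod>i\<in>G \<union> G'. tr (y i)) = (\<Sum>k\<le>n. of_nat (n choose k) *
      (moment y k G \<A> * (\<Prod>i\<in>G. tr (y i)) * (moment y (n - k) G' \<B> * (\<Prod>i\<in>G'. tr (y i)))))"
    using moment_real[of "G \<union> G'" "\<A> \<union> \<B>" n y] assms(4,5) fin
    by (simp only: of_real_eq_iff) (metis (no_types, lifting) Sup_union_distrib Un_mono finite_UnI of_real_eq_iff)
  also have "\<dots> = (\<Sum>k\<le>n. of_nat (n choose k) * (moment y k G \<A> * moment y (n - k) G' \<B>)) * (\<Prod>i\<in>G \<union> G'. tr (y i))"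
    unfolding prod.union_disjoint[OF fin assms(6)] sum_distrib_right by (intro sum.cong refl) simp
  finally have eq: "moment y n (G \<union> G') (\<A> \<union> \<B>) * (\<Prod>i\<in>G \<union> G'. tr (y i)) =
      (\<Sum>k\<le>n. of_nat (n choose k) * (moment y k G \<A> * moment y (n - k) G' \<B>)) * (\<Prod>i\<in>G \<union> G'. tr (y i))" .
  have "(\<Prod>i\<in>G \<union> G'. tr (y i)) \<noteq> 0" using tr_pos fin by (simp add: less_imp_neq[symmetric])
  with eq show ?thesis by (simp only: mult_cancel_right) simp
qed

lemma moment_empty:
  assumes "finite \<Lambda>"
  shows "moment y n \<Lambda> {} = (if n = 0 then 1 else 0)"
proof (cases n)
  case 0
  have "ktrace (cfg \<Lambda>) (kmult (cfg \<Lambda>) kid (local_proj y \<Lambda>)) = ktrace (cfg \<Lambda>) (local_proj y \<Lambda>)"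
    unfolding ktrace_def by (intro sum.cong refl) (simp add: kmult_kid_left assms)
  moreover have "(\<Prod>i\<in>\<Lambda>. tr (y i)) \<noteq> 0" using tr_pos assms by (simp add: less_imp_neq[symmetric])
  ultimately show ?thesis using 0 ktrace_local_proj[OF assms, of y] by (simp add: moment_def kpow_0 del: of_real_prod)
next
  case (Suc k)
  have "fam_ham \<Lambda> {} = (\<lambda>\<sigma> \<tau>. 0)" by (simp add: fam_ham_def)
  then have "kpow (cfg \<Lambda>) (fam_ham \<Lambda> {}) n = (\<lambda>\<sigma> \<tau>. 0)" by (simp add: Suc kpow_Suc kmult_def)
  then show ?thesis using Suc by (simp add: moment_def kmult_def ktrace_def)
qed

text \<open>The remaining sites carry the empty family, whose only nonzero moment is the zeroth,
  equal to 1; \<open>moment_Un\<close> then reduces to one term.\<close>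

lemma moment_ambient:
  assumes "finite \<Lambda>" "finite \<A>" "\<Union>\<A> \<subseteq> \<Lambda>"
  shows "moment y n \<Lambda> \<A> = moment y n (\<Union>\<A>) \<A>"
proof -
  have fin: "finite (\<Union>\<A>)" "finite (\<Lambda> - \<Union>\<A>)" using finite_subset[OF assms(3,1)] assms(1) by auto
  have "moment y n (\<Union>\<A> \<union> (\<Lambda> - \<Union>\<A>)) (\<A> \<union> {}) =
      (\<Sum>k\<le>n. of_nat (n choose k) * (moment y k (\<Union>\<A>) \<A> * moment y (n - k) (\<Lambda> - \<Union>\<A>) {}))"
    by (rule moment_Un) (use assms fin in auto)
  also have "\<dots> = (\<Sum>k\<le>n. if k = n then moment y n (\<Union>\<A>) \<A> else 0)"
    by (intro sum.cong refl) (auto simp: moment_empty[OF fin(2)])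
  also have "\<dots> = moment y n (\<Union>\<A>) \<A>" by simp
  finally show ?thesis using assms(3) by (simp add: Un_absorb1)
qed

section \<open>Words of interaction terms and their norm bounds\<close>

lemma hnorm_nonneg: "finite A \<Longrightarrow> 0 \<le> hnorm A"
  unfolding hnorm_def by (simp add: kopnorm_nonneg)

definition kword :: "'s set \<Rightarrow> 's set list \<Rightarrow> ('s \<Rightarrow> 'm) \<Rightarrow> ('s \<Rightarrow> 'm) \<Rightarrow> complex" where
  "kword \<Lambda> ws = foldr (\<lambda>A M. kmult (cfg \<Lambda>) (emb A \<Lambda> (\<Phi> A)) M) ws kid"

lemma kword_Cons: "kword \<Lambda> (A # ws) = kmult (cfg \<Lambda>) (emb A \<Lambda> (\<Phi> A)) (kword \<Lambda> ws)"
  by (simp add: kword_def)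

lemma kbound_kword:
  assumes "finite \<Lambda>" "\<Union>(set ws) \<subseteq> \<Lambda>"
  shows "kbound (cfg \<Lambda>) (kword \<Lambda> ws) (prod_list (map hnorm ws))"
  using assms(2)
proof (induction ws)
  case Nil
  then show ?case using assms(1) by (simp add: kword_def kbound_kid)
next
  case (Cons A ws)
  then have A: "A \<subseteq> \<Lambda>" "finite A" using finite_subset[OF _ assms(1)] by auto
  have "kbound (cfg \<Lambda>) (emb A \<Lambda> (\<Phi> A)) (hnorm A)"
    by (rule kbound_emb) (use A assms(1) hnorm_nonneg in \<open>auto simp: hnorm_def kbound_kopnorm\<close>)
  then show ?case using Cons A by (simp add: kword_Cons kbound_kmult hnorm_nonneg)
qed

lemma kpow_eq_sum_words:
  assumes "finite \<A>"
  shows "kpow (cfg \<Lambda>) (fam_ham \<Lambda> \<A>) n \<sigma> \<tau> = (\<Sum>ws\<in>{ws. set ws \<subseteq> \<A> \<and> length ws = n}. kword \<Lambda> ws \<sigma> \<tau>)"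
proof (induction n arbitrary: \<sigma>)
  case 0
  have "{ws. set ws \<subseteq> \<A> \<and> length ws = 0} = {[]}" by auto
  then show ?case by (simp add: kpow_0 kword_def)
next
  case (Suc n)
  let ?W = "{ws. set ws \<subseteq> \<A> \<and> length ws = n}"
  have "kpow (cfg \<Lambda>) (fam_ham \<Lambda> \<A>) (Suc n) \<sigma> \<tau> =
      (\<Sum>\<rho>\<in>cfg \<Lambda>. \<Sum>A\<in>\<A>. \<Sum>ws\<in>?W. emb A \<Lambda> (\<Phi> A) \<sigma> \<rho> * kword \<Lambda> ws \<rho> \<tau>)"
    unfolding kpow_Suc kmult_def[of "cfg \<Lambda>" "fam_ham \<Lambda> \<A>"] Suc sum_product[symmetric] by (simp add: fam_ham_def)
  also have "\<dots> = (\<Sum>A\<in>\<A>. \<Sum>\<rho>\<in>cfg \<Lambda>. \<Sum>ws\<in>?W. emb A \<Lambda> (\<Phi> A) \<sigma> \<rho> * kword \<Lambda> ws \<rho> \<tau>)"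
    by (rule sum.swap)
  also have "\<dots> = (\<Sum>A\<in>\<A>. \<Sum>ws\<in>?W. \<Sum>\<rho>\<in>cfg \<Lambda>. emb A \<Lambda> (\<Phi> A) \<sigma> \<rho> * kword \<Lambda> ws \<rho> \<tau>)"
    by (intro sum.cong refl sum.swap)
  finally show ?case by (simp add: sum_words_Suc[OF assms] kword_Cons kmult_def)
qed

definition wmoment :: "('s \<Rightarrow> 'l) \<Rightarrow> 's set \<Rightarrow> 's set list \<Rightarrow> real" where
  "wmoment y \<Lambda> ws = Re (ktrace (cfg \<Lambda>) (kmult (cfg \<Lambda>) (kword \<Lambda> ws) (local_proj y \<Lambda>))) / (\<Prod>i\<in>\<Lambda>. tr (y i))"

lemma moment_eq_sum_words:
  assumes "finite \<A>"
  shows "moment y n \<Lambda> \<A> = (\<Sum>ws\<in>{ws. set ws \<subseteq> \<A> \<and> length ws = n}. wmoment y \<Lambda> ws)"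
proof -
  let ?W = "{ws. set ws \<subseteq> \<A> \<and> length ws = n}"
  have "ktrace (cfg \<Lambda>) (kmult (cfg \<Lambda>) (kpow (cfg \<Lambda>) (fam_ham \<Lambda> \<A>) n) (local_proj y \<Lambda>))
      = (\<Sum>\<sigma>\<in>cfg \<Lambda>. \<Sum>\<rho>\<in>cfg \<Lambda>. \<Sum>ws\<in>?W. kword \<Lambda> ws \<sigma> \<rho> * local_proj y \<Lambda> \<rho> \<sigma>)"
    by (simp add: ktrace_def kmult_def kpow_eq_sum_words[OF assms] sum_distrib_right)
  also have "\<dots> = (\<Sum>\<sigma>\<in>cfg \<Lambda>. \<Sum>ws\<in>?W. \<Sum>\<rho>\<in>cfg \<Lambda>. kword \<Lambda> ws \<sigma> \<rho> * local_proj y \<Lambda> \<rho> \<sigma>)"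
    by (intro sum.cong refl sum.swap)
  also have "\<dots> = (\<Sum>ws\<in>?W. ktrace (cfg \<Lambda>) (kmult (cfg \<Lambda>) (kword \<Lambda> ws) (local_proj y \<Lambda>)))"
    unfolding ktrace_def kmult_def by (rule sum.swap)
  finally show ?thesis by (simp add: moment_def wmoment_def sum_divide_distrib)
qed

text \<open>The trace of K P is at most the norm of K times the trace of P, and the normalisation
  cancels that trace. The bound is therefore independent of the labels, which is the source of all
  uniformity in X.\<close>

lemma wmoment_le:
  assumes "finite \<Lambda>" "\<Union>(set ws) \<subseteq> \<Lambda>"
  shows "\<bar>wmoment y \<Lambda> ws\<bar> \<le> prod_list (map hnorm ws)"
proof -
  let ?t = "\<Prod>i\<in>\<Lambda>. tr (y i)"
  have t: "?t > 0" by (simp add: prod_pos tr_pos)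
  have "\<bar>Re (ktrace (cfg \<Lambda>) (kmult (cfg \<Lambda>) (kword \<Lambda> ws) (local_proj y \<Lambda>)))\<bar>
      \<le> cmod (ktrace (cfg \<Lambda>) (kmult (cfg \<Lambda>) (kword \<Lambda> ws) (local_proj y \<Lambda>)))" by (rule abs_Re_le_cmod)
  also have "\<dots> \<le> prod_list (map hnorm ws) * Re (ktrace (cfg \<Lambda>) (local_proj y \<Lambda>))"
    by (rule ktrace_projection_le[OF kbound_kword[OF assms]]) (rule local_proj_hermitian, rule local_proj_idem[OF assms(1)])
  also have "\<dots> = prod_list (map hnorm ws) * ?t" by (simp add: ktrace_local_proj[OF assms(1)] del: of_real_prod)
  finally show ?thesis using t by (simp add: wmoment_def divide_le_eq)
qed

lemma moment_le:
  assumes "finite \<Lambda>" "finite \<A>" "\<Union>\<A> \<subseteq> \<Lambda>"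
  shows "\<bar>moment y n \<Lambda> \<A>\<bar> \<le> (\<Sum>A\<in>\<A>. hnorm A) ^ n"
  unfolding moment_eq_sum_words[OF assms(2)] power_eq_sum_words[OF assms(2)]
  by (rule order_trans[OF sum_abs], rule sum_mono, rule wmoment_le) (use assms in auto)

section \<open>The exponential series and its activities\<close>

lemma fam_weight_summable:
  assumes "finite \<Lambda>" "finite \<A>" "\<Union>\<A> \<subseteq> \<Lambda>"
  shows "summable (\<lambda>n. norm ((- \<beta>) ^ n / fact n * moment y n \<Lambda> \<A>))"
proof (rule summable_comparison_test[OF _ summable_exp[of "\<bar>\<beta>\<bar> * (\<Sum>A\<in>\<A>. hnorm A)"]], intro exI allI impI)
  fix n
  have "norm (norm ((- \<beta>) ^ n / fact n * moment y n \<Lambda> \<A>)) = \<bar>\<beta>\<bar> ^ n / fact n * \<bar>moment y n \<Lambda> \<A>\<bar>"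
    by (simp add: abs_mult power_abs)
  also have "\<dots> \<le> \<bar>\<beta>\<bar> ^ n / fact n * (\<Sum>A\<in>\<A>. hnorm A) ^ n"
    by (intro mult_left_mono moment_le assms) auto
  also have "\<dots> = inverse (fact n) * (\<bar>\<beta>\<bar> * (\<Sum>A\<in>\<A>. hnorm A)) ^ n"
    by (simp add: power_mult_distrib divide_inverse mult_ac)
  finally show "norm (norm ((- \<beta>) ^ n / fact n * moment y n \<Lambda> \<A>)) \<le> inverse (fact n) * (\<bar>\<beta>\<bar> * (\<Sum>A\<in>\<A>. hnorm A)) ^ n" .
qed

lemma fam_weight_sums:
  assumes "finite \<Lambda>" "finite \<A>" "\<Union>\<A> \<subseteq> \<Lambda>"
  shows "(\<lambda>n. (- \<beta>) ^ n / fact n * moment y n \<Lambda> \<A>) sums fam_weight \<beta> y \<A>"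
  using summable_sums[OF summable_norm_cancel[OF fam_weight_summable[OF assms, of \<beta> y]]]
  by (simp add: fam_weight_def moment_ambient[OF assms])

text \<open>The Cauchy product of the two series: the binomial coefficients of
  \<open>moment_Un\<close> combine with the factorials.\<close>

lemma fam_weight_union:
  assumes "finite \<A>" "finite \<B>" "finite (\<Union>(\<A> \<union> \<B>))" "{} \<notin> \<A> \<union> \<B>" "\<Union>\<A> \<inter> \<Union>\<B> = {}"
  shows "fam_weight \<beta> y (\<A> \<union> \<B>) = fam_weight \<beta> y \<A> * fam_weight \<beta> y \<B>"
proof -
  have fin: "finite (\<Union>\<A>)" "finite (\<Union>\<B>)" using assms(3) by auto
  have disj: "\<A> \<inter> \<B> = {}"
  proof (rule ccontr)
    assume "\<A> \<inter> \<B> \<noteq> {}"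
    then obtain A where A: "A \<in> \<A>" "A \<in> \<B>" by blast
    then have "A \<subseteq> \<Union>\<A> \<inter> \<Union>\<B>" by blast
    then have "A = {}" using assms(5) by simp
    then show False using A assms(4) by blast
  qed
  let ?a = "\<lambda>n. (- \<beta>) ^ n / fact n * moment y n (\<Union>\<A>) \<A>" and ?b = "\<lambda>n. (- \<beta>) ^ n / fact n * moment y n (\<Union>\<B>) \<B>"
  have "(\<lambda>n. \<Sum>k\<le>n. ?a k * ?b (n - k)) sums ((\<Sum>k. ?a k) * (\<Sum>k. ?b k))"
    by (rule Cauchy_product_sums; rule fam_weight_summable) (use assms fin in auto)
  moreover have "(\<Sum>k\<le>n. ?a k * ?b (n - k)) = (- \<beta>) ^ n / fact n * moment y n (\<Union>(\<A> \<union> \<B>)) (\<A> \<union> \<B>)" for n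
  proof -
    have "moment y n (\<Union>\<A> \<union> \<Union>\<B>) (\<A> \<union> \<B>) =
        (\<Sum>k\<le>n. of_nat (n choose k) * (moment y k (\<Union>\<A>) \<A> * moment y (n - k) (\<Union>\<B>) \<B>))"
      by (rule moment_Un) (use assms fin disj in auto)
    then have "(- \<beta>) ^ n / fact n * moment y n (\<Union>(\<A> \<union> \<B>)) (\<A> \<union> \<B>) =
        (\<Sum>k\<le>n. (- \<beta>) ^ n / fact n * (of_nat (n choose k) * (moment y k (\<Union>\<A>) \<A> * moment y (n - k) (\<Union>\<B>) \<B>)))"
      by (simp add: sum_distrib_left)
    also have "\<dots> = (\<Sum>k\<le>n. ?a k * ?b (n - k))"
    proof (intro sum.cong refl)
      fix k assume "k \<in> {..n}"
      then have k: "k \<le> n" by simp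
      have "(- \<beta>) ^ n = (- \<beta>) ^ k * (- \<beta>) ^ (n - k)" using k by (simp flip: power_add)
      then show "(- \<beta>) ^ n / fact n * (of_nat (n choose k) * (moment y k (\<Union>\<A>) \<A> * moment y (n - k) (\<Union>\<B>) \<B>))
          = ?a k * ?b (n - k)"
        by (simp add: binomial_fact[OF k] field_simps)
    qed
    finally show ?thesis by simp
  qed
  ultimately show ?thesis by (simp add: fam_weight_def sums_iff)
qed

lemma fam_weight_empty: "fam_weight \<beta> y {} = 1"
proof -
  have "(\<lambda>n. (- \<beta>) ^ n / fact n * moment y n {} {}) sums fam_weight \<beta> y {}"
    by (rule fam_weight_sums) auto
  moreover have "(\<lambda>n. (- \<beta>) ^ n / fact n * moment y n {} {}) = (\<lambda>n. if n = 0 then 1 else 0)"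
    by (simp add: moment_empty fun_eq_iff)
  ultimately show ?thesis using sums_unique2 sums_single[of 0 "\<lambda>_. 1 :: real"] by fastforce
qed

text \<open>Order by order, the coefficient at \<open>\<C>\<close> collects the words whose letters
  are exactly the members of \<open>\<C>\<close>, each bounded by the product of its norms. Scalars
  in place of the operators give the same words, and their series sums to
  \<open>mob_exp_additive\<close>.\<close>

lemma mob_fam_weight_le:
  assumes "0 \<le> \<beta>" "finite \<C>" "finite (\<Union>\<C>)"
  shows "\<bar>mob (fam_weight \<beta> y) \<C>\<bar> \<le> (\<Prod>A\<in>\<C>. exp (\<beta> * hnorm A) - 1)"
proof -
  \<comment> \<open>All subfamilies are evaluated in this one volume; otherwise the moment of a word
    would change with the family and \<open>maj_words\<close> would not apply.\<close>
  let ?L = "\<Union>\<C>"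
  have "maj \<C> (fam_weight \<beta> y) (\<lambda>\<A>. exp (\<Sum>A\<in>\<A>. \<beta> * hnorm A))"
  proof (rule maj_sums[OF assms(2), where f = "\<lambda>n \<A>. ((- \<beta>) ^ n / fact n) * moment y n ?L \<A>"
        and g = "\<lambda>n \<A>. (\<beta> ^ n / fact n) * (\<Sum>A\<in>\<A>. hnorm A) ^ n"])
    fix n
    have "maj \<C> (\<lambda>\<A>. \<Sum>ws\<in>{ws. set ws \<subseteq> \<A> \<and> length ws = n}. wmoment y ?L ws)
        (\<lambda>\<A>. \<Sum>ws\<in>{ws. set ws \<subseteq> \<A> \<and> length ws = n}. prod_list (map hnorm ws))"
      by (rule maj_words[OF assms(2)], rule wmoment_le[OF assms(3)]) auto
    then have "maj \<C> (moment y n ?L) (\<lambda>\<A>. (\<Sum>A\<in>\<A>. hnorm A) ^ n)"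
      by (rule maj_cong) (use finite_subset[OF _ assms(2)] in \<open>auto simp: moment_eq_sum_words power_eq_sum_words\<close>)
    then show "maj \<C> (\<lambda>\<A>. (- \<beta>) ^ n / fact n * moment y n ?L \<A>) (\<lambda>\<A>. \<beta> ^ n / fact n * (\<Sum>A\<in>\<A>. hnorm A) ^ n)"
      by (rule maj_scale) (use assms(1) in \<open>simp add: power_abs\<close>)
  next
    fix \<A> assume A: "\<A> \<subseteq> \<C>"
    show "(\<lambda>n. (- \<beta>) ^ n / fact n * moment y n ?L \<A>) sums fam_weight \<beta> y \<A>"
      by (rule fam_weight_sums[OF assms(3) finite_subset[OF A assms(2)]]) (use A in auto)
    have "(\<lambda>n. (\<Sum>A\<in>\<A>. \<beta> * hnorm A) ^ n /\<^sub>R fact n) sums exp (\<Sum>A\<in>\<A>. \<beta> * hnorm A)"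
      by (rule exp_converges)
    then show "(\<lambda>n. \<beta> ^ n / fact n * (\<Sum>A\<in>\<A>. hnorm A) ^ n) sums exp (\<Sum>A\<in>\<A>. \<beta> * hnorm A)"
      by (simp add: sum_distrib_left[symmetric] power_mult_distrib divide_inverse mult_ac)
  qed
  then show ?thesis unfolding maj_def mob_exp_additive[OF assms(2), symmetric] by blast
qed

text \<open>The trace is taken termwise in the exponential series. \<open>H\<close> and
  \<open>B\<close> are required to agree only on configurations of the volume, so both the
  Hamiltonian with its {} term and the identity matrix can be inserted.\<close>

lemma ktrace_kexp:
  assumes fin: "finite \<Lambda>" "finite \<A>" "\<Union>\<A> \<subseteq> \<Lambda>"
    and H: "\<And>\<sigma> \<tau>. \<sigma> \<in> cfg \<Lambda> \<Longrightarrow> \<tau> \<in> cfg \<Lambda> \<Longrightarrow> H \<sigma> \<tau> = - complex_of_real \<beta> * fam_ham \<Lambda> \<A> \<sigma> \<tau>"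
    and B: "\<And>\<sigma> \<tau>. \<sigma> \<in> cfg \<Lambda> \<Longrightarrow> \<tau> \<in> cfg \<Lambda> \<Longrightarrow> B \<sigma> \<tau> = local_proj y \<Lambda> \<sigma> \<tau>"
  shows "ktrace (cfg \<Lambda>) (kmult (cfg \<Lambda>) (kexp (cfg \<Lambda>) H) B) = complex_of_real ((\<Prod>i\<in>\<Lambda>. tr (y i)) * fam_weight \<beta> y \<A>)"
proof -
  let ?S = "cfg \<Lambda> :: ('s \<Rightarrow> 'm) set"
  let ?K = "kpow ?S (fam_ham \<Lambda> \<A>)"
  let ?c = "\<lambda>n. (- complex_of_real \<beta>) ^ n / fact n"
  let ?h = "\<Sum>A\<in>\<A>. hnorm A"
  have pw: "kpow ?S H n \<sigma> \<tau> / of_nat (fact n) = ?c n * ?K n \<sigma> \<tau>" if "\<sigma> \<in> ?S" "\<tau> \<in> ?S" for n \<sigma> \<tau>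
  proof -
    have "kpow ?S H n \<sigma> \<tau> = kpow ?S (\<lambda>\<sigma> \<tau>. - complex_of_real \<beta> * fam_ham \<Lambda> \<A> \<sigma> \<tau>) n \<sigma> \<tau>"
      by (rule kpow_cong) (use H that in auto)
    then show ?thesis unfolding kpow_scale[OF that(1)] by simp
  qed
  have bd: "cmod (?K n \<sigma> \<tau>) \<le> ?h ^ n" if "\<sigma> \<in> ?S" "\<tau> \<in> ?S" for n \<sigma> \<tau>
    unfolding kpow_eq_sum_words[OF fin(2)] power_eq_sum_words[OF fin(2)]
    by (rule order_trans[OF norm_sum], rule sum_mono, rule kbound_entry[OF finite_cfg[OF fin(1)] kbound_kword[OF fin(1)]])
       (use fin that in auto)
  have ex: "(\<lambda>n. ?c n * ?K n \<sigma> \<tau>) sums kexp ?S H \<sigma> \<tau>" if st: "\<sigma> \<in> ?S" "\<tau> \<in> ?S" for \<sigma> \<tau>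
  proof -
    have "summable (\<lambda>n. ?c n * ?K n \<sigma> \<tau>)"
    proof (rule summable_comparison_test[OF _ summable_exp[of "\<bar>\<beta>\<bar> * ?h"]], intro exI allI impI)
      fix n
      have "norm (?c n * ?K n \<sigma> \<tau>) = \<bar>\<beta>\<bar> ^ n / fact n * cmod (?K n \<sigma> \<tau>)"
        by (simp add: norm_mult norm_divide norm_power)
      also have "\<dots> \<le> \<bar>\<beta>\<bar> ^ n / fact n * ?h ^ n" by (intro mult_left_mono bd st) auto
      also have "\<dots> = inverse (fact n) * (\<bar>\<beta>\<bar> * ?h) ^ n"
        by (simp add: power_mult_distrib divide_inverse mult_ac)
      finally show "norm (?c n * ?K n \<sigma> \<tau>) \<le> inverse (fact n) * (\<bar>\<beta>\<bar> * ?h) ^ n" .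
    qed
    then show ?thesis unfolding kexp_def pw[OF st] by (rule summable_sums)
  qed
  have "(\<lambda>n. \<Sum>\<sigma>\<in>?S. \<Sum>\<rho>\<in>?S. (?c n * ?K n \<sigma> \<rho>) * local_proj y \<Lambda> \<rho> \<sigma>) sums
      (\<Sum>\<sigma>\<in>?S. \<Sum>\<rho>\<in>?S. kexp ?S H \<sigma> \<rho> * local_proj y \<Lambda> \<rho> \<sigma>)"
    by (intro sums_sum sums_mult2 ex)
  also have "(\<Sum>\<sigma>\<in>?S. \<Sum>\<rho>\<in>?S. kexp ?S H \<sigma> \<rho> * local_proj y \<Lambda> \<rho> \<sigma>) = ktrace ?S (kmult ?S (kexp ?S H) B)"
    unfolding ktrace_def kmult_def by (intro sum.cong refl) (simp add: B)
  also have "(\<lambda>n. \<Sum>\<sigma>\<in>?S. \<Sum>\<rho>\<in>?S. (?c n * ?K n \<sigma> \<rho>) * local_proj y \<Lambda> \<rho> \<sigma>) =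
      (\<lambda>n. complex_of_real ((\<Prod>i\<in>\<Lambda>. tr (y i)) * ((- \<beta>) ^ n / fact n * moment y n \<Lambda> \<A>)))"
  proof
    fix n
    have "(\<Sum>\<sigma>\<in>?S. \<Sum>\<rho>\<in>?S. (?c n * ?K n \<sigma> \<rho>) * local_proj y \<Lambda> \<rho> \<sigma>) = ?c n * ktrace ?S (kmult ?S (?K n) (local_proj y \<Lambda>))"
      by (simp add: ktrace_def kmult_def sum_distrib_left mult.assoc)
    then show "(\<Sum>\<sigma>\<in>?S. \<Sum>\<rho>\<in>?S. (?c n * ?K n \<sigma> \<rho>) * local_proj y \<Lambda> \<rho> \<sigma>) =
        complex_of_real ((\<Prod>i\<in>\<Lambda>. tr (y i)) * ((- \<beta>) ^ n / fact n * moment y n \<Lambda> \<A>))"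
      by (simp add: moment_real[OF fin(1,3)] mult_ac)
  qed
  finally have 1: "(\<lambda>n. complex_of_real ((\<Prod>i\<in>\<Lambda>. tr (y i)) * ((- \<beta>) ^ n / fact n * moment y n \<Lambda> \<A>))) sums
      ktrace ?S (kmult ?S (kexp ?S H) B)" .
  have 2: "(\<lambda>n. complex_of_real ((\<Prod>i\<in>\<Lambda>. tr (y i)) * ((- \<beta>) ^ n / fact n * moment y n \<Lambda> \<A>))) sums
      complex_of_real ((\<Prod>i\<in>\<Lambda>. tr (y i)) * fam_weight \<beta> y \<A>)"
    by (intro sums_of_real sums_mult fam_weight_sums fin)
  show ?thesis by (rule sums_unique2[OF 1 2])
qed

text \<open>The activity is set to 0 at infinite sets because \<open>family_gas\<close> asks for
  nonnegativity at every set, while \<open>hnorm\<close> is known to be nonnegative only at finite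
  ones.\<close>

lemma family_gas_fam_weight:
  fixes a e \<beta> :: real
  assumes "0 \<le> \<beta>" "0 \<le> a" "0 \<le> e" "exp e \<le> 2 - exp (- a)"
    and "\<And>L y. finite L \<Longrightarrow> (\<Sum>A\<in>{A\<in>Pow L. y \<in> A}. (exp (\<beta> * hnorm A) - 1) * exp ((a + e) * card A)) \<le> e"
  shows "family_gas (fam_weight \<beta>) (\<lambda>A. if finite A then exp (\<beta> * hnorm A) - 1 else 0) a e"
proof
  show "\<bar>mob (fam_weight \<beta> y) \<A>\<bar> \<le> (\<Prod>A\<in>\<A>. if finite A then exp (\<beta> * hnorm A) - 1 else 0)"
    if "finite \<A>" "finite (\<Union>\<A>)" "{} \<notin> \<A>" for y \<A>
  proof -
    have "finite A" if "A \<in> \<A>" for A using that \<open>finite (\<Union>\<A>)\<close> by (meson Sup_upper finite_subset)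
    then have "(\<Prod>A\<in>\<A>. if finite A then exp (\<beta> * hnorm A) - 1 else 0) = (\<Prod>A\<in>\<A>. exp (\<beta> * hnorm A) - 1)"
      by (intro prod.cong) auto
    then show ?thesis using mob_fam_weight_le[OF assms(1) that(1,2)] by simp
  qed
  show "(\<Sum>A\<in>{A\<in>Pow L. y \<in> A}. (if finite A then exp (\<beta> * hnorm A) - 1 else 0) * exp ((a + e) * card A)) \<le> e"
    if "finite L" for L y
  proof -
    have "(\<Sum>A\<in>{A\<in>Pow L. y \<in> A}. (if finite A then exp (\<beta> * hnorm A) - 1 else 0) * exp ((a + e) * card A))
       = (\<Sum>A\<in>{A\<in>Pow L. y \<in> A}. (exp (\<beta> * hnorm A) - 1) * exp ((a + e) * card A))"
      by (intro sum.cong refl) (use finite_subset[OF _ that] in auto)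
    then show ?thesis using assms(5)[OF that] by simp
  qed
qed (use assms hnorm_nonneg fam_weight_empty fam_weight_union in auto)

end

section \<open>Spectral resolution\<close>

lemma eigvec_zero: "eigvec X x (\<lambda>_. 0)"
  by (simp add: eigvec_def)

lemma eigvec_sum:
  assumes "\<And>i. i \<in> I \<Longrightarrow> eigvec X x (f i)"
  shows "eigvec X x (\<lambda>a. \<Sum>i\<in>I. c i * f i a)"
  unfolding eigvec_def
proof
  fix a
  have "(\<Sum>b\<in>UNIV. X a b * (\<Sum>i\<in>I. c i * f i b)) = (\<Sum>i\<in>I. c i * (\<Sum>b\<in>UNIV. X a b * f i b))"
    unfolding sum_distrib_left by (subst sum.swap) (simp add: mult_ac)
  also have "\<dots> = (\<Sum>i\<in>I. c i * (complex_of_real x * f i a))"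
    by (intro sum.cong refl) (use assms in \<open>simp add: eigvec_def\<close>)
  finally show "(\<Sum>b\<in>UNIV. X a b * (\<Sum>i\<in>I. c i * f i b)) = complex_of_real x * (\<Sum>i\<in>I. c i * f i a)"
    by (simp add: sum_distrib_left mult_ac)
qed

lemma eigvec_orthogonal:
  assumes "selfadjoint X" "eigvec X x v" "eigvec X y w" "x \<noteq> y"
  shows "(\<Sum>a\<in>UNIV. cnj (v a) * w a) = 0"
proof -
  have "complex_of_real y * (\<Sum>a\<in>UNIV. cnj (v a) * w a) = (\<Sum>a\<in>UNIV. cnj (v a) * (\<Sum>b\<in>UNIV. X a b * w b))"
    using assms(3) by (simp add: eigvec_def sum_distrib_left mult_ac)
  also have "\<dots> = (\<Sum>a\<in>UNIV. \<Sum>b\<in>UNIV. cnj (X b a * v a) * w b)"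
  proof -
    have "X a b = cnj (X b a)" for a b using assms(1) unfolding selfadjoint_def by blast
    then have "cnj (X b a * v a) * w b = cnj (v a) * (X a b * w b)" for a b
      by (metis complex_cnj_mult mult.assoc mult.commute)
    then show ?thesis by (simp only: sum_distrib_left)
  qed
  also have "\<dots> = (\<Sum>b\<in>UNIV. \<Sum>a\<in>UNIV. cnj (X b a * v a) * w b)" by (rule sum.swap)
  also have "\<dots> = (\<Sum>b\<in>UNIV. cnj (\<Sum>a\<in>UNIV. X b a * v a) * w b)" by (simp add: sum_distrib_right)
  also have "\<dots> = complex_of_real x * (\<Sum>a\<in>UNIV. cnj (v a) * w a)"
    using assms(2) by (simp add: eigvec_def sum_distrib_left mult_ac)
  finally show ?thesis using assms(4) by simp
qed

text \<open>The spectral theorem by the Rayleigh quotient. If eigenvectors did not span, their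
  orthogonal complement W would be nonzero and invariant, and a maximiser of the quadratic form on
  its unit sphere would be an eigenvector orthogonal to itself. Space, span and inner product are
  real, the last being the real part of the Hermitian one.\<close>

lemma span_eigenvectors:
  fixes X :: "'m::finite \<Rightarrow> 'm \<Rightarrow> complex"
  assumes "selfadjoint X"
  shows "span {v :: complex^'m. \<exists>x. eigvec X x (($) v)} = UNIV"
proof (rule ccontr)
  let ?V = "{v :: complex^'m. \<exists>x. eigvec X x (($) v)}"
  define T :: "complex^'m \<Rightarrow> complex^'m" where "T v = (\<chi> a. \<Sum>b\<in>UNIV. X a b * v $ b)" for v
  have lin: "linear T"
    by (rule linearI) (simp_all add: T_def vec_eq_iff algebra_simps sum.distrib scaleR_sum_right)
  have eig: "eigvec X x (($) v) \<longleftrightarrow> T v = x *\<^sub>R v" for x v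
    by (simp add: eigvec_def T_def vec_eq_iff scaleR_conv_of_real[where 'a = complex])
  have sa: "T v \<bullet> w = v \<bullet> T w" for v w
  proof -
    have X: "X a b = cnj (X b a)" for a b using assms unfolding selfadjoint_def by blast
    have ip: "x \<bullet> y = Re (cnj x * y)" for x y :: complex by (simp add: inner_complex_def)
    have "T v \<bullet> w = Re (\<Sum>a\<in>UNIV. \<Sum>b\<in>UNIV. cnj (X a b * v $ b) * w $ a)"
      by (simp add: inner_vec_def ip T_def sum_distrib_right)
    also have "\<dots> = Re (\<Sum>b\<in>UNIV. \<Sum>a\<in>UNIV. cnj (X a b * v $ b) * w $ a)" by (subst sum.swap) simp
    also have "\<dots> = Re (\<Sum>b\<in>UNIV. \<Sum>a\<in>UNIV. cnj (v $ b) * (X b a * w $ a))"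
    proof (intro arg_cong[where f = Re] sum.cong refl)
      fix a b
      have "cnj (X a b) = X b a" using X[of b a] by simp
      then show "cnj (X a b * v $ b) * w $ a = cnj (v $ b) * (X b a * w $ a)" by simp
    qed
    also have "\<dots> = v \<bullet> T w"
      by (simp add: inner_vec_def ip T_def sum_distrib_left)
    finally show ?thesis .
  qed
  assume "span ?V \<noteq> UNIV"
  then have "dim ?V < DIM(complex^'m)"
    by (metis dim_eq_full dim_subset_UNIV le_neq_implies_less)
  then obtain z where z: "z \<noteq> 0" "\<And>y. y \<in> span ?V \<Longrightarrow> orthogonal z y"
    using orthogonal_to_subspace_exists by blast
  define W where "W = {v. \<forall>u\<in>?V. u \<bullet> v = 0}"
  have W: "subspace W"
    unfolding W_def by (auto simp: subspace_def inner_add_right)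
  have zW: "z \<in> W"
    unfolding W_def
  proof (intro CollectI ballI)
    fix u assume "u \<in> ?V"
    then have "orthogonal z u" by (intro z(2) span_base)
    then show "u \<bullet> z = 0" by (simp add: orthogonal_def inner_commute)
  qed
  have TW: "T v \<in> W" if "v \<in> W" for v
    unfolding W_def
  proof (intro CollectI ballI)
    fix u assume u: "u \<in> ?V"
    then obtain x where "T u = x *\<^sub>R u" using eig by auto
    then have "u \<bullet> T v = x * (u \<bullet> v)" using sa[of u v] by simp
    then show "u \<bullet> T v = 0" using that u by (auto simp: W_def)
  qed
  let ?S = "W \<inter> sphere 0 1"
  have "closed W" using W by (rule closed_subspace)
  then have comp: "compact ?S" by (simp add: closed_Int_compact)
  have "z /\<^sub>R norm z \<in> ?S" using z(1) zW W by (auto intro: subspace_scale)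
  then have ne: "?S \<noteq> {}" by blast
  have cont: "continuous_on ?S (\<lambda>v. v \<bullet> T v)"
    by (intro continuous_on_inner continuous_on_id linear_continuous_on) (simp add: lin linear_conv_bounded_linear[symmetric])
  obtain v where v: "v \<in> ?S" "\<And>w. w \<in> ?S \<Longrightarrow> w \<bullet> T w \<le> v \<bullet> T v"
    using continuous_attains_sup[OF comp ne cont] by blast
  define l where "l = v \<bullet> T v"
  have v1: "v \<in> W" "norm v = 1" using v(1) by auto
  have le: "w \<bullet> T w \<le> l * (w \<bullet> w)" if w: "w \<in> W" for w
  proof (cases "w = 0")
    case True
    then show ?thesis using lin by (simp add: linear_0)
  next
    case False
    have "(w /\<^sub>R norm w) \<bullet> T (w /\<^sub>R norm w) \<le> l"
      unfolding l_def by (rule v(2)) (use w W False in \<open>auto intro: subspace_scale\<close>)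
    moreover have "T (w /\<^sub>R norm w) = T w /\<^sub>R norm w" using lin by (simp add: linear_scale)
    ultimately have "(w \<bullet> T w) / (norm w * norm w) \<le> l" by (simp add: divide_inverse mult_ac)
    then have "w \<bullet> T w \<le> l * (norm w * norm w)" using False by (simp add: divide_le_eq)
    then show ?thesis by (simp add: dot_square_norm power2_eq_square)
  qed
  \<comment> \<open>The residual of v as an eigenvector with value l. Moving v in the direction g
    changes the quotient to first order by a multiple of \<open>g \<bullet> g\<close>, so maximality
    forces g = 0.\<close>
  define g where "g = T v - l *\<^sub>R v"
  have gW: "g \<in> W" unfolding g_def using W v1 TW by (intro subspace_diff subspace_scale) auto
  define C where "C = l * (g \<bullet> g) - g \<bullet> T g"
  have var: "2 * t * (g \<bullet> g) \<le> t\<^sup>2 * C" for t :: real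
  proof -
    have "v + t *\<^sub>R g \<in> W" using W v1 gW by (intro subspace_add subspace_scale)
    then have "(v + t *\<^sub>R g) \<bullet> T (v + t *\<^sub>R g) \<le> l * ((v + t *\<^sub>R g) \<bullet> (v + t *\<^sub>R g))" by (rule le)
    moreover have "T (v + t *\<^sub>R g) = T v + t *\<^sub>R T g" using lin by (simp add: linear_add linear_scale)
    moreover have "v \<bullet> T g = g \<bullet> T v" using sa[of v g] by (simp add: inner_commute)
    moreover have "g \<bullet> T v = g \<bullet> g + l * (g \<bullet> v)"
    proof -
      have "T v = g + l *\<^sub>R v" by (simp add: g_def)
      then show ?thesis by (simp add: inner_add_right)
    qed
    moreover have "v \<bullet> v = 1" using v1 by (simp add: dot_square_norm)
    moreover have "v \<bullet> T v = l" by (simp add: l_def)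
    ultimately show ?thesis
      unfolding C_def by (simp add: inner_add_left inner_add_right inner_commute power2_eq_square algebra_simps)
  qed
  have "g \<bullet> g = 0"
  proof (rule ccontr)
    assume "g \<bullet> g \<noteq> 0"
    then have gg: "g \<bullet> g > 0" by (simp add: inner_gt_zero_iff)
    \<comment> \<open>A step so small that the second-order term \<open>t * C\<close> stays below
      \<open>g \<bullet> g\<close>, while \<open>var\<close> needs it to be at least twice that; the
      1 prevents division by 0.\<close>
    define t where "t = (g \<bullet> g) / (1 + \<bar>C\<bar>)"
    have t: "t > 0" using gg by (simp add: t_def add_pos_nonneg)
    have "2 * t * (g \<bullet> g) \<le> t\<^sup>2 * C" by (rule var)
    then have "2 * (g \<bullet> g) \<le> t * C" using t by (simp add: power2_eq_square)
    also have "\<dots> \<le> t * (1 + \<bar>C\<bar>)" using t by (intro mult_left_mono) auto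
    also have "\<dots> = g \<bullet> g" by (simp add: t_def add_pos_nonneg)
    finally show False using gg by simp
  qed
  then have "T v = l *\<^sub>R v" by (simp add: g_def)
  then have "v \<in> ?V" using eig by auto
  then have "v \<bullet> v = 0" using v1 by (auto simp: W_def)
  then show False using v1 by simp
qed

lemma eigvec_decomposition:
  fixes X :: "'m::finite \<Rightarrow> 'm \<Rightarrow> complex" and v :: "'m \<Rightarrow> complex"
  assumes "selfadjoint X"
  obtains Y u where "finite Y" "\<And>x. eigvec X x (u x)" "\<And>a. v a = (\<Sum>x\<in>Y. u x a)"
proof -
  let ?V = "{v :: complex^'m. \<exists>x. eigvec X x (($) v)}"
  have "(\<chi> a. v a) \<in> span ?V" using span_eigenvectors[OF assms] by simp
  then obtain t r where t: "finite t" "t \<subseteq> ?V" "(\<chi> a. v a) = (\<Sum>w\<in>t. r w *\<^sub>R w)"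
    unfolding span_explicit by blast
  have "\<forall>w\<in>t. \<exists>x. eigvec X x (($) w)" using t(2) by blast
  then obtain ev where ev: "\<And>w. w \<in> t \<Longrightarrow> eigvec X (ev w) (($) w)"
    using bchoice by metis
  define u where "u x = (\<lambda>a. \<Sum>w\<in>{w\<in>t. ev w = x}. complex_of_real (r w) * w $ a)" for x
  show thesis
  proof (rule that[of "ev ` t" u])
    show "eigvec X x (u x)" for x
      unfolding u_def by (rule eigvec_sum) (use ev in auto)
    show "v a = (\<Sum>x\<in>ev ` t. u x a)" for a
    proof -
      have "v a = (\<Sum>w\<in>t. r w *\<^sub>R w) $ a" using arg_cong[OF t(3), of "\<lambda>x. x $ a"] by simp
      also have "\<dots> = (\<Sum>w\<in>t. complex_of_real (r w) * w $ a)" by (simp add: scaleR_conv_of_real[where 'a = complex])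
      also have "\<dots> = (\<Sum>x\<in>ev ` t. \<Sum>w\<in>{w\<in>t. ev w = x}. complex_of_real (r w) * w $ a)"
        by (rule sum.group[symmetric]) (use t in auto)
      finally show ?thesis by (simp add: u_def)
    qed
  qed (use t in auto)
qed

text \<open>Each basis vector is decomposed into eigenvectors; the component for x of the b-th one
  becomes column b of a matrix P x. Orthogonality of eigenspaces alone shows that P x is the
  projection described by \<open>specproj\<close>.\<close>

lemma spectral_resolution:
  fixes X :: "'m::finite \<Rightarrow> 'm \<Rightarrow> complex"
  assumes sa: "selfadjoint X"
  shows "finite (spec X)"
    and "\<And>x a b. x \<in> spec X \<Longrightarrow> specproj X x a b = cnj (specproj X x b a)"
    and "\<And>x. x \<in> spec X \<Longrightarrow> kmult UNIV (specproj X x) (specproj X x) = specproj X x"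
    and "\<And>x. x \<in> spec X \<Longrightarrow> \<exists>a b. specproj X x a b \<noteq> 0"
    and "\<And>a b. (\<Sum>x\<in>spec X. specproj X x a b) = kid a b"
proof -
  have "\<exists>Y u. finite Y \<and> (\<forall>x. eigvec X x (u x)) \<and> (\<forall>a. kid a b = (\<Sum>x\<in>Y. u x a))" for b
    using eigvec_decomposition[OF sa, of "\<lambda>a. kid a b"] by metis
  then obtain Yb ub where Yb: "\<And>b. finite (Yb b)" "\<And>b x. eigvec X x (ub b x)"
    "\<And>b a. kid a b = (\<Sum>x\<in>Yb b. ub b x a)" by metis
  define Y where "Y = (\<Union>b. Yb b)"
  define P where "P x a b = (if x \<in> Yb b then ub b x a else 0)" for x a b
  have finY: "finite Y" using Yb(1) by (simp add: Y_def)
  have col: "eigvec X x (\<lambda>a. P x a b)" for x b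
    using Yb(2) eigvec_zero by (cases "x \<in> Yb b") (auto simp: P_def)
  have sumP: "(\<Sum>x\<in>Y. P x a b) = kid a b" for a b
    unfolding Yb(3) P_def by (rule sum.mono_neutral_cong_right) (use finY in \<open>auto simp: Y_def\<close>)
  have orth: "(\<Sum>c\<in>UNIV. cnj (P x c a) * v c) = 0" if "eigvec X y v" "x \<noteq> y" for x y v a
    using eigvec_orthogonal[OF sa col that(1)] that(2) by simp
  \<comment> \<open>The resolution of the identity, applied through its adjoint: the conjugated
    columns are what orthogonality can be used against.\<close>
  have expand: "v a = (\<Sum>x\<in>Y. \<Sum>c\<in>UNIV. cnj (P x c a) * v c)" for v a
  proof -
    have "v a = (\<Sum>c\<in>UNIV. cnj (kid c a) * v c)"
      by (simp add: kid_def if_distrib[of cnj] if_distrib[of "\<lambda>x. x * _"] sum.delta cong: if_cong)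
    also have "\<dots> = (\<Sum>c\<in>UNIV. \<Sum>x\<in>Y. cnj (P x c a) * v c)"
      by (simp add: sumP[symmetric] sum_distrib_right)
    finally show ?thesis by (subst sum.swap)
  qed
  \<comment> \<open>For an eigenvector all terms of the expansion but its own vanish, so the adjoint
    of P x fixes the eigenvectors for x.\<close>
  have comp: "v a = (\<Sum>c\<in>UNIV. cnj (P x c a) * v c)" if v: "eigvec X x v" and x: "x \<in> Y" for x v a
  proof -
    have "v a = (\<Sum>y\<in>Y. if y = x then \<Sum>c\<in>UNIV. cnj (P x c a) * v c else 0)"
      unfolding expand[of v a] by (intro sum.cong refl) (use orth[OF v] in auto)
    then show ?thesis using finY x by (simp add: sum.delta)
  qed
  have specY: "spec X \<subseteq> Y"
  proof
    fix x assume "x \<in> spec X"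
    then obtain v where v: "v \<noteq> (\<lambda>_. 0)" "eigvec X x v" by (auto simp: spec_def)
    show "x \<in> Y"
    proof (rule ccontr)
      assume x: "x \<notin> Y"
      have "v a = 0" for a
        unfolding expand[of v a] by (intro sum.neutral ballI orth[OF v(2)]) (use x in blast)
      then show False using v(1) by auto
    qed
  qed
  \<comment> \<open>Applied to the columns of P x itself, this says that P x equals its adjoint
    times P x. Hermitian symmetry and idempotence both follow.\<close>
  have PP: "P x a b = (\<Sum>c\<in>UNIV. cnj (P x c a) * P x c b)" if "x \<in> Y" for x a b
    by (rule comp[OF col that])
  have herm: "P x a b = cnj (P x b a)" if "x \<in> Y" for x a b
  proof -
    have "cnj (P x b a) = cnj (\<Sum>c\<in>UNIV. cnj (P x c b) * P x c a)"
      by (rule arg_cong[OF PP[OF that]])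
    also have "\<dots> = (\<Sum>c\<in>UNIV. cnj (P x c a) * P x c b)" by (simp add: mult.commute)
    also have "\<dots> = P x a b" by (rule PP[OF that, symmetric])
    finally show ?thesis by (rule sym)
  qed
  have idem: "kmult UNIV (P x) (P x) = P x" if "x \<in> Y" for x
  proof (intro ext)
    fix a b
    have "kmult UNIV (P x) (P x) a b = (\<Sum>c\<in>UNIV. cnj (P x c a) * P x c b)"
      unfolding kmult_def by (intro sum.cong refl) (subst herm[OF that, of a], rule refl)
    then show "kmult UNIV (P x) (P x) a b = P x a b" by (rule trans[OF _ PP[OF that, symmetric]])
  qed
  have fixv: "v = (\<lambda>a. \<Sum>b\<in>UNIV. P x a b * v b)" if "eigvec X x v" "x \<in> Y" for x v
  proof
    fix a
    show "v a = (\<Sum>b\<in>UNIV. P x a b * v b)"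
    proof (rule trans[OF comp[OF that]])
      show "(\<Sum>c\<in>UNIV. cnj (P x c a) * v c) = (\<Sum>b\<in>UNIV. P x a b * v b)"
        by (intro sum.cong refl) (subst herm[OF that(2), of a], rule refl)
    qed
  qed
  have rng: "eigvec X x (\<lambda>a. \<Sum>b\<in>UNIV. P x a b * w b)" for x w
    using eigvec_sum[of UNIV X x "\<lambda>b a. P x a b" w] col by (simp add: mult.commute)
  have proj: "specproj X x = P x" if x: "x \<in> Y" for x
    unfolding specproj_def
  proof (rule the_equality)
    show "(\<forall>a b. P x a b = cnj (P x b a)) \<and> kmult UNIV (P x) (P x) = P x \<and>
       (\<forall>v. eigvec X x v \<longleftrightarrow> (\<exists>w. v = (\<lambda>a. \<Sum>b\<in>UNIV. P x a b * w b)))"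
      using herm[OF x] idem[OF x] fixv[OF _ x] rng by blast
  next
    \<comment> \<open>Uniqueness for the definite description: both matrices project onto the same
      eigenspace, so R = P R and P = R P, and taking the adjoint of the first identity gives R =
      P.\<close>
    fix R assume R: "(\<forall>a b. R a b = cnj (R b a)) \<and> kmult UNIV R R = R \<and>
       (\<forall>v. eigvec X x v \<longleftrightarrow> (\<exists>w. v = (\<lambda>a. \<Sum>b\<in>UNIV. R a b * w b)))"
    note R1 = conjunct1[OF R, rule_format] and R2 = conjunct1[OF conjunct2[OF R]]
      and R3 = conjunct2[OF conjunct2[OF R], rule_format]
    have colR: "eigvec X x (\<lambda>a. R a b)" for b
    proof -
      have "(\<lambda>a. R a b) = (\<lambda>a. \<Sum>c\<in>UNIV. R a c * kid c b)"
        by (simp add: kid_def if_distrib[of "\<lambda>x. _ * x"] sum.delta' cong: if_cong)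
      then show ?thesis by (intro iffD2[OF R3] exI)
    qed
    have 1: "R a b = (\<Sum>c\<in>UNIV. P x a c * R c b)" for a b
      using fun_cong[OF fixv[OF colR x], of a] by simp
    have 2: "P x a b = (\<Sum>c\<in>UNIV. R a c * P x c b)" for a b
    proof -
      obtain w where w: "(\<lambda>a. P x a b) = (\<lambda>a. \<Sum>d\<in>UNIV. R a d * w d)" using iffD1[OF R3 col[of x b]] by blast
      have "(\<Sum>c\<in>UNIV. R a c * P x c b) = (\<Sum>c\<in>UNIV. R a c * (\<Sum>d\<in>UNIV. R c d * w d))"
        by (intro sum.cong refl) (use fun_cong[OF w] in simp)
      also have "\<dots> = (\<Sum>d\<in>UNIV. (\<Sum>c\<in>UNIV. R a c * R c d) * w d)"
        unfolding sum_distrib_left sum_distrib_right by (subst sum.swap) (simp add: mult.assoc)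
      also have "\<dots> = (\<Sum>d\<in>UNIV. R a d * w d)"
        using fun_cong[OF fun_cong[OF R2], of a] by (simp add: kmult_def)
      also have "\<dots> = P x a b" using fun_cong[OF w, of a] by simp
      finally show ?thesis by simp
    qed
    show "R = P x"
    proof (intro ext)
      fix a b
      have "R a b = cnj (R b a)" by (rule R1)
      also have "\<dots> = (\<Sum>c\<in>UNIV. cnj (P x b c) * cnj (R c a))" by (subst 1[of b a]) simp
      also have "\<dots> = (\<Sum>c\<in>UNIV. R a c * P x c b)"
      proof (intro sum.cong refl)
        fix c
        have "cnj (R c a) = R a c" "cnj (P x b c) = P x c b" by (rule R1[symmetric], rule herm[OF x, symmetric])
        then show "cnj (P x b c) * cnj (R c a) = R a c * P x c b" by simp
      qed
      also have "\<dots> = P x a b" by (rule 2[symmetric])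
      finally show "R a b = P x a b" .
    qed
  qed
  show "finite (spec X)" using finite_subset[OF specY finY] .
  show "(\<Sum>x\<in>spec X. specproj X x a b) = kid a b" for a b
    unfolding sumP[symmetric]
  proof (rule sum.mono_neutral_cong_left[OF finY specY])
    show "\<forall>x\<in>Y - spec X. P x a b = 0"
    proof
      fix x assume "x \<in> Y - spec X"
      then have "(\<lambda>a. P x a b) = (\<lambda>_. 0)" using col unfolding spec_def by blast
      then show "P x a b = 0" by (rule fun_cong)
    qed
    show "specproj X x a b = P x a b" if "x \<in> spec X" for x using proj that specY by auto
  qed
  fix x assume xs: "x \<in> spec X"
  then have x: "x \<in> Y" using specY by blast
  show "specproj X x a b = cnj (specproj X x b a)" for a b unfolding proj[OF x] by (rule herm[OF x])
  show "kmult UNIV (specproj X x) (specproj X x) = specproj X x" unfolding proj[OF x] by (rule idem[OF x])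
  show "\<exists>a b. specproj X x a b \<noteq> 0"
  proof (rule ccontr)
    assume "\<not> (\<exists>a b. specproj X x a b \<noteq> 0)"
    then have z: "P x a b = 0" for a b using proj[OF x] by auto
    obtain v where v: "v \<noteq> (\<lambda>_. 0)" "eigvec X x v" using xs by (auto simp: spec_def)
    have "v = (\<lambda>_. 0)" using fixv[OF v(2) x] z by simp
    then show False using v(1) by blast
  qed
qed

section \<open>Measures defined by an extended potential\<close>

lemma finite_box: "finite (box n :: (int^'d) set)"
proof -
  have "(box n :: (int^'d) set) \<subseteq> (\<lambda>f. \<chi> k. f k) ` (PiE UNIV (\<lambda>_. {- int n..int n}))"
  proof
    fix x :: "int^'d" assume x: "x \<in> box n"
    have "-int n \<le> x $ k \<and> x $ k \<le> int n" for k using x by (simp add: box_def abs_le_iff minus_le_iff)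
    then show "x \<in> (\<lambda>f. \<chi> k. f k) ` (PiE UNIV (\<lambda>_. {- int n..int n}))"
      by (intro image_eqI[of _ _ "($) x"]) (auto simp: vec_eq_iff)
  qed
  then show ?thesis by (rule finite_subset) (intro finite_imageI finite_PiE, auto)
qed

lemma eventually_subset_box:
  fixes A :: "(int^'d) set"
  assumes "finite A"
  shows "eventually (\<lambda>n. A \<subseteq> box n) sequentially"
proof -
  have "eventually (\<lambda>n. x \<in> box n) sequentially" for x :: "int^'d"
    unfolding eventually_sequentially
  proof (intro exI allI impI)
    fix n assume n: "nat (\<Sum>k\<in>UNIV. \<bar>x $ k\<bar>) \<le> n"
    have "\<bar>x $ k\<bar> \<le> int n" for k
    proof -
      have "\<bar>x $ k\<bar> \<le> (\<Sum>k\<in>UNIV. \<bar>x $ k\<bar>)" by (rule member_le_sum) auto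
      then show ?thesis using n by linarith
    qed
    then show "x \<in> box n" by (simp add: box_def)
  qed
  then have "eventually (\<lambda>n. \<forall>x\<in>A. x \<in> box n) sequentially"
    using assms by (intro eventually_ball_finite) auto
  then show ?thesis by (simp add: subset_iff Ball_def)
qed

lemma cyl_in_sets:
  assumes "space M = space (Omega_alg S)" "finite W" "\<zeta> \<in> W \<rightarrow>\<^sub>E S"
    and "\<And>i. i \<in> W \<Longrightarrow> (\<lambda>\<omega>. \<omega> i) \<in> measurable M (count_space S)"
  shows "cyl S W \<zeta> \<in> sets M"
proof -
  have "cyl S W \<zeta> = {\<omega> \<in> space M. \<forall>i\<in>W. \<omega> i = \<zeta> i}" by (simp add: cyl_def assms(1))
  also have "\<dots> \<in> sets M"
  proof (rule sets.sets_Collect_finite_All[OF _ assms(2)])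
    fix i assume i: "i \<in> W"
    then have "\<zeta> i \<in> S" using assms(3) by auto
    then have "(\<lambda>\<omega>. \<omega> i) -` {\<zeta> i} \<inter> space M \<in> sets M"
      by (intro measurable_sets[OF assms(4)[OF i]]) simp
    moreover have "(\<lambda>\<omega>. \<omega> i) -` {\<zeta> i} \<inter> space M = {\<omega> \<in> space M. \<omega> i = \<zeta> i}" by auto
    ultimately show "{\<omega> \<in> space M. \<omega> i = \<zeta> i} \<in> sets M" by simp
  qed
  finally show ?thesis .
qed

lemma cyl_in_Omega_alg:
  assumes "finite W" "\<zeta> \<in> W \<rightarrow>\<^sub>E S"
  shows "cyl S W \<zeta> \<in> sets (Omega_alg S)"
  by (rule cyl_in_sets[OF refl assms]) (simp add: Omega_alg_def measurable_component_singleton)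

text \<open>Dominated convergence for the counting measure; the bound passes to the limit function,
  so every sum involved is absolutely convergent.\<close>

lemma infsum_dominated_convergence:
  fixes f :: "nat \<Rightarrow> 'a \<Rightarrow> real"
  assumes "s summable_on I" "\<And>n A. A \<in> I \<Longrightarrow> \<bar>f n A\<bar> \<le> s A" "\<And>A. A \<in> I \<Longrightarrow> (\<lambda>n. f n A) \<longlonglongrightarrow> f' A"
  shows "(\<lambda>n. infsum (f n) I) \<longlonglongrightarrow> infsum f' I"
proof -
  have s: "s A \<ge> 0" if "A \<in> I" for A using assms(2)[OF that, of 0] by linarith
  have abs: "Infinite_Set_Sum.abs_summable_on g I" if "\<And>A. A \<in> I \<Longrightarrow> \<bar>g A\<bar> \<le> s A" for g
  proof -
    have "(\<lambda>A. \<bar>g A\<bar>) summable_on I"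
      by (rule summable_on_comparison_test[OF assms(1)]) (use that in auto)
    then show ?thesis using abs_summable_equivalent[of g I] by simp
  qed
  have f': "\<bar>f' A\<bar> \<le> s A" if "A \<in> I" for A
    by (rule LIMSEQ_le_const2[OF tendsto_rabs[OF assms(3)[OF that]]]) (use assms(2) that in auto)
  have "(\<lambda>n. lebesgue_integral (count_space I) (f n)) \<longlonglongrightarrow> lebesgue_integral (count_space I) f'"
  proof (rule integral_dominated_convergence)
    show "integrable (count_space I) s"
      using abs[of s] s unfolding Infinite_Set_Sum.abs_summable_on_def by simp
  qed (use assms in \<open>auto simp: AE_count_space\<close>)
  then show ?thesis
    using infsetsum_infsum[OF abs[OF assms(2)]] infsetsum_infsum[OF abs[OF f']]
    by (simp add: infsetsum_def)
qed

definition meets :: "'s set \<Rightarrow> 's set set" where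
  "meets V = {A. finite A \<and> A \<inter> V \<noteq> {}}"

definition labels :: "'s set \<Rightarrow> ('s \<Rightarrow> 'v) \<Rightarrow> 's \<Rightarrow> 'v option" where
  "labels V \<xi> = (\<lambda>i. if i \<in> V then Some (\<xi> i) else None)"

definition overwrite :: "'s set \<Rightarrow> ('s \<Rightarrow> 'v) \<Rightarrow> ('s \<Rightarrow> 'v option) \<Rightarrow> 's \<Rightarrow> 'v option" where
  "overwrite V \<xi> y = (\<lambda>i. if i \<in> V then Some (\<xi> i) else y i)"

definition erase :: "'s set \<Rightarrow> ('s \<Rightarrow> 'v option) \<Rightarrow> 's \<Rightarrow> 'v option" where
  "erase V y = (\<lambda>i. if i \<in> V then None else y i)"

text \<open>A potential on configurations in which sites may carry the additional label
  \<open>None\<close>, which stands for summation over the spin at that site.\<close>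

locale extended_potential =
  fixes S :: "real set" and \<psi> :: "(int^'d) set \<Rightarrow> ((int^'d) \<Rightarrow> real option) \<Rightarrow> real"
    and s :: "(int^'d) set \<Rightarrow> real"
  assumes finite_S: "finite S" and S_nonempty: "S \<noteq> {}"
    and psi_local: "(\<And>i. i \<in> A \<Longrightarrow> y i = y' i) \<Longrightarrow> \<psi> A y = \<psi> A y'"
    and psi_empty: "\<psi> {} y = 0"
    and psi_le: "finite A \<Longrightarrow> \<bar>\<psi> A y\<bar> \<le> s A"
    and s_summable: "s summable_on {A. finite A \<and> x \<in> A}"
    and psi_transl: "finite A \<Longrightarrow> \<psi> (transl i A) y = \<psi> A (\<lambda>j. y (j + i))"
    and psi_None: "finite L \<Longrightarrow> i \<in> L \<Longrightarrow>
      exp (\<Sum>A\<in>Pow L. \<psi> A (y(i := None))) = (\<Sum>v\<in>S. exp (\<Sum>A\<in>Pow L. \<psi> A (y(i := Some v))))"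
begin

definition weight :: "(int^'d) set \<Rightarrow> ((int^'d) \<Rightarrow> real option) \<Rightarrow> real" where
  "weight L y = exp (\<Sum>A\<in>Pow L. \<psi> A y)"

text \<open>The limiting probability of a cylinder. The limit is taken of the ratio, in which the
  contributions of sets away from the cylinder base cancel.\<close>

definition cyl_weight :: "((int^'d) \<Rightarrow> real option) \<Rightarrow> real" where
  "cyl_weight y = lim (\<lambda>n. weight (box n) y / weight (box n) (\<lambda>_. None))"

lemma weight_pos: "weight L y > 0"
  by (simp add: weight_def)

lemma s_summable_meets:
  assumes "finite V"
  shows "s summable_on (meets V)"
  using assms
proof (induction V rule: finite_induct)
  case empty
  then show ?case by (simp add: meets_def)
next
  case (insert x V)
  have "meets (insert x V) = {A. finite A \<and> x \<in> A} \<union> (meets V - {A. finite A \<and> x \<in> A})"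
    by (auto simp: meets_def)
  moreover have "s summable_on ({A. finite A \<and> x \<in> A} \<union> (meets V - {A. finite A \<and> x \<in> A}))"
    by (rule summable_on_Un_disjoint[OF s_summable])
       (use summable_on_subset_banach[OF insert.IH] in auto)
  ultimately show ?case by simp
qed

lemma psi_summable_meets:
  assumes "finite V"
  shows "(\<lambda>A. \<psi> A y) summable_on (meets V)"
proof -
  have "(\<lambda>A. \<bar>\<psi> A y\<bar>) summable_on (meets V)"
    by (rule summable_on_comparison_test[OF s_summable_meets[OF assms]])
       (use psi_le in \<open>auto simp: meets_def\<close>)
  then show ?thesis using summable_on_iff_abs_summable_on_real by auto
qed

text \<open>Sets that miss V see equal labels and cancel. The remaining exponents are dominated by 2
  s on \<open>meets V\<close>, and each set is eventually inside the box.\<close>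

lemma ratio_tendsto:
  assumes V: "finite V" and eq: "\<And>i. i \<notin> V \<Longrightarrow> y i = y' i"
  shows "(\<lambda>n. weight (box n) y / weight (box n) y') \<longlonglongrightarrow> exp ((\<Sum>\<^sub>\<infinity>A\<in>meets V. \<psi> A y) - (\<Sum>\<^sub>\<infinity>A\<in>meets V. \<psi> A y'))"
proof -
  let ?f = "\<lambda>n A. of_bool (A \<subseteq> box n) * (\<psi> A y - \<psi> A y')"
  have "(\<lambda>n. infsum (?f n) (meets V)) \<longlonglongrightarrow> infsum (\<lambda>A. \<psi> A y - \<psi> A y') (meets V)"
  proof (rule infsum_dominated_convergence)
    show "(\<lambda>A. s A + s A) summable_on (meets V)"
      by (intro summable_on_add s_summable_meets V)
    show "\<bar>?f n A\<bar> \<le> s A + s A" if "A \<in> meets V" for n A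
      using psi_le[of A y] psi_le[of A y'] that by (auto simp: meets_def)
    show "(\<lambda>n. ?f n A) \<longlonglongrightarrow> \<psi> A y - \<psi> A y'" if "A \<in> meets V" for A
      by (rule tendsto_eventually, rule eventually_mono[OF eventually_subset_box[of A]])
         (use that in \<open>auto simp: meets_def\<close>)
  qed
  moreover have "infsum (?f n) (meets V) = (\<Sum>A\<in>Pow (box n). \<psi> A y - \<psi> A y')" for n
  proof -
    have "infsum (?f n) (meets V) = infsum (?f n) (Pow (box n) \<inter> meets V)"
      by (rule infsum_cong_neutral) auto
    also have "\<dots> = (\<Sum>A\<in>Pow (box n) \<inter> meets V. \<psi> A y - \<psi> A y')"
      using finite_box[of n] by (subst infsum_finite) (auto intro!: sum.cong)
    also have "\<dots> = (\<Sum>A\<in>Pow (box n). \<psi> A y - \<psi> A y')"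
    proof (rule sum.mono_neutral_left)
      show "\<forall>A\<in>Pow (box n) - Pow (box n) \<inter> meets V. \<psi> A y - \<psi> A y' = 0"
      proof
        fix A assume A: "A \<in> Pow (box n) - Pow (box n) \<inter> meets V"
        then have "finite A" using finite_subset[OF _ finite_box[of n]] by auto
        then have "A \<inter> V = {}" using A by (auto simp: meets_def)
        then have "\<psi> A y = \<psi> A y'" by (intro psi_local eq) auto
        then show "\<psi> A y - \<psi> A y' = 0" by simp
      qed
    qed (use finite_box in auto)
    finally show ?thesis .
  qed
  moreover have "infsum (\<lambda>A. \<psi> A y - \<psi> A y') (meets V) = (\<Sum>\<^sub>\<infinity>A\<in>meets V. \<psi> A y) - (\<Sum>\<^sub>\<infinity>A\<in>meets V. \<psi> A y')"
    using infsum_add[of "\<lambda>A. \<psi> A y" "meets V" "\<lambda>A. - \<psi> A y'"] psi_summable_meets[OF V]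
    by (simp add: infsum_uminus summable_on_uminus)
  ultimately have "(\<lambda>n. exp (\<Sum>A\<in>Pow (box n). \<psi> A y - \<psi> A y')) \<longlonglongrightarrow> exp ((\<Sum>\<^sub>\<infinity>A\<in>meets V. \<psi> A y) - (\<Sum>\<^sub>\<infinity>A\<in>meets V. \<psi> A y'))"
    by (intro tendsto_exp) simp
  then show ?thesis by (simp add: weight_def exp_diff sum_subtractf)
qed

lemma cyl_weight_tendsto:
  assumes "finite V" "\<And>i. i \<notin> V \<Longrightarrow> y i = None"
  shows "(\<lambda>n. weight (box n) y / weight (box n) (\<lambda>_. None)) \<longlonglongrightarrow> cyl_weight y" and "cyl_weight y > 0"
proof -
  let ?l = "exp ((\<Sum>\<^sub>\<infinity>A\<in>meets V. \<psi> A y) - (\<Sum>\<^sub>\<infinity>A\<in>meets V. \<psi> A (\<lambda>_. None)))"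
  have 1: "(\<lambda>n. weight (box n) y / weight (box n) (\<lambda>_. None)) \<longlonglongrightarrow> ?l"
    by (rule ratio_tendsto) (use assms in auto)
  then have "cyl_weight y = ?l" unfolding cyl_weight_def by (rule limI)
  with 1 show "(\<lambda>n. weight (box n) y / weight (box n) (\<lambda>_. None)) \<longlonglongrightarrow> cyl_weight y" "cyl_weight y > 0" by auto
qed

text \<open>The base V can be much larger than L, yet only sets meeting L enter. This locality is
  what becomes the DLR equation.\<close>

lemma cyl_weight_ratio:
  assumes "finite V" "\<And>i. i \<notin> V \<Longrightarrow> y i = None" "\<And>i. i \<notin> V \<Longrightarrow> y' i = None"
    and L: "finite L" "\<And>i. i \<notin> L \<Longrightarrow> y i = y' i"
  shows "cyl_weight y = cyl_weight y' * exp ((\<Sum>\<^sub>\<infinity>A\<in>meets L. \<psi> A y) - (\<Sum>\<^sub>\<infinity>A\<in>meets L. \<psi> A y'))"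
proof -
  have 1: "(\<lambda>n. weight (box n) y / weight (box n) (\<lambda>_. None)) \<longlonglongrightarrow> cyl_weight y" using assms(1,2) by (rule cyl_weight_tendsto)
  have "(\<lambda>n. (weight (box n) y' / weight (box n) (\<lambda>_. None)) * (weight (box n) y / weight (box n) y'))
      \<longlonglongrightarrow> cyl_weight y' * exp ((\<Sum>\<^sub>\<infinity>A\<in>meets L. \<psi> A y) - (\<Sum>\<^sub>\<infinity>A\<in>meets L. \<psi> A y'))"
    by (intro tendsto_mult cyl_weight_tendsto[OF assms(1,3)] ratio_tendsto L)
  moreover have "(weight (box n) y' / weight (box n) (\<lambda>_. None)) * (weight (box n) y / weight (box n) y')
      = weight (box n) y / weight (box n) (\<lambda>_. None)" for n
    using weight_pos[of "box n" y'] by simp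
  ultimately show ?thesis using 1 LIMSEQ_unique by simp
qed

lemma cyl_weight_None: "cyl_weight (\<lambda>_. None) = 1"
proof -
  have "(\<lambda>n. weight (box n) (\<lambda>_. None) / weight (box n) (\<lambda>_. None)) \<longlonglongrightarrow> cyl_weight (\<lambda>_. None)"
    by (rule cyl_weight_tendsto[of "{}"]) auto
  then show ?thesis using weight_pos by (simp add: less_imp_neq[symmetric] LIMSEQ_const_iff)
qed

text \<open>The finite-volume identity \<open>psi_None\<close> holds in every box containing i and
  passes to the limit. It is Kolmogorov consistency for one site.\<close>

lemma cyl_weight_sum1:
  assumes "finite V" "\<And>i. i \<notin> V \<Longrightarrow> y i = None"
  shows "(\<Sum>v\<in>S. cyl_weight (y(i := Some v))) = cyl_weight (y(i := None))"
proof -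
  have 1: "(\<lambda>n. \<Sum>v\<in>S. weight (box n) (y(i := Some v)) / weight (box n) (\<lambda>_. None)) \<longlonglongrightarrow> (\<Sum>v\<in>S. cyl_weight (y(i := Some v)))"
    by (intro tendsto_sum cyl_weight_tendsto[of "insert i V"]) (use assms in auto)
  have 2: "(\<lambda>n. weight (box n) (y(i := None)) / weight (box n) (\<lambda>_. None)) \<longlonglongrightarrow> cyl_weight (y(i := None))"
    by (rule cyl_weight_tendsto[of "insert i V"]) (use assms in auto)
  have 3: "eventually (\<lambda>n. (\<Sum>v\<in>S. weight (box n) (y(i := Some v)) / weight (box n) (\<lambda>_. None))
      = weight (box n) (y(i := None)) / weight (box n) (\<lambda>_. None)) sequentially"
  proof (rule eventually_mono[OF eventually_subset_box[of "{i}"]])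
    fix n assume "{i} \<subseteq> box n"
    then have "weight (box n) (y(i := None)) = (\<Sum>v\<in>S. weight (box n) (y(i := Some v)))"
      unfolding weight_def by (intro psi_None finite_box) simp
    then show "(\<Sum>v\<in>S. weight (box n) (y(i := Some v)) / weight (box n) (\<lambda>_. None))
      = weight (box n) (y(i := None)) / weight (box n) (\<lambda>_. None)"
      by (simp only: sum_divide_distrib)
  qed simp
  show ?thesis by (rule LIMSEQ_unique[OF Lim_transform_eventually[OF 1 3] 2])
qed

lemma cyl_weight_sum:
  assumes "finite L" "finite V" "\<And>i. i \<notin> V \<Longrightarrow> y i = None"
  shows "(\<Sum>\<xi>\<in>L \<rightarrow>\<^sub>E S. cyl_weight (overwrite L \<xi> y)) = cyl_weight (erase L y)"
  using assms
proof (induction L arbitrary: y V rule: finite_induct)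
  case empty
  then show ?case by (simp add: overwrite_def erase_def)
next
  case (insert i L)
  have inj: "inj_on (\<lambda>(v, g). g(i := v)) (S \<times> (L \<rightarrow>\<^sub>E S))"
    using insert.hyps inj_combinator[of i L "\<lambda>_. S"] by (simp add: Pi_def inj_on_def)
  have "(\<Sum>\<xi>\<in>insert i L \<rightarrow>\<^sub>E S. cyl_weight (overwrite (insert i L) \<xi> y)) = (\<Sum>(v, \<xi>)\<in>S \<times> (L \<rightarrow>\<^sub>E S). cyl_weight (overwrite (insert i L) (\<xi>(i := v)) y))"
    unfolding PiE_insert_eq by (subst sum.reindex[OF inj]) (simp add: split_def)
  also have "\<dots> = (\<Sum>v\<in>S. \<Sum>\<xi>\<in>L \<rightarrow>\<^sub>E S. cyl_weight (overwrite L \<xi> (y(i := Some v))))"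
    unfolding sum.cartesian_product[symmetric]
  proof (intro sum.cong refl arg_cong[where f = cyl_weight])
    fix v \<xi>
    show "overwrite (insert i L) (\<xi>(i := v)) y = overwrite L \<xi> (y(i := Some v))"
      using insert.hyps by (auto simp: overwrite_def fun_eq_iff)
  qed
  also have "\<dots> = (\<Sum>v\<in>S. cyl_weight (erase L (y(i := Some v))))"
    by (intro sum.cong refl insert.IH[of "insert i V"]) (use insert.prems in auto)
  also have "\<dots> = (\<Sum>v\<in>S. cyl_weight ((erase L y)(i := Some v)))"
  proof (intro sum.cong refl arg_cong[where f = cyl_weight])
    show "erase L (y(i := Some v)) = (erase L y)(i := Some v)" for v
      using insert.hyps by (auto simp: erase_def fun_eq_iff)
  qed
  also have "\<dots> = cyl_weight ((erase L y)(i := None))"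
    by (rule cyl_weight_sum1[OF insert.prems(1)]) (use insert.prems in \<open>auto simp: erase_def\<close>)
  also have "(erase L y)(i := None) = erase (insert i L) y" by (auto simp: erase_def fun_eq_iff)
  finally show ?case .
qed

section \<open>Finite marginals and the limit measure\<close>

lemma cyl_weight_labels_pos: "finite V \<Longrightarrow> cyl_weight (labels V \<xi>) > 0"
  by (rule cyl_weight_tendsto[of V]) (auto simp: labels_def)

text \<open>The discrete law is pushed to Borel sets of real-valued configurations, the setting in
  which \<open>polish_projective\<close> extends consistent families.\<close>

definition marginal :: "(int^'d) set \<Rightarrow> ((int^'d) \<Rightarrow> real) measure" where
  "marginal J = distr (point_measure (J \<rightarrow>\<^sub>E S) (\<lambda>\<xi>. ennreal (cyl_weight (labels J \<xi>)))) (PiM J (\<lambda>_. borel)) (\<lambda>\<xi>. \<xi>)"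

lemma emeasure_marginal:
  assumes "finite J" "X \<in> sets (PiM J (\<lambda>_. borel))"
  shows "emeasure (marginal J) X = ennreal (\<Sum>\<xi>\<in>J \<rightarrow>\<^sub>E S. of_bool (\<xi> \<in> X) * cyl_weight (labels J \<xi>))"
proof -
  let ?PS = "J \<rightarrow>\<^sub>E S"
  have fin: "finite ?PS" using assms finite_S by (simp add: finite_PiE)
  have sp: "?PS \<subseteq> space (PiM J (\<lambda>_. borel))" by (auto simp: space_PiM)
  have "emeasure (marginal J) X = emeasure (point_measure ?PS (\<lambda>\<xi>. ennreal (cyl_weight (labels J \<xi>)))) (X \<inter> ?PS)"
    unfolding marginal_def using assms(2) sp by (subst emeasure_distr) (auto simp: space_point_measure)
  also have "\<dots> = (\<Sum>\<xi>\<in>X \<inter> ?PS. ennreal (cyl_weight (labels J \<xi>)))"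
    by (rule emeasure_point_measure_finite) (use fin in auto)
  also have "\<dots> = ennreal (\<Sum>\<xi>\<in>X \<inter> ?PS. cyl_weight (labels J \<xi>))"
    by (rule sum_ennreal) (use cyl_weight_labels_pos[OF assms(1)] in \<open>auto intro: less_imp_le\<close>)
  also have "(\<Sum>\<xi>\<in>X \<inter> ?PS. cyl_weight (labels J \<xi>)) = (\<Sum>\<xi>\<in>?PS. of_bool (\<xi> \<in> X) * cyl_weight (labels J \<xi>))"
    by (rule sum.mono_neutral_cong_left) (use fin in auto)
  finally show ?thesis .
qed

text \<open>Integrating out H - J sums over the labels there, and \<open>cyl_weight_sum\<close>
  replaces them by \<open>None\<close>, which leaves the weight for J.\<close>

lemma marginal_projective:
  assumes "J \<subseteq> H" "finite H"
  shows "marginal J = distr (marginal H) (PiM J (\<lambda>_. borel)) (\<lambda>f. restrict f J)"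
proof (rule measure_eqI)
  show "sets (marginal J) = sets (distr (marginal H) (PiM J (\<lambda>_. borel)) (\<lambda>f. restrict f J))"
    by (simp add: marginal_def)
  fix X assume "X \<in> sets (marginal J)"
  then have X: "X \<in> sets (PiM J (\<lambda>_. borel :: real measure))" by (simp add: marginal_def)
  have J: "finite J" using finite_subset[OF assms] .
  have m: "(\<lambda>f. restrict f J) \<in> measurable (marginal H) (PiM J (\<lambda>_. borel))"
    unfolding marginal_def measurable_distr_eq1 by (rule measurable_restrict_subset[OF assms(1)])
  let ?Y = "(\<lambda>f. restrict f J) -` X \<inter> space (marginal H)"
  have Y: "?Y \<in> sets (PiM H (\<lambda>_. borel))" using measurable_sets[OF m X] by (simp add: marginal_def)
  have spH: "\<xi> \<in> space (marginal H)" if "\<xi> \<in> H \<rightarrow>\<^sub>E S" for \<xi> using that by (auto simp: marginal_def space_PiM)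
  have H: "H = J \<union> (H - J)" using assms by auto
  have "(\<Sum>\<xi>\<in>H \<rightarrow>\<^sub>E S. of_bool (\<xi> \<in> ?Y) * cyl_weight (labels H \<xi>)) =
      (\<Sum>\<xi>\<in>(J \<union> (H - J)) \<rightarrow>\<^sub>E S. of_bool (restrict \<xi> J \<in> X) * cyl_weight (overwrite (H - J) (restrict \<xi> (H - J)) (labels J (restrict \<xi> J))))"
    unfolding H[symmetric]
  proof (intro sum.cong refl)
    fix \<xi> assume "\<xi> \<in> H \<rightarrow>\<^sub>E S"
    moreover have "labels H \<xi> = overwrite (H - J) (restrict \<xi> (H - J)) (labels J (restrict \<xi> J))"
      using assms by (auto simp: labels_def overwrite_def fun_eq_iff)
    ultimately show "of_bool (\<xi> \<in> ?Y) * cyl_weight (labels H \<xi>) =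
        of_bool (restrict \<xi> J \<in> X) * cyl_weight (overwrite (H - J) (restrict \<xi> (H - J)) (labels J (restrict \<xi> J)))"
      using spH by simp
  qed
  also have "\<dots> = (\<Sum>\<zeta>\<in>J \<rightarrow>\<^sub>E S. \<Sum>\<zeta>'\<in>(H - J) \<rightarrow>\<^sub>E S. of_bool (\<zeta> \<in> X) * cyl_weight (overwrite (H - J) \<zeta>' (labels J \<zeta>)))"
    by (rule sum_PiE_split[where f = "\<lambda>\<zeta> \<zeta>'. of_bool (\<zeta> \<in> X) * cyl_weight (overwrite (H - J) \<zeta>' (labels J \<zeta>))"]) auto
  also have "\<dots> = (\<Sum>\<zeta>\<in>J \<rightarrow>\<^sub>E S. of_bool (\<zeta> \<in> X) * cyl_weight (labels J \<zeta>))"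
  proof (intro sum.cong refl)
    fix \<zeta> :: "(int^'d) \<Rightarrow> real"
    have "(\<Sum>\<zeta>'\<in>(H - J) \<rightarrow>\<^sub>E S. cyl_weight (overwrite (H - J) \<zeta>' (labels J \<zeta>))) = cyl_weight (erase (H - J) (labels J \<zeta>))"
      by (rule cyl_weight_sum[OF _ J]) (use assms in \<open>auto simp: labels_def\<close>)
    also have "erase (H - J) (labels J \<zeta>) = labels J \<zeta>" by (auto simp: erase_def labels_def fun_eq_iff)
    finally show "(\<Sum>\<zeta>'\<in>(H - J) \<rightarrow>\<^sub>E S. of_bool (\<zeta> \<in> X) * cyl_weight (overwrite (H - J) \<zeta>' (labels J \<zeta>))) = of_bool (\<zeta> \<in> X) * cyl_weight (labels J \<zeta>)"
      by (simp add: sum_distrib_left[symmetric])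
  qed
  finally show "emeasure (marginal J) X = emeasure (distr (marginal H) (PiM J (\<lambda>_. borel)) (\<lambda>f. restrict f J)) X"
    using m X by (simp add: emeasure_distr emeasure_marginal[OF assms(2) Y] emeasure_marginal[OF J X])
qed

lemma prob_space_marginal:
  assumes "finite J"
  shows "prob_space (marginal J)"
proof
  have "(\<Sum>\<xi>\<in>J \<rightarrow>\<^sub>E S. cyl_weight (overwrite J \<xi> (\<lambda>_. None))) = cyl_weight (erase J (\<lambda>_. None))"
    by (rule cyl_weight_sum[OF assms, of "{}"]) auto
  moreover have "overwrite J \<xi> (\<lambda>_. None) = labels J \<xi>" for \<xi> :: "(int^'d) \<Rightarrow> real" by (simp add: overwrite_def labels_def)
  moreover have "erase J (\<lambda>_. None) = (\<lambda>_. None :: real option)" by (auto simp: erase_def)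
  ultimately have 1: "(\<Sum>\<xi>\<in>J \<rightarrow>\<^sub>E S. cyl_weight (labels J \<xi>)) = 1" by (simp add: cyl_weight_None)
  have "emeasure (marginal J) (space (marginal J)) = ennreal (\<Sum>\<xi>\<in>J \<rightarrow>\<^sub>E S. of_bool (\<xi> \<in> space (marginal J)) * cyl_weight (labels J \<xi>))"
    by (rule emeasure_marginal[OF assms]) (simp add: marginal_def)
  also have "(\<Sum>\<xi>\<in>J \<rightarrow>\<^sub>E S. of_bool (\<xi> \<in> space (marginal J)) * cyl_weight (labels J \<xi>)) = (\<Sum>\<xi>\<in>J \<rightarrow>\<^sub>E S. cyl_weight (labels J \<xi>))"
    by (intro sum.cong refl) (auto simp: marginal_def space_PiM)
  finally show "emeasure (marginal J) (space (marginal J)) = 1" using 1 by simp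
qed

text \<open>The extension lives on all real configurations; it is mapped into configurations over S
  afterwards, without changing the probability of any cylinder.\<close>

theorem kolmogorov_extension:
  obtains \<mu> where "prob_space \<mu>" "sets \<mu> = sets (Omega_alg S)"
    "\<And>\<Lambda> \<xi>. finite \<Lambda> \<Longrightarrow> \<xi> \<in> \<Lambda> \<rightarrow>\<^sub>E S \<Longrightarrow> measure \<mu> (cyl S \<Lambda> \<xi>) = cyl_weight (labels \<Lambda> \<xi>)"
proof -
  interpret K: polish_projective UNIV marginal
  proof (intro polish_projective.intro projective_family.intro)
    show "marginal J = distr (marginal H) (PiM J (\<lambda>_. borel)) (\<lambda>f. restrict f J)"
      if "J \<subseteq> H" "finite H" "H \<subseteq> UNIV" for J H by (rule marginal_projective[OF that(1,2)])
    show "prob_space (marginal J)" if "finite J" "J \<subseteq> UNIV" for J by (rule prob_space_marginal[OF that(1)])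
  qed
  obtain s0 where s0: "s0 \<in> S" using S_nonempty by blast
  \<comment> \<open>Values outside S are sent to an arbitrary element of S, so that f maps
    everywhere into the space of \<open>Omega_alg S\<close>.\<close>
  define f where "f \<omega> = (\<lambda>i. if \<omega> i \<in> S then \<omega> i else s0)" for \<omega> :: "(int^'d) \<Rightarrow> real"
  have sl: "sets K.lim = sets (PiM UNIV (\<lambda>_. borel))" by (rule K.sets_lim)
  have comp: "(\<lambda>\<omega>. f \<omega> i) \<in> measurable K.lim (count_space S)" for i
  proof -
    have "(\<lambda>x :: real. if x \<in> S then x else s0) \<in> measurable borel (count_space S)"
    proof (subst measurable_count_space_eq2[OF finite_S], intro conjI ballI)
      fix v
      have "(\<lambda>x. if x \<in> S then x else s0) -` {v} \<inter> space borel = (S \<inter> {v}) \<union> (if v = s0 then - S else {})"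
        using s0 by (auto split: if_splits)
      moreover have "S \<in> sets borel" using finite_S by (simp add: borel_closed finite_imp_closed)
      ultimately show "(\<lambda>x. if x \<in> S then x else s0) -` {v} \<inter> space borel \<in> sets borel" by auto
    qed (use s0 in auto)
    moreover have "(\<lambda>\<omega>. \<omega> i) \<in> measurable K.lim borel"
      unfolding measurable_cong_sets[OF sl refl] by (rule measurable_component_singleton) simp
    ultimately show ?thesis unfolding f_def by (rule measurable_compose[rotated])
  qed
  have mf: "f \<in> measurable K.lim (Omega_alg S)"
    unfolding Omega_alg_def
    by (rule measurable_PiM_single') (use comp s0 in \<open>auto simp: f_def PiE_def\<close>)
  let ?\<mu> = "distr K.lim (Omega_alg S) f"
  show thesis
  proof (rule that[of ?\<mu>])
    show "prob_space ?\<mu>" using K.P.prob_space_distr[OF mf] .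
    fix \<Lambda> :: "(int^'d) set" and \<xi> assume L: "finite \<Lambda>" and \<xi>: "\<xi> \<in> \<Lambda> \<rightarrow>\<^sub>E S"
    \<comment> \<open>The pullback of the cylinder under f. If \<xi> takes the value
      \<open>s0\<close>, it also contains points with coordinates outside S, but the marginal gives
      them no mass.\<close>
    define X where "X = {g \<in> space (PiM \<Lambda> (\<lambda>_. borel :: real measure)). \<forall>i\<in>\<Lambda>. (if g i \<in> S then g i else s0) = \<xi> i}"
    have X: "X \<in> sets (PiM \<Lambda> (\<lambda>_. borel))"
    proof -
      have SB: "S \<in> sets borel" using finite_S by (simp add: borel_closed finite_imp_closed)
      show ?thesis unfolding X_def
      proof (rule sets.sets_Collect_finite_All[OF _ L])
        fix i assume i: "i \<in> \<Lambda>"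
        have "(\<lambda>x :: real. if x \<in> S then x else s0) \<in> borel_measurable borel"
          using SB by (intro measurable_If_set) auto
        from measurable_compose[OF measurable_component_singleton[OF i] this]
        have "(\<lambda>g. if g i \<in> S then g i else s0) \<in> borel_measurable (PiM \<Lambda> (\<lambda>_. borel))" .
        then have "(\<lambda>g. if g i \<in> S then g i else s0) -` {\<xi> i} \<inter> space (PiM \<Lambda> (\<lambda>_. borel)) \<in> sets (PiM \<Lambda> (\<lambda>_. borel))"
          by (rule measurable_sets) simp
        moreover have "(\<lambda>g. if g i \<in> S then g i else s0) -` {\<xi> i} \<inter> space (PiM \<Lambda> (\<lambda>_. borel))
            = {g \<in> space (PiM \<Lambda> (\<lambda>_. borel)). (if g i \<in> S then g i else s0) = \<xi> i}" by auto
        ultimately show "{g \<in> space (PiM \<Lambda> (\<lambda>_. borel)). (if g i \<in> S then g i else s0) = \<xi> i} \<in> sets (PiM \<Lambda> (\<lambda>_. borel))"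
          by simp
      qed
    qed
    have cylm: "cyl S \<Lambda> \<xi> \<in> sets (Omega_alg S)" by (rule cyl_in_Omega_alg[OF L \<xi>])
    have "measure ?\<mu> (cyl S \<Lambda> \<xi>) = measure K.lim (f -` cyl S \<Lambda> \<xi> \<inter> space K.lim)"
      by (rule measure_distr[OF mf cylm])
    also have "f -` cyl S \<Lambda> \<xi> \<inter> space K.lim = prod_emb UNIV (\<lambda>_. borel) \<Lambda> X"
      using s0 unfolding X_def cyl_def Omega_alg_def prod_emb_def f_def
      by (auto simp: space_PiM sets_eq_imp_space_eq[OF sl] PiE_def)
    also have "measure K.lim \<dots> = measure (marginal \<Lambda>) X" by (rule K.measure_lim_emb) (use L X in auto)
    also have "\<dots> = (\<Sum>\<eta>\<in>\<Lambda> \<rightarrow>\<^sub>E S. of_bool (\<eta> \<in> X) * cyl_weight (labels \<Lambda> \<eta>))"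
      unfolding measure_def emeasure_marginal[OF L X]
      by (rule enn2real_ennreal, rule sum_nonneg) (use cyl_weight_labels_pos[OF L] in \<open>auto intro: less_imp_le\<close>)
    also have "\<dots> = (\<Sum>\<eta>\<in>\<Lambda> \<rightarrow>\<^sub>E S. if \<eta> = \<xi> then cyl_weight (labels \<Lambda> \<xi>) else 0)"
    proof (intro sum.cong refl)
      fix \<eta> assume \<eta>: "\<eta> \<in> \<Lambda> \<rightarrow>\<^sub>E S"
      have "\<eta> \<in> X \<longleftrightarrow> (\<forall>i\<in>\<Lambda>. \<eta> i = \<xi> i)" using \<eta> unfolding X_def by (auto simp: space_PiM PiE_def Pi_def)
      also have "\<dots> \<longleftrightarrow> \<eta> = \<xi>" using \<eta> \<xi> PiE_ext by blast
      finally show "of_bool (\<eta> \<in> X) * cyl_weight (labels \<Lambda> \<eta>) = (if \<eta> = \<xi> then cyl_weight (labels \<Lambda> \<xi>) else 0)" by simp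
    qed
    also have "\<dots> = cyl_weight (labels \<Lambda> \<xi>)" using \<xi> L finite_S by (simp add: sum.delta finite_PiE)
    finally show "measure ?\<mu> (cyl S \<Lambda> \<xi>) = cyl_weight (labels \<Lambda> \<xi>)" .
  qed simp
qed

end

section \<open>The DLR equations\<close>

lemma space_Omega_alg: "space (Omega_alg S) = {\<omega>. \<forall>i. \<omega> i \<in> S}"
  by (auto simp: Omega_alg_def space_PiM PiE_def)

lemma space_outside_alg: "space (outside_alg S \<Lambda>) = space (Omega_alg S)"
  by (simp add: outside_alg_def)

lemma restrict_in_space: "(\<lambda>\<omega>. restrict \<omega> (- \<Lambda>)) \<in> space (Omega_alg S) \<rightarrow> space (PiM (- \<Lambda>) (\<lambda>_. count_space S))"
  by (auto simp: space_Omega_alg space_PiM)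

lemma coordinate_measurable_outside:
  assumes "i \<notin> \<Lambda>"
  shows "(\<lambda>\<omega>. \<omega> i) \<in> measurable (outside_alg S \<Lambda>) (count_space S)"
proof -
  have "(\<lambda>\<omega>. restrict \<omega> (- \<Lambda>)) \<in> measurable (outside_alg S \<Lambda>) (PiM (- \<Lambda>) (\<lambda>_. count_space S))"
    unfolding outside_alg_def by (rule measurable_vimage_algebra1[OF restrict_in_space])
  from measurable_compose[OF this measurable_component_singleton[of i]]
  have "(\<lambda>\<omega>. restrict \<omega> (- \<Lambda>) i) \<in> measurable (outside_alg S \<Lambda>) (count_space S)" using assms by simp
  then show ?thesis using assms by simp
qed

lemma sets_outside_alg: "sets (outside_alg S \<Lambda>) = {(\<lambda>\<omega>. restrict \<omega> (- \<Lambda>)) -` A \<inter> space (Omega_alg S) | A.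
    A \<in> sets (PiM (- \<Lambda>) (\<lambda>_. count_space S))}"
  unfolding outside_alg_def by (rule sets_vimage_algebra2[OF restrict_in_space])

lemma subalgebra_outside: "subalgebra (Omega_alg S) (outside_alg S \<Lambda>)"
  unfolding subalgebra_def
proof
  show "sets (outside_alg S \<Lambda>) \<subseteq> sets (Omega_alg S)"
  proof
    fix B assume "B \<in> sets (outside_alg S \<Lambda>)"
    then obtain A where A: "A \<in> sets (PiM (- \<Lambda>) (\<lambda>_. count_space S))"
      "B = (\<lambda>\<omega>. restrict \<omega> (- \<Lambda>)) -` A \<inter> space (Omega_alg S)" by (auto simp: sets_outside_alg)
    have "(\<lambda>\<omega>. restrict \<omega> (- \<Lambda>)) \<in> measurable (Omega_alg S) (PiM (- \<Lambda>) (\<lambda>_. count_space S))"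
      unfolding Omega_alg_def by (rule measurable_restrict_subset) simp
    then show "B \<in> sets (Omega_alg S)" unfolding A(2) by (rule measurable_sets[OF _ A(1)])
  qed
qed (rule space_outside_alg)

text \<open>The generating \<pi>-system of the outside algebra; {} is added because incompatible
  cylinders have empty intersection.\<close>

definition outside_cyls :: "real set \<Rightarrow> (int^'d) set \<Rightarrow> ((int^'d) \<Rightarrow> real) set set" where
  "outside_cyls S \<Lambda> = insert {} {cyl S V \<eta> | V \<eta>. finite V \<and> V \<inter> \<Lambda> = {} \<and> \<eta> \<in> V \<rightarrow>\<^sub>E S}"

lemma cyl_in_outside_cyls:
  "finite V \<Longrightarrow> V \<inter> \<Lambda> = {} \<Longrightarrow> \<eta> \<in> V \<rightarrow>\<^sub>E S \<Longrightarrow> cyl S V \<eta> \<in> outside_cyls S \<Lambda>"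
  unfolding outside_cyls_def by blast

lemma outside_cyls_Pow: "outside_cyls S \<Lambda> \<subseteq> Pow (space (Omega_alg S))"
  by (auto simp: outside_cyls_def cyl_def)

lemma cyl_Int:
  assumes "V \<inter> W = {}"
  shows "cyl S V \<eta> \<inter> cyl S W \<zeta> = cyl S (V \<union> W) (merge V W (\<eta>, \<zeta>))"
  using assms by (auto simp: cyl_def merge_def)

lemma merge_in_PiE:
  "\<eta> \<in> V \<rightarrow>\<^sub>E S \<Longrightarrow> \<zeta> \<in> W \<rightarrow>\<^sub>E S \<Longrightarrow> merge V W (\<eta>, \<zeta>) \<in> (V \<union> W) \<rightarrow>\<^sub>E S"
  by (auto simp: PiE_def Pi_def extensional_def merge_def)

lemma Int_stable_outside_cyls: "Int_stable (outside_cyls S \<Lambda>)"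
  unfolding Int_stable_def
proof (intro ballI)
  fix A B assume AB: "A \<in> outside_cyls S \<Lambda>" "B \<in> outside_cyls S \<Lambda>"
  show "A \<inter> B \<in> outside_cyls S \<Lambda>"
  proof (cases "A \<inter> B = {}")
    case True
    then show ?thesis by (simp add: outside_cyls_def)
  next
    case False
    then obtain V \<eta> W \<zeta> where A: "A = cyl S V \<eta>" "finite V" "V \<inter> \<Lambda> = {}" "\<eta> \<in> V \<rightarrow>\<^sub>E S"
      and B: "B = cyl S W \<zeta>" "finite W" "W \<inter> \<Lambda> = {}" "\<zeta> \<in> W \<rightarrow>\<^sub>E S"
      using AB by (auto simp: outside_cyls_def)
    obtain \<omega> where "\<omega> \<in> A" "\<omega> \<in> B" using False by blast
    then have eq: "\<eta> i = \<zeta> i" if "i \<in> V" "i \<in> W" for i using that by (auto simp: A B cyl_def)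
    have "A \<inter> B = cyl S (V \<union> W) (merge V W (\<eta>, \<zeta>))"
      using eq by (auto simp: A B cyl_def merge_def)
    moreover have "finite (V \<union> W)" "(V \<union> W) \<inter> \<Lambda> = {}" using A B by auto
    ultimately show ?thesis using merge_in_PiE[OF A(4) B(4)] by (simp add: cyl_in_outside_cyls)
  qed
qed

lemma sets_outside_alg_subset:
  assumes "finite S"
  shows "sets (outside_alg S \<Lambda>) \<subseteq> sigma_sets (space (Omega_alg S)) (outside_cyls S \<Lambda>)"
proof
  let ?\<Omega> = "space (Omega_alg S)"
  let ?M = "sigma ?\<Omega> (outside_cyls S \<Lambda>)"
  have sM: "sets ?M = sigma_sets ?\<Omega> (outside_cyls S \<Lambda>)" "space ?M = ?\<Omega>"
    by (rule sets_measure_of[OF outside_cyls_Pow], rule space_measure_of[OF outside_cyls_Pow])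
  have "(\<lambda>\<omega>. \<omega> i) \<in> measurable ?M (count_space S)" if "i \<in> - \<Lambda>" for i
  proof (subst measurable_count_space_eq2[OF assms], intro conjI ballI)
    show "(\<lambda>\<omega>. \<omega> i) \<in> space ?M \<rightarrow> S" unfolding sM by (auto simp: space_Omega_alg)
    fix v assume v: "v \<in> S"
    have "(\<lambda>\<omega>. \<omega> i) -` {v} \<inter> space ?M = cyl S {i} (\<lambda>_\<in>{i}. v)" by (auto simp: cyl_def sM)
    moreover have "cyl S {i} (\<lambda>_\<in>{i}. v) \<in> outside_cyls S \<Lambda>"
      by (rule cyl_in_outside_cyls) (use that v in auto)
    ultimately show "(\<lambda>\<omega>. \<omega> i) -` {v} \<inter> space ?M \<in> sets ?M" by (simp add: sM)
  qed
  then have m: "(\<lambda>\<omega>. restrict \<omega> (- \<Lambda>)) \<in> measurable ?M (PiM (- \<Lambda>) (\<lambda>_. count_space S))"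
    by (rule measurable_restrict)
  fix B assume "B \<in> sets (outside_alg S \<Lambda>)"
  then obtain A where A: "A \<in> sets (PiM (- \<Lambda>) (\<lambda>_. count_space S))"
    "B = (\<lambda>\<omega>. restrict \<omega> (- \<Lambda>)) -` A \<inter> ?\<Omega>" by (auto simp: sets_outside_alg)
  show "B \<in> sigma_sets ?\<Omega> (outside_cyls S \<Lambda>)"
    using measurable_sets[OF m A(1)] unfolding A(2) sM .
qed

section \<open>Conditional weights and the specification\<close>

context extended_potential
begin

text \<open>The sign turns \<open>\<psi>\<close>, an exponent of weights, into an energy; only
  labels \<open>Some\<close> occur, so this is an ordinary classical potential.\<close>

definition Psi :: "(int^'d) set \<Rightarrow> ((int^'d) \<Rightarrow> real) \<Rightarrow> real" where
  "Psi A x = - \<psi> A (\<lambda>i. Some (x i))"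

definition local_energy :: "(int^'d) set \<Rightarrow> ((int^'d) \<Rightarrow> real option) \<Rightarrow> real" where
  "local_energy \<Lambda> y = (\<Sum>\<^sub>\<infinity>A\<in>meets \<Lambda>. \<psi> A y)"

text \<open>The Gibbs specification extended to boundary conditions containing \<open>None\<close>.
  With finitely many \<open>Some\<close> it is an exact conditional probability given partial
  information; with \<open>Some\<close> everywhere it is \<open>gibbs_spec\<close>.\<close>

definition cond_weight :: "(int^'d) set \<Rightarrow> ((int^'d) \<Rightarrow> real) \<Rightarrow> ((int^'d) \<Rightarrow> real option) \<Rightarrow> real" where
  "cond_weight \<Lambda> \<xi> y = exp (local_energy \<Lambda> (overwrite \<Lambda> \<xi> y)) / (\<Sum>\<xi>'\<in>\<Lambda> \<rightarrow>\<^sub>E S. exp (local_energy \<Lambda> (overwrite \<Lambda> \<xi>' y)))"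

lemma gibbs_spec_Psi: "gibbs_spec S Psi \<Lambda> \<xi> \<omega> = cond_weight \<Lambda> \<xi> (\<lambda>i. Some (\<omega> i))"
proof -
  have e: "energy Psi \<Lambda> x = - local_energy \<Lambda> (\<lambda>i. Some (x i))" for x
  proof -
    have "energy Psi \<Lambda> x = (\<Sum>\<^sub>\<infinity>A\<in>meets \<Lambda>. - \<psi> A (\<lambda>i. Some (x i)))"
      unfolding energy_def meets_def Psi_def by (intro infsum_cong arg_cong[where f = uminus] psi_local) simp
    then show ?thesis by (simp add: infsum_uminus local_energy_def)
  qed
  have "(\<lambda>i. Some (merge_cfg \<Lambda> \<xi> \<omega> i)) = overwrite \<Lambda> \<xi> (\<lambda>i. Some (\<omega> i))" for \<xi>
    by (auto simp: merge_cfg_def overwrite_def)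
  then show ?thesis by (simp add: gibbs_spec_def cond_weight_def e)
qed

lemma classical_potential_Psi: "classical_potential S Psi"
  unfolding classical_potential_def Psi_def
proof (intro conjI ballI allI impI)
  fix A :: "(int^'d) set" and i x assume "finite A"
  then have "\<psi> (transl i A) (\<lambda>i. Some (x i)) = \<psi> A (\<lambda>j. Some (x (j + i)))" by (simp add: psi_transl)
  also have "\<dots> = \<psi> A (\<lambda>j. Some ((\<lambda>j\<in>A. x (j + i)) j))" by (rule psi_local) simp
  finally show "- \<psi> (transl i A) (\<lambda>i. Some (x i)) = - \<psi> A (\<lambda>j. Some ((\<lambda>j\<in>A. x (j + i)) j))" by simp
qed (simp add: psi_empty)

lemma potential_norm0_Psi: "potential_norm0_finite S Psi"
  unfolding potential_norm0_finite_def
proof (rule summable_on_comparison_test[OF s_summable[of 0]])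
  fix A :: "(int^'d) set" assume "A \<in> {A. finite A \<and> 0 \<in> A}"
  then have A: "finite A" by simp
  have le: "\<bar>Psi A x\<bar> \<le> s A" for x unfolding Psi_def using psi_le[OF A] by simp
  obtain x where x: "x \<in> A \<rightarrow>\<^sub>E S" using S_nonempty by (meson PiE_eq_empty_iff equals0I)
  show "(SUP x\<in>A \<rightarrow>\<^sub>E S. \<bar>Psi A x\<bar>) \<le> s A" by (rule cSUP_least) (use x le in auto)
  have "bdd_above ((\<lambda>x. \<bar>Psi A x\<bar>) ` (A \<rightarrow>\<^sub>E S))" by (rule bdd_aboveI2[where M = "s A"]) (rule le)
  then show "0 \<le> (SUP x\<in>A \<rightarrow>\<^sub>E S. \<bar>Psi A x\<bar>)" by (rule cSUP_upper2[OF _ x]) simp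
qed

lemma finite_PiE_S: "finite \<Lambda> \<Longrightarrow> finite (\<Lambda> \<rightarrow>\<^sub>E S)"
  using finite_S by (simp add: finite_PiE)

lemma cond_weight_denominator_pos:
  assumes "finite \<Lambda>"
  shows "0 < (\<Sum>\<xi>'\<in>\<Lambda> \<rightarrow>\<^sub>E S. exp (local_energy \<Lambda> (overwrite \<Lambda> \<xi>' y)))"
proof (rule sum_pos)
  show "(\<Lambda> \<rightarrow>\<^sub>E S) \<noteq> {}" using S_nonempty by (simp add: PiE_eq_empty_iff)
qed (use finite_PiE_S[OF assms] in auto)

lemma cond_weight_bounds:
  assumes "finite \<Lambda>" "\<xi> \<in> \<Lambda> \<rightarrow>\<^sub>E S"
  shows "0 \<le> cond_weight \<Lambda> \<xi> y" "cond_weight \<Lambda> \<xi> y \<le> 1"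
proof -
  note d = cond_weight_denominator_pos[OF assms(1), of y]
  show "0 \<le> cond_weight \<Lambda> \<xi> y" unfolding cond_weight_def using d by (intro divide_nonneg_pos) auto
  have "exp (local_energy \<Lambda> (overwrite \<Lambda> \<xi> y)) \<le> (\<Sum>\<xi>'\<in>\<Lambda> \<rightarrow>\<^sub>E S. exp (local_energy \<Lambda> (overwrite \<Lambda> \<xi>' y)))"
    by (rule member_le_sum[OF assms(2)]) (use finite_PiE_S[OF assms(1)] in auto)
  then show "cond_weight \<Lambda> \<xi> y \<le> 1" unfolding cond_weight_def using d by simp
qed

lemma cond_weight_cong:
  assumes "\<And>i. i \<notin> \<Lambda> \<Longrightarrow> y i = y' i"
  shows "cond_weight \<Lambda> \<xi> y = cond_weight \<Lambda> \<xi> y'"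
proof -
  have "overwrite \<Lambda> \<xi> y = overwrite \<Lambda> \<xi> y'" for \<xi> using assms by (auto simp: overwrite_def)
  then show ?thesis by (simp add: cond_weight_def)
qed

text \<open>By \<open>cyl_weight_ratio\<close> all fillings of \<Lambda> have weights proportional
  to their exponentiated local energies, and by \<open>cyl_weight_sum\<close> they add up to the
  weight of y.\<close>

lemma cyl_weight_cond_weight:
  assumes "finite \<Lambda>" "finite V" "\<And>i. i \<notin> V \<Longrightarrow> y i = None" "\<And>i. i \<in> \<Lambda> \<Longrightarrow> y i = None" "\<xi> \<in> \<Lambda> \<rightarrow>\<^sub>E S"
  shows "cyl_weight (overwrite \<Lambda> \<xi> y) = cond_weight \<Lambda> \<xi> y * cyl_weight y"
proof -
  have r: "cyl_weight (overwrite \<Lambda> \<xi>' y) = cyl_weight (overwrite \<Lambda> \<xi> y) * (exp (local_energy \<Lambda> (overwrite \<Lambda> \<xi>' y)) / exp (local_energy \<Lambda> (overwrite \<Lambda> \<xi> y)))" for \<xi>'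
    unfolding local_energy_def exp_diff[symmetric]
    by (rule cyl_weight_ratio[of "\<Lambda> \<union> V"]) (use assms(1-3) in \<open>auto simp: overwrite_def\<close>)
  have "erase \<Lambda> y = y" using assms(4) by (auto simp: erase_def)
  then have "cyl_weight y = (\<Sum>\<xi>'\<in>\<Lambda> \<rightarrow>\<^sub>E S. cyl_weight (overwrite \<Lambda> \<xi>' y))" using cyl_weight_sum[OF assms(1-3)] by simp
  also have "\<dots> = cyl_weight (overwrite \<Lambda> \<xi> y) * ((\<Sum>\<xi>'\<in>\<Lambda> \<rightarrow>\<^sub>E S. exp (local_energy \<Lambda> (overwrite \<Lambda> \<xi>' y))) / exp (local_energy \<Lambda> (overwrite \<Lambda> \<xi> y)))"
    by (subst r) (simp add: sum_distrib_left sum_divide_distrib)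
  finally show ?thesis
    using cond_weight_denominator_pos[OF assms(1), of y] by (simp add: cond_weight_def field_simps)
qed

text \<open>Each \<open>\<psi> A\<close> is constant once the box covers A, and \<open>s\<close>
  dominates the rest: revealing more and more outside spins converges at every
  configuration.\<close>

lemma cond_weight_tendsto:
  assumes "finite \<Lambda>"
  shows "(\<lambda>k. cond_weight \<Lambda> \<xi> (labels (box k) \<omega>)) \<longlonglongrightarrow> cond_weight \<Lambda> \<xi> (\<lambda>i. Some (\<omega> i))"
proof -
  have "(\<lambda>k. local_energy \<Lambda> (overwrite \<Lambda> \<xi> (labels (box k) \<omega>))) \<longlonglongrightarrow> local_energy \<Lambda> (overwrite \<Lambda> \<xi> (\<lambda>i. Some (\<omega> i)))" for \<xi>
    unfolding local_energy_def
  proof (rule infsum_dominated_convergence[OF s_summable_meets[OF assms]])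
    fix A assume "A \<in> meets \<Lambda>"
    then have A: "finite A" by (simp add: meets_def)
    show "\<bar>\<psi> A (overwrite \<Lambda> \<xi> (labels (box k) \<omega>))\<bar> \<le> s A" for k using psi_le[OF A] .
    show "(\<lambda>k. \<psi> A (overwrite \<Lambda> \<xi> (labels (box k) \<omega>))) \<longlonglongrightarrow> \<psi> A (overwrite \<Lambda> \<xi> (\<lambda>i. Some (\<omega> i)))"
    proof (rule tendsto_eventually, rule eventually_mono[OF eventually_subset_box[OF A]])
      fix k assume k: "A \<subseteq> box k"
      show "\<psi> A (overwrite \<Lambda> \<xi> (labels (box k) \<omega>)) = \<psi> A (overwrite \<Lambda> \<xi> (\<lambda>i. Some (\<omega> i)))"
        by (rule psi_local) (use k in \<open>auto simp: overwrite_def labels_def\<close>)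
    qed
  qed
  then show ?thesis
    unfolding cond_weight_def using cond_weight_denominator_pos[OF assms, of "\<lambda>i. Some (\<omega> i)"]
    by (intro tendsto_divide tendsto_sum tendsto_exp) auto
qed

text \<open>The conditional weight given the spins in V and D depends on finitely many coordinates,
  so on a cylinder over V it is a finite combination of indicators of cylinders.\<close>

lemma cond_weight_cyl_expand:
  assumes "finite V" "finite D" "V \<inter> D = {}" "\<eta> \<in> V \<rightarrow>\<^sub>E S" "\<omega> \<in> space (Omega_alg S)"
  shows "indicator (cyl S V \<eta>) \<omega> * cond_weight \<Lambda> \<xi> (labels (V \<union> D) \<omega>) =
    (\<Sum>\<zeta>\<in>D \<rightarrow>\<^sub>E S. cond_weight \<Lambda> \<xi> (overwrite D \<zeta> (labels V \<eta>)) * indicator (cyl S (V \<union> D) (merge V D (\<eta>, \<zeta>))) \<omega>)"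
proof (cases "\<omega> \<in> cyl S V \<eta>")
  case False
  then have "\<omega> \<notin> cyl S (V \<union> D) (merge V D (\<eta>, \<zeta>))" for \<zeta>
    using cyl_Int[OF assms(3), of S \<eta> \<zeta>] by blast
  then show ?thesis using False by simp
next
  case True
  have \<omega>S: "\<omega> i \<in> S" for i using assms(5) by (simp add: space_Omega_alg)
  have "(\<Sum>\<zeta>\<in>D \<rightarrow>\<^sub>E S. cond_weight \<Lambda> \<xi> (overwrite D \<zeta> (labels V \<eta>)) * indicator (cyl S (V \<union> D) (merge V D (\<eta>, \<zeta>))) \<omega>)
      = (\<Sum>\<zeta>\<in>D \<rightarrow>\<^sub>E S. if \<zeta> = restrict \<omega> D then cond_weight \<Lambda> \<xi> (labels (V \<union> D) \<omega>) else 0)"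
  proof (intro sum.cong refl)
    fix \<zeta> assume \<zeta>: "\<zeta> \<in> D \<rightarrow>\<^sub>E S"
    have "\<omega> \<in> cyl S (V \<union> D) (merge V D (\<eta>, \<zeta>)) \<longleftrightarrow> \<omega> \<in> cyl S D \<zeta>"
      using True cyl_Int[OF assms(3), of S \<eta> \<zeta>] by blast
    also have "\<dots> \<longleftrightarrow> \<zeta> = restrict \<omega> D"
      using \<zeta> assms(5) by (auto simp: cyl_def PiE_def extensional_def fun_eq_iff)
    finally have 1: "\<omega> \<in> cyl S (V \<union> D) (merge V D (\<eta>, \<zeta>)) \<longleftrightarrow> \<zeta> = restrict \<omega> D" .
    have "overwrite D (restrict \<omega> D) (labels V \<eta>) = labels (V \<union> D) \<omega>"
      using True by (auto simp: overwrite_def labels_def cyl_def fun_eq_iff)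
    then show "cond_weight \<Lambda> \<xi> (overwrite D \<zeta> (labels V \<eta>)) * indicator (cyl S (V \<union> D) (merge V D (\<eta>, \<zeta>))) \<omega>
        = (if \<zeta> = restrict \<omega> D then cond_weight \<Lambda> \<xi> (labels (V \<union> D) \<omega>) else 0)"
      using 1 by (simp add: indicator_def)
  qed
  also have "\<dots> = cond_weight \<Lambda> \<xi> (labels (V \<union> D) \<omega>)"
    using finite_PiE_S[OF assms(2)] \<omega>S by (subst sum.delta) auto
  finally show ?thesis using True by simp
qed

lemma cond_weight_box_measurable:
  assumes "finite \<Lambda>"
  shows "(\<lambda>\<omega>. cond_weight \<Lambda> \<xi> (labels (box k) \<omega>)) \<in> borel_measurable (outside_alg S \<Lambda>)"
proof -
  \<comment> \<open>Labels inside \<Lambda> are overwritten anyway, so only coordinates outside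
    \<Lambda> are used. The expansion is taken with the empty base, whose labelling is
    \<open>None\<close> everywhere.\<close>
  let ?D = "box k - \<Lambda>"
  have D: "finite ?D" using finite_box by auto
  have "(\<lambda>\<omega>. \<Sum>\<zeta>\<in>?D \<rightarrow>\<^sub>E S. cond_weight \<Lambda> \<xi> (overwrite ?D \<zeta> (labels {} undefined)) *
      indicator (cyl S ({} \<union> ?D) (merge {} ?D (\<lambda>_. undefined, \<zeta>))) \<omega> :: real)
    \<in> borel_measurable (outside_alg S \<Lambda>)"
  proof (intro borel_measurable_sum borel_measurable_times borel_measurable_const borel_measurable_indicator)
    fix \<zeta> assume "\<zeta> \<in> ?D \<rightarrow>\<^sub>E S"
    then have "merge {} ?D (\<lambda>_. undefined, \<zeta>) \<in> ({} \<union> ?D) \<rightarrow>\<^sub>E S" by (intro merge_in_PiE) auto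
    then show "cyl S ({} \<union> ?D) (merge {} ?D (\<lambda>_. undefined, \<zeta>)) \<in> sets (outside_alg S \<Lambda>)"
      by (intro cyl_in_sets coordinate_measurable_outside space_outside_alg) (use D in auto)
  qed
  moreover have "cond_weight \<Lambda> \<xi> (labels (box k) \<omega>) = (\<Sum>\<zeta>\<in>?D \<rightarrow>\<^sub>E S. cond_weight \<Lambda> \<xi> (overwrite ?D \<zeta> (labels {} undefined)) *
      indicator (cyl S ({} \<union> ?D) (merge {} ?D (\<lambda>_. undefined, \<zeta>))) \<omega>)" if "\<omega> \<in> space (outside_alg S \<Lambda>)" for \<omega>
  proof -
    have sp: "\<omega> \<in> space (Omega_alg S)" using that by (simp add: space_outside_alg)
    have l: "labels {} \<eta> = (labels {} undefined :: (int^'d) \<Rightarrow> real option)" for \<eta> by (simp add: labels_def)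
    have "cond_weight \<Lambda> \<xi> (labels (box k) \<omega>) = cond_weight \<Lambda> \<xi> (labels ({} \<union> ?D) \<omega>)" by (rule cond_weight_cong) (auto simp: labels_def)
    moreover have "indicator (cyl S {} (\<lambda>_. undefined)) \<omega> = (1 :: real)" using sp by (simp add: cyl_def)
    ultimately show ?thesis
      using cond_weight_cyl_expand[OF finite.emptyI D _ _ sp, of "\<lambda>_. undefined" \<Lambda> \<xi>] by (simp add: l[of "\<lambda>_. undefined"])
  qed
  ultimately show ?thesis by (subst measurable_cong) auto
qed

lemma cond_weight_Some_measurable:
  assumes "finite \<Lambda>"
  shows "(\<lambda>\<omega>. cond_weight \<Lambda> \<xi> (\<lambda>i. Some (\<omega> i))) \<in> borel_measurable (outside_alg S \<Lambda>)"
  by (rule borel_measurable_LIMSEQ_real[OF cond_weight_tendsto[OF assms] cond_weight_box_measurable[OF assms]])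

lemma labels_merge: "V \<inter> D = {} \<Longrightarrow> labels (V \<union> D) (merge V D (\<eta>, \<zeta>)) = overwrite D \<zeta> (labels V \<eta>)"
  by (auto simp: labels_def overwrite_def merge_def fun_eq_iff)

text \<open>The defining property of conditional probability, tested on outside cylinders. It holds
  exactly with the boundary condition cut off at any box containing V, and dominated convergence
  removes the cutoff.\<close>

lemma cond_weight_cyl_integral:
  assumes \<mu>: "prob_space \<mu>" "sets \<mu> = sets (Omega_alg S)"
    and cylm: "\<And>\<Lambda> \<xi>. finite \<Lambda> \<Longrightarrow> \<xi> \<in> \<Lambda> \<rightarrow>\<^sub>E S \<Longrightarrow> measure \<mu> (cyl S \<Lambda> \<xi>) = cyl_weight (labels \<Lambda> \<xi>)"
    and L: "finite \<Lambda>" "\<xi> \<in> \<Lambda> \<rightarrow>\<^sub>E S" and V: "finite V" "V \<inter> \<Lambda> = {}" "\<eta> \<in> V \<rightarrow>\<^sub>E S"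
  shows "(LINT \<omega>|\<mu>. indicator (cyl S V \<eta>) \<omega> * cond_weight \<Lambda> \<xi> (\<lambda>i. Some (\<omega> i))) = measure \<mu> (cyl S V \<eta> \<inter> cyl S \<Lambda> \<xi>)"
proof -
  interpret prob_space \<mu> by fact
  have sp: "space \<mu> = space (Omega_alg S)" using \<mu>(2) by (rule sets_eq_imp_space_eq)
  have sub: "subalgebra \<mu> (outside_alg S \<Lambda>)"
    using subalgebra_outside[of S \<Lambda>] \<mu>(2) sp by (simp add: subalgebra_def)
  let ?h = "\<lambda>k \<omega>. indicator (cyl S V \<eta>) \<omega> * cond_weight \<Lambda> \<xi> (labels (box k) \<omega>)"
  have cs: "cyl S V \<zeta> \<in> sets \<mu>" if "finite V" "\<zeta> \<in> V \<rightarrow>\<^sub>E S" for V \<zeta>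
    using cyl_in_Omega_alg[OF that] \<mu>(2) by simp
  have meas: "(\<lambda>\<omega>. cond_weight \<Lambda> \<xi> (labels (box k) \<omega>)) \<in> borel_measurable \<mu>" "(\<lambda>\<omega>. cond_weight \<Lambda> \<xi> (\<lambda>i. Some (\<omega> i))) \<in> borel_measurable \<mu>" for k
    by (rule measurable_from_subalg[OF sub] cond_weight_box_measurable[OF L(1)] cond_weight_Some_measurable[OF L(1)])+
  have ind: "indicator (cyl S V \<eta>) \<in> borel_measurable \<mu>"
    using cs[OF V(1,3)] by simp
  have lim: "(\<lambda>k. LINT \<omega>|\<mu>. ?h k \<omega>) \<longlonglongrightarrow> (LINT \<omega>|\<mu>. indicator (cyl S V \<eta>) \<omega> * cond_weight \<Lambda> \<xi> (\<lambda>i. Some (\<omega> i)))"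
  proof (rule integral_dominated_convergence[where w = "\<lambda>_. 1"])
    show "AE \<omega> in \<mu>. (\<lambda>k. ?h k \<omega>) \<longlonglongrightarrow> indicator (cyl S V \<eta>) \<omega> * cond_weight \<Lambda> \<xi> (\<lambda>i. Some (\<omega> i))"
      by (intro always_eventually allI tendsto_mult tendsto_const cond_weight_tendsto L(1))
    show "AE \<omega> in \<mu>. norm (?h k \<omega>) \<le> 1" for k
      using cond_weight_bounds[OF L] by (intro always_eventually allI) (auto simp: indicator_def)
  qed (intro borel_measurable_times ind meas, intro borel_measurable_times ind meas, simp)
  have "eventually (\<lambda>k. (LINT \<omega>|\<mu>. ?h k \<omega>) = measure \<mu> (cyl S V \<eta> \<inter> cyl S \<Lambda> \<xi>)) sequentially"
  proof (rule eventually_mono[OF eventually_subset_box[OF V(1)]])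
    fix k assume k: "V \<subseteq> box k"
    let ?D = "box k - \<Lambda> - V"
    have D: "finite ?D" "V \<inter> ?D = {}" using finite_box by auto
    have VD: "V \<union> ?D = box k - \<Lambda>" using k V(2) by auto
    let ?C = "\<lambda>\<zeta>. cyl S (V \<union> ?D) (merge V ?D (\<eta>, \<zeta>))"
    have mg: "merge V ?D (\<eta>, \<zeta>) \<in> (V \<union> ?D) \<rightarrow>\<^sub>E S" if "\<zeta> \<in> ?D \<rightarrow>\<^sub>E S" for \<zeta>
      using merge_in_PiE[OF V(3) that] .
    have fVD: "finite (V \<union> ?D)" using V(1) D(1) by simp
    have "(LINT \<omega>|\<mu>. ?h k \<omega>) = (LINT \<omega>|\<mu>. (\<Sum>\<zeta>\<in>?D \<rightarrow>\<^sub>E S. cond_weight \<Lambda> \<xi> (overwrite ?D \<zeta> (labels V \<eta>)) * indicator (?C \<zeta>) \<omega>))"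
    proof (rule Bochner_Integration.integral_cong[OF refl])
      fix \<omega> assume "\<omega> \<in> space \<mu>"
      then have \<omega>: "\<omega> \<in> space (Omega_alg S)" using sp by simp
      have "cond_weight \<Lambda> \<xi> (labels (box k) \<omega>) = cond_weight \<Lambda> \<xi> (labels (V \<union> ?D) \<omega>)"
        unfolding VD by (rule cond_weight_cong) (auto simp: labels_def)
      then show "?h k \<omega> = (\<Sum>\<zeta>\<in>?D \<rightarrow>\<^sub>E S. cond_weight \<Lambda> \<xi> (overwrite ?D \<zeta> (labels V \<eta>)) * indicator (?C \<zeta>) \<omega>)"
        using cond_weight_cyl_expand[OF V(1) D V(3) \<omega>, of \<Lambda> \<xi>] by simp
    qed
    also have "\<dots> = (\<Sum>\<zeta>\<in>?D \<rightarrow>\<^sub>E S. LINT \<omega>|\<mu>. cond_weight \<Lambda> \<xi> (overwrite ?D \<zeta> (labels V \<eta>)) * indicator (?C \<zeta>) \<omega>)"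
      by (rule Bochner_Integration.integral_sum)
         (intro integrable_mult_right integrable_real_indicator cs[OF fVD mg], simp_all add: emeasure_eq_measure)
    also have "\<dots> = (\<Sum>\<zeta>\<in>?D \<rightarrow>\<^sub>E S. cond_weight \<Lambda> \<xi> (overwrite ?D \<zeta> (labels V \<eta>)) * cyl_weight (overwrite ?D \<zeta> (labels V \<eta>)))"
    proof (intro sum.cong refl)
      fix \<zeta> assume \<zeta>: "\<zeta> \<in> ?D \<rightarrow>\<^sub>E S"
      have "(LINT \<omega>|\<mu>. indicator (?C \<zeta>) \<omega>) = measure \<mu> (?C \<zeta>)"
        using cs[OF fVD mg[OF \<zeta>]] by (simp add: sets.sets_into_space Int_absorb2)
      also have "\<dots> = cyl_weight (overwrite ?D \<zeta> (labels V \<eta>))" using cylm[OF fVD mg[OF \<zeta>]] labels_merge[OF D(2)] by metis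
      finally show "(LINT \<omega>|\<mu>. cond_weight \<Lambda> \<xi> (overwrite ?D \<zeta> (labels V \<eta>)) * indicator (?C \<zeta>) \<omega>) =
          cond_weight \<Lambda> \<xi> (overwrite ?D \<zeta> (labels V \<eta>)) * cyl_weight (overwrite ?D \<zeta> (labels V \<eta>))" by simp
    qed
    \<comment> \<open>Conditional weight times weight of the condition is the joint weight; the sum
      over \<zeta> then forgets the auxiliary spins in \<open>?D\<close>.\<close>
    also have "\<dots> = (\<Sum>\<zeta>\<in>?D \<rightarrow>\<^sub>E S. cyl_weight (overwrite ?D \<zeta> (overwrite \<Lambda> \<xi> (labels V \<eta>))))"
    proof (intro sum.cong refl)
      fix \<zeta> assume "\<zeta> \<in> ?D \<rightarrow>\<^sub>E S"
      have "cyl_weight (overwrite \<Lambda> \<xi> (overwrite ?D \<zeta> (labels V \<eta>))) = cond_weight \<Lambda> \<xi> (overwrite ?D \<zeta> (labels V \<eta>)) * cyl_weight (overwrite ?D \<zeta> (labels V \<eta>))"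
        by (rule cyl_weight_cond_weight[OF L(1) fVD _ _ L(2)]) (use V(2) in \<open>auto simp: overwrite_def labels_def\<close>)
      moreover have "overwrite \<Lambda> \<xi> (overwrite ?D \<zeta> (labels V \<eta>)) = overwrite ?D \<zeta> (overwrite \<Lambda> \<xi> (labels V \<eta>))"
        by (auto simp: overwrite_def)
      ultimately show "cond_weight \<Lambda> \<xi> (overwrite ?D \<zeta> (labels V \<eta>)) * cyl_weight (overwrite ?D \<zeta> (labels V \<eta>)) = cyl_weight (overwrite ?D \<zeta> (overwrite \<Lambda> \<xi> (labels V \<eta>)))"
        by simp
    qed
    also have "\<dots> = cyl_weight (erase ?D (overwrite \<Lambda> \<xi> (labels V \<eta>)))"
      by (rule cyl_weight_sum[OF D(1), of "V \<union> \<Lambda>"]) (use V(1) L(1) in \<open>auto simp: overwrite_def labels_def\<close>)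
    also have "erase ?D (overwrite \<Lambda> \<xi> (labels V \<eta>)) = overwrite \<Lambda> \<xi> (labels V \<eta>)"
      by (auto simp: erase_def overwrite_def labels_def)
    also have "cyl_weight \<dots> = measure \<mu> (cyl S V \<eta> \<inter> cyl S \<Lambda> \<xi>)"
      unfolding cyl_Int[OF V(2)] using cylm[OF _ merge_in_PiE[OF V(3) L(2)]] labels_merge[OF V(2), of \<eta> \<xi>] V(1) L(1) by simp
    finally show "(LINT \<omega>|\<mu>. ?h k \<omega>) = measure \<mu> (cyl S V \<eta> \<inter> cyl S \<Lambda> \<xi>)" .
  qed
  then have "(\<lambda>k. LINT \<omega>|\<mu>. ?h k \<omega>) \<longlonglongrightarrow> measure \<mu> (cyl S V \<eta> \<inter> cyl S \<Lambda> \<xi>)" by (rule tendsto_eventually)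
  with lim show ?thesis by (rule LIMSEQ_unique)
qed

text \<open>The property proved on cylinders extends to the whole outside algebra by a
  \<pi>-\<lambda> argument and then characterises the conditional expectation.\<close>

lemma DLR:
  assumes \<mu>: "prob_space \<mu>" "sets \<mu> = sets (Omega_alg S)"
    and cylm: "\<And>\<Lambda> \<xi>. finite \<Lambda> \<Longrightarrow> \<xi> \<in> \<Lambda> \<rightarrow>\<^sub>E S \<Longrightarrow> measure \<mu> (cyl S \<Lambda> \<xi>) = cyl_weight (labels \<Lambda> \<xi>)"
    and L: "finite \<Lambda>" "\<xi> \<in> \<Lambda> \<rightarrow>\<^sub>E S"
  shows "AE \<omega> in \<mu>. real_cond_exp \<mu> (outside_alg S \<Lambda>) (indicator (cyl S \<Lambda> \<xi>)) \<omega> = gibbs_spec S Psi \<Lambda> \<xi> \<omega>"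
proof -
  interpret prob_space \<mu> by fact
  have sp: "space \<mu> = space (Omega_alg S)" using \<mu>(2) by (rule sets_eq_imp_space_eq)
  have sub: "subalgebra \<mu> (outside_alg S \<Lambda>)"
    using subalgebra_outside[of S \<Lambda>] \<mu>(2) sp by (simp add: subalgebra_def)
  interpret finite_measure_subalgebra \<mu> "outside_alg S \<Lambda>" by unfold_locales (rule sub)
  let ?g = "\<lambda>\<omega>. cond_weight \<Lambda> \<xi> (\<lambda>i. Some (\<omega> i))" and ?C = "cyl S \<Lambda> \<xi>"
  have C: "?C \<in> sets \<mu>" using cyl_in_Omega_alg[OF L] \<mu>(2) by simp
  have gm: "?g \<in> borel_measurable \<mu>" by (rule measurable_from_subalg[OF sub cond_weight_Some_measurable[OF L(1)]])
  have iC: "integrable \<mu> (indicator ?C :: _ \<Rightarrow> real)"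
    using C by (simp add: integrable_real_indicator emeasure_eq_measure)
  have ig: "integrable \<mu> ?g"
    by (rule integrable_const_bound[where B = 1, OF _ gm]) (use cond_weight_bounds[OF L] in auto)
  have em: "emeasure (density \<mu> (\<lambda>\<omega>. ennreal (f \<omega>))) A = ennreal (LINT \<omega>:A|\<mu>. f \<omega>)"
    if f: "integrable \<mu> f" "\<And>\<omega>. 0 \<le> f \<omega>" and A: "A \<in> sets \<mu>" for f A
  proof -
    have fm: "f \<in> borel_measurable \<mu>" using f(1) by simp
    have "emeasure (density \<mu> (\<lambda>\<omega>. ennreal (f \<omega>))) A = (\<integral>\<^sup>+\<omega>. ennreal (f \<omega>) * indicator A \<omega> \<partial>\<mu>)"
      using fm A by (simp add: emeasure_density)
    also have "\<dots> = (\<integral>\<^sup>+\<omega>. ennreal (indicator A \<omega> * f \<omega>) \<partial>\<mu>)"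
      by (intro nn_integral_cong) (auto simp: indicator_def)
    also have "\<dots> = ennreal (LINT \<omega>:A|\<mu>. f \<omega>)"
      unfolding set_lebesgue_integral_def real_scaleR_def
      by (rule nn_integral_eq_integral) (use integrable_real_mult_indicator[OF A f(1)] f(2) in \<open>auto simp: mult.commute\<close>)
    finally show ?thesis .
  qed
  \<comment> \<open>The two sides are read as finite measures with densities, so that closure under
    complements and disjoint unions is that of measures.\<close>
  let ?M1 = "density \<mu> (\<lambda>\<omega>. ennreal (indicator ?C \<omega>))" and ?M2 = "density \<mu> (\<lambda>\<omega>. ennreal (?g \<omega>))"
  have sets_sub: "sigma_sets (space \<mu>) (outside_cyls S \<Lambda>) \<subseteq> sets \<mu>"
  proof (rule sets.sigma_sets_subset)
    show "outside_cyls S \<Lambda> \<subseteq> sets \<mu>" using cyl_in_Omega_alg \<mu>(2) by (auto simp: outside_cyls_def)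
  qed
  have eq: "emeasure ?M1 A = emeasure ?M2 A" if Acyl: "A \<in> outside_cyls S \<Lambda>" for A
  proof (cases "A = {}")
    case False
    then obtain V \<eta> where V: "A = cyl S V \<eta>" "finite V" "V \<inter> \<Lambda> = {}" "\<eta> \<in> V \<rightarrow>\<^sub>E S"
      using Acyl by (auto simp: outside_cyls_def)
    have A: "A \<in> sets \<mu>" using cyl_in_Omega_alg[OF V(2,4)] \<mu>(2) by (simp add: V(1))
    have "(LINT \<omega>:A|\<mu>. indicator ?C \<omega>) = (LINT \<omega>|\<mu>. indicator (A \<inter> ?C) \<omega> :: real)"
      unfolding set_lebesgue_integral_def by (simp add: indicator_inter_arith)
    also have "\<dots> = measure \<mu> (A \<inter> ?C)" using A C by (simp add: sets.sets_into_space Int_absorb2)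
    also have "\<dots> = (LINT \<omega>:A|\<mu>. ?g \<omega>)"
      unfolding set_lebesgue_integral_def real_scaleR_def V(1)
      using cond_weight_cyl_integral[OF \<mu> cylm L V(2,3,4)] by simp
    finally show ?thesis
      using em[OF iC _ A] em[OF ig _ A] cond_weight_bounds[OF L] by simp
  qed simp
  have fin: "emeasure ?M1 A \<noteq> \<infinity>" "emeasure ?M2 A \<noteq> \<infinity>" if "A \<in> sets \<mu>" for A
    using em[OF iC _ that] em[OF ig _ that] cond_weight_bounds[OF L] by auto
  have all: "emeasure ?M1 A = emeasure ?M2 A" if "A \<in> sets (outside_alg S \<Lambda>)" for A
  proof -
    have "A \<in> sigma_sets (space \<mu>) (outside_cyls S \<Lambda>)"
      using that sets_outside_alg_subset[OF finite_S, of \<Lambda>] sp by auto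
    from Int_stable_outside_cyls outside_cyls_Pow[of S \<Lambda>, folded sp] this
    show ?thesis
    proof (induction rule: sigma_sets_induct_disjoint)
      case (basic A)
      then show ?case by (rule eq)
    next
      case empty
      then show ?case by simp
    next
      case (compl A)
      have A: "A \<in> sets \<mu>" using compl sets_sub by auto
      \<comment> \<open>The whole space is the cylinder over the empty base; agreement there gives
        equal total mass, needed for complements.\<close>
      have "space \<mu> \<in> outside_cyls S \<Lambda>"
      proof -
        have "cyl S {} (\<lambda>_. undefined) = space \<mu>" by (simp add: cyl_def sp)
        moreover have "cyl S {} (\<lambda>_. undefined) \<in> outside_cyls S \<Lambda>"
          by (rule cyl_in_outside_cyls) auto
        ultimately show ?thesis by simp
      qed
      then have "emeasure ?M1 (space \<mu>) = emeasure ?M2 (space \<mu>)" by (rule eq)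
      then show ?case
        using compl A fin[OF A] emeasure_compl[of A ?M1] emeasure_compl[of A ?M2] by simp
    next
      case (union A)
      have A: "range A \<subseteq> sets \<mu>" using union sets_sub by blast
      have "emeasure ?M1 (\<Union>i. A i) = (\<Sum>i. emeasure ?M1 (A i))"
        by (rule suminf_emeasure[symmetric]) (use A union in auto)
      also have "\<dots> = (\<Sum>i. emeasure ?M2 (A i))" using union by simp
      also have "\<dots> = emeasure ?M2 (\<Union>i. A i)"
        by (rule suminf_emeasure) (use A union in auto)
      finally show ?case .
    qed
  qed
  have "AE \<omega> in \<mu>. real_cond_exp \<mu> (outside_alg S \<Lambda>) (indicator ?C) \<omega> = ?g \<omega>"
  proof (rule real_cond_exp_charact)
    fix A assume A: "A \<in> sets (outside_alg S \<Lambda>)"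
    then have A\<mu>: "A \<in> sets \<mu>" using sub by (auto simp: subalgebra_def)
    have "ennreal (LINT \<omega>:A|\<mu>. indicator ?C \<omega>) = ennreal (LINT \<omega>:A|\<mu>. ?g \<omega>)"
      using all[OF A] em[OF iC _ A\<mu>] em[OF ig _ A\<mu>] cond_weight_bounds[OF L] by simp
    moreover have "0 \<le> (LINT \<omega>:A|\<mu>. indicator ?C \<omega> :: real)" "0 \<le> (LINT \<omega>:A|\<mu>. ?g \<omega>)"
      unfolding set_lebesgue_integral_def using cond_weight_bounds[OF L] by (auto intro!: integral_nonneg_AE)
    ultimately show "(LINT \<omega>:A|\<mu>. indicator ?C \<omega>) = (LINT \<omega>:A|\<mu>. ?g \<omega>)" by (simp add: ennreal_inj)
  qed (use iC ig cond_weight_Some_measurable[OF L(1)] in auto)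
  then show ?thesis by (simp add: gibbs_spec_Psi)
qed

theorem gibbs_measure_exists:
  "\<exists>\<mu>. prob_space \<mu> \<and> sets \<mu> = sets (Omega_alg S) \<and>
     (\<forall>\<Lambda>. finite \<Lambda> \<longrightarrow> (\<forall>\<xi>\<in>\<Lambda> \<rightarrow>\<^sub>E S.
       (\<lambda>n. weight (box n) (labels \<Lambda> \<xi>) / weight (box n) (\<lambda>_. None)) \<longlonglongrightarrow> measure \<mu> (cyl S \<Lambda> \<xi>))) \<and>
     gibbsian S \<mu>"
proof -
  obtain \<mu> where \<mu>: "prob_space \<mu>" "sets \<mu> = sets (Omega_alg S)"
    "\<And>\<Lambda> \<xi>. finite \<Lambda> \<Longrightarrow> \<xi> \<in> \<Lambda> \<rightarrow>\<^sub>E S \<Longrightarrow> measure \<mu> (cyl S \<Lambda> \<xi>) = cyl_weight (labels \<Lambda> \<xi>)"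
    using kolmogorov_extension by metis
  have "(\<lambda>n. weight (box n) (labels \<Lambda> \<xi>) / weight (box n) (\<lambda>_. None)) \<longlonglongrightarrow> measure \<mu> (cyl S \<Lambda> \<xi>)"
    if "finite \<Lambda>" "\<xi> \<in> \<Lambda> \<rightarrow>\<^sub>E S" for \<Lambda> \<xi>
    unfolding \<mu>(3)[OF that] by (rule cyl_weight_tendsto[OF that(1)]) (simp add: labels_def)
  moreover have "gibbsian S \<mu>"
    unfolding gibbsian_def
    using classical_potential_Psi potential_norm0_Psi DLR[OF \<mu>] by blast
  ultimately show ?thesis using \<mu>(1,2) by blast
qed

end

section \<open>Translation invariance and local projections\<close>

lemma mob_image:
  assumes "finite A" "inj_on g A"
  shows "mob f (g ` A) = mob (\<lambda>B. f (g ` B)) A"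
proof -
  have "mob f (g ` A) = (\<Sum>B\<in>Pow A. (-1) ^ (card (g ` A) - card (g ` B)) * f (g ` B))"
    unfolding mob_def image_Pow_surj[OF refl, symmetric]
    by (subst sum.reindex) (use inj_on_image_Pow[OF assms(2)] in auto)
  also have "\<dots> = (\<Sum>B\<in>Pow A. (-1) ^ (card A - card B) * f (g ` B))"
  proof (intro sum.cong refl)
    fix B assume "B \<in> Pow A"
    then have "card (g ` B) = card B" "card (g ` A) = card A"
      using assms(2) by (auto intro: card_image inj_on_subset)
    then show "(-1) ^ (card (g ` A) - card (g ` B)) * f (g ` B) = (-1) ^ (card A - card B) * f (g ` B)" by simp
  qed
  finally show ?thesis by (simp add: mob_def)
qed

lemma kpow_reindex:
  assumes "bij_betw g S S'" "\<And>\<sigma> \<tau>. \<sigma> \<in> S \<Longrightarrow> \<tau> \<in> S \<Longrightarrow> K \<sigma> \<tau> = K' (g \<sigma>) (g \<tau>)" "\<sigma> \<in> S" "\<tau> \<in> S"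
  shows "kpow S K n \<sigma> \<tau> = kpow S' K' n (g \<sigma>) (g \<tau>)"
  using assms(3)
proof (induction n arbitrary: \<sigma>)
  case 0
  then show ?case using assms(1,4) by (auto simp: kpow_0 kid_def bij_betw_def inj_on_eq_iff)
next
  case (Suc n)
  then show ?case
    unfolding kpow_Suc kmult_def sum.reindex_bij_betw[OF assms(1), symmetric]
    by (intro sum.cong refl) (simp add: assms(2))
qed

lemma ktrace_kmult_reindex:
  assumes "bij_betw g S S'" "\<And>\<sigma> \<tau>. \<sigma> \<in> S \<Longrightarrow> \<tau> \<in> S \<Longrightarrow> K \<sigma> \<tau> = K' (g \<sigma>) (g \<tau>)"
    "\<And>\<sigma> \<tau>. \<sigma> \<in> S \<Longrightarrow> \<tau> \<in> S \<Longrightarrow> L \<sigma> \<tau> = L' (g \<sigma>) (g \<tau>)"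
  shows "ktrace S (kmult S K L) = ktrace S' (kmult S' K' L')"
  unfolding ktrace_def kmult_def sum.reindex_bij_betw[OF assms(1), symmetric]
  by (intro sum.cong refl) (simp add: assms(2,3))

lemma inj_on_shift: "inj_on (\<lambda>j. j + (i :: int^'d)) A"
  by (simp add: inj_on_def)

lemma transl_transl: "transl i (transl j A) = transl (i + j) A"
  by (auto simp: transl_def image_image add_ac)

lemma transl_0: "transl 0 A = A"
  by (simp add: transl_def)

lemma inj_transl: "inj (transl i)"
  by (rule inj_on_inverseI[where g = "transl (- i)"]) (simp add: transl_transl transl_0)

lemma card_transl: "card (transl i A) = card A"
  unfolding transl_def by (rule card_image[OF inj_on_shift])

lemma nePow_transl: "nePow (transl i B) = transl i ` nePow B"
proof -
  have "Pow (transl i B) = transl i ` Pow B"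
    using image_Pow_surj[of "\<lambda>j. j + i" B "transl i B"] by (simp add: transl_def[abs_def])
  moreover have "transl i {} = {}" by (simp add: transl_def)
  ultimately show ?thesis by (simp add: nePow_def image_set_diff[OF inj_transl])
qed

lemma bij_betw_shift:
  "bij_betw (\<lambda>\<sigma>. \<lambda>j\<in>A. \<sigma> (j + i)) (cfg (transl i A) :: (int^'d \<Rightarrow> 'm) set) (cfg A)"
proof (rule bij_betw_byWitness[where f' = "\<lambda>\<tau>. \<lambda>j\<in>transl i A. \<tau> (j - i)"])
  show "\<forall>\<sigma>\<in>cfg (transl i A) :: (int^'d \<Rightarrow> 'm) set. (\<lambda>j\<in>transl i A. (\<lambda>j\<in>A. \<sigma> (j + i)) (j - i)) = \<sigma>"
    by (auto simp: cfg_def transl_def PiE_def extensional_def fun_eq_iff)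
  show "\<forall>\<tau>\<in>cfg A :: (int^'d \<Rightarrow> 'm) set. (\<lambda>j\<in>A. (\<lambda>j\<in>transl i A. \<tau> (j - i)) (j + i)) = \<tau>"
    by (auto simp: cfg_def transl_def PiE_def extensional_def fun_eq_iff)
qed auto

lemma quantum_interaction_transl:
  assumes "quantum_interaction \<Phi>" "finite A" "\<sigma> \<in> cfg (transl i A)" "\<tau> \<in> cfg (transl i A)"
  shows "\<Phi> (transl i A) \<sigma> \<tau> = \<Phi> A (\<lambda>j\<in>A. \<sigma> (j + i)) (\<lambda>j\<in>A. \<tau> (j + i))"
  using assms unfolding quantum_interaction_def by blast

lemma kopnorm_transl_le:
  fixes \<Phi> :: "(int^'d) set \<Rightarrow> ((int^'d) \<Rightarrow> 'm::finite) \<Rightarrow> ((int^'d) \<Rightarrow> 'm) \<Rightarrow> complex"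
  assumes "quantum_interaction \<Phi>" "finite A"
  shows "kopnorm (cfg (transl i A)) (\<Phi> (transl i A)) \<le> kopnorm (cfg A) (\<Phi> A)"
proof (rule kopnorm_le)
  show "kbound (cfg (transl i A)) (\<Phi> (transl i A)) (kopnorm (cfg A) (\<Phi> A))"
  proof (rule kbound_reindex[OF bij_betw_shift])
    show "kbound (cfg A) (\<Phi> A) (kopnorm (cfg A) (\<Phi> A))" using assms(2) by (simp add: kbound_kopnorm)
  qed (rule quantum_interaction_transl[OF assms])
qed (use assms(2) in \<open>simp add: kopnorm_nonneg\<close>)

text \<open>Translating by -y moves all sets through y to sets through the origin without changing
  size or norm, so the interaction norm bounds the sum at every site.\<close>

lemma interaction_sum_le:
  fixes \<Phi> :: "(int^'d) set \<Rightarrow> ((int^'d) \<Rightarrow> 'm::finite) \<Rightarrow> ((int^'d) \<Rightarrow> 'm) \<Rightarrow> complex"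
  assumes "quantum_interaction \<Phi>" "interaction_norm_finite \<kappa> \<Phi>" "finite L"
  shows "(\<Sum>A\<in>{A\<in>Pow L. y \<in> A}. exp (\<kappa> * card A) * kopnorm (cfg A) (\<Phi> A))
    \<le> (\<Sum>\<^sub>\<infinity>A\<in>{A. finite A \<and> 0 \<in> A}. exp (\<kappa> * card A) * kopnorm (cfg A) (\<Phi> A))"
proof -
  let ?F = "{A\<in>Pow L. y \<in> A}"
  let ?f = "\<lambda>A. exp (\<kappa> * card A) * kopnorm (cfg A) (\<Phi> A)"
  have fin: "finite A" if "A \<in> ?F" for A using that finite_subset[OF _ assms(3)] by auto
  have "(\<Sum>A\<in>?F. ?f A) \<le> (\<Sum>A\<in>?F. ?f (transl (- y) A))"
  proof (rule sum_mono)
    fix A assume "A \<in> ?F"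
    then have "finite (transl (- y) A)" using fin by (simp add: transl_def)
    then have "kopnorm (cfg (transl y (transl (- y) A))) (\<Phi> (transl y (transl (- y) A)))
        \<le> kopnorm (cfg (transl (- y) A)) (\<Phi> (transl (- y) A))"
      by (rule kopnorm_transl_le[OF assms(1)])
    then show "?f A \<le> ?f (transl (- y) A)" by (simp add: transl_transl transl_0 card_transl)
  qed
  also have "\<dots> = (\<Sum>A\<in>transl (- y) ` ?F. ?f A)"
    by (subst sum.reindex) (auto intro: inj_on_subset[OF inj_transl])
  also have "\<dots> \<le> (\<Sum>\<^sub>\<infinity>A\<in>{A. finite A \<and> 0 \<in> A}. ?f A)"
  proof (rule finite_sum_le_infsum)
    show "?f summable_on {A. finite A \<and> 0 \<in> A}" using assms(2) by (simp add: interaction_norm_finite_def)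
    show "transl (- y) ` ?F \<subseteq> {A. finite A \<and> 0 \<in> A}" using fin by (force simp: transl_def)
  qed (use assms(3) in \<open>auto intro!: mult_nonneg_nonneg kopnorm_nonneg\<close>)
  finally show ?thesis .
qed

text \<open>From 1 - x \<le> exp(-x), multiplied by exp(x).\<close>

lemma exp_minus_one_le:
  fixes x :: real
  shows "exp x - 1 \<le> x * exp x"
proof -
  have "(1 + - x) * exp x \<le> exp (- x) * exp x"
    by (intro mult_right_mono exp_ge_add_one_self) simp
  also have "\<dots> = 1" by (simp add: exp_minus)
  finally show ?thesis by (simp add: algebra_simps)
qed

lemma Union_nePow: "\<Union>(nePow L) = L"
  by (auto simp: nePow_def)

context spin_system
begin

lemma fam_weight_cong:
  assumes "\<And>i. i \<in> \<Union>\<A> \<Longrightarrow> y i = y' i"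
  shows "fam_weight \<beta> y \<A> = fam_weight \<beta> y' \<A>"
proof -
  have "local_proj y (\<Union>\<A>) = local_proj y' (\<Union>\<A>)" unfolding local_proj_def by (intro ext prod.cong refl) (simp add: assms)
  moreover have "(\<Prod>i\<in>\<Union>\<A>. tr (y i)) = (\<Prod>i\<in>\<Union>\<A>. tr (y' i))" by (intro prod.cong refl) (simp add: assms)
  ultimately show ?thesis by (simp add: fam_weight_def moment_def)
qed

end

text \<open>Shifting configurations is a bijection that carries embedded terms, local projections
  and traces of the translated region to those of B, so all moments agree.\<close>

lemma fam_weight_transl:
  fixes \<Phi> :: "(int^'d) set \<Rightarrow> ((int^'d) \<Rightarrow> 'm::finite) \<Rightarrow> ((int^'d) \<Rightarrow> 'm) \<Rightarrow> complex"
  assumes "spin_system \<Phi> P" "quantum_interaction \<Phi>" "finite B"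
  shows "spin_system.fam_weight \<Phi> P \<beta> y (nePow (transl i B)) = spin_system.fam_weight \<Phi> P \<beta> (\<lambda>j. y (j + i)) (nePow B)"
proof -
  interpret spin_system \<Phi> P by fact
  let ?g = "\<lambda>\<sigma>. \<lambda>j\<in>B. \<sigma> (j + i)" and ?T = "transl i B"
  have H: "fam_ham ?T (nePow ?T) \<sigma> \<tau> = fam_ham B (nePow B) (?g \<sigma>) (?g \<tau>)" for \<sigma> \<tau>
  proof -
    have "fam_ham ?T (nePow ?T) \<sigma> \<tau> = (\<Sum>A\<in>nePow B. emb (transl i A) ?T (\<Phi> (transl i A)) \<sigma> \<tau>)"
      unfolding fam_ham_def nePow_transl by (subst sum.reindex) (auto intro: inj_on_subset[OF inj_transl])
    also have "\<dots> = fam_ham B (nePow B) (?g \<sigma>) (?g \<tau>)"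
      unfolding fam_ham_def
    proof (intro sum.cong refl)
      fix A assume "A \<in> nePow B"
      then have A: "A \<subseteq> B" "finite A" using finite_subset[OF _ assms(3)] by (auto simp: nePow_def)
      have tr: "\<Phi> (transl i A) \<sigma>' \<tau>' = \<Phi> A (\<lambda>j\<in>A. \<sigma>' (j + i)) (\<lambda>j\<in>A. \<tau>' (j + i))"
        if "\<sigma>' \<in> cfg (transl i A)" "\<tau>' \<in> cfg (transl i A)" for \<sigma>' \<tau>'
        by (rule quantum_interaction_transl[OF assms(2) A(2) that])
      have r: "(\<lambda>j\<in>A. restrict \<sigma> (transl i A) (j + i)) = restrict (?g \<sigma>) A" for \<sigma> :: "int^'d \<Rightarrow> 'm"
        using A(1) by (auto simp: transl_def fun_eq_iff)
      have "?T - transl i A = (\<lambda>j. j + i) ` (B - A)" by (auto simp: transl_def)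
      then have d: "(\<forall>k\<in>?T - transl i A. \<sigma> k = \<tau> k) \<longleftrightarrow> (\<forall>j\<in>B - A. ?g \<sigma> j = ?g \<tau> j)" by simp
      show "emb (transl i A) ?T (\<Phi> (transl i A)) \<sigma> \<tau> = emb A B (\<Phi> A) (?g \<sigma>) (?g \<tau>)"
        unfolding emb_def d tr[OF restrict_in_cfg restrict_in_cfg] r ..
    qed
    finally show ?thesis .
  qed
  have PPt: "local_proj y ?T \<sigma> \<tau> = local_proj (\<lambda>j. y (j + i)) B (?g \<sigma>) (?g \<tau>)" for \<sigma> \<tau>
    unfolding local_proj_def transl_def by (subst prod.reindex[OF inj_on_shift]) (auto intro!: prod.cong)
  have tr: "(\<Prod>k\<in>?T. tr (y k)) = (\<Prod>j\<in>B. tr (y (j + i)))"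
    unfolding transl_def by (subst prod.reindex[OF inj_on_shift]) simp
  have "moment y n ?T (nePow ?T) = moment (\<lambda>j. y (j + i)) n B (nePow B)" for n
  proof -
    have "ktrace (cfg ?T) (kmult (cfg ?T) (kpow (cfg ?T) (fam_ham ?T (nePow ?T)) n) (local_proj y ?T))
        = ktrace (cfg B) (kmult (cfg B) (kpow (cfg B) (fam_ham B (nePow B)) n) (local_proj (\<lambda>j. y (j + i)) B))"
      by (rule ktrace_kmult_reindex[OF bij_betw_shift]) (auto intro!: kpow_reindex[OF bij_betw_shift] H PPt)
    then show ?thesis by (simp add: moment_def tr)
  qed
  then show ?thesis by (simp add: fam_weight_def Union_nePow)
qed

text \<open>Since \<open>specproj\<close> is a definite description, labels outside the spectrum are sent to the
  identity; every label then yields a nonzero orthogonal projection.\<close>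

definition site_proj :: "('m::finite \<Rightarrow> 'm \<Rightarrow> complex) \<Rightarrow> real option \<Rightarrow> 'm \<Rightarrow> 'm \<Rightarrow> complex" where
  "site_proj X l = (case l of None \<Rightarrow> kid | Some x \<Rightarrow> if x \<in> spec X then specproj X x else kid)"

lemma spin_system_site_proj:
  fixes \<Phi> :: "(int^'d) set \<Rightarrow> ((int^'d) \<Rightarrow> 'm::finite) \<Rightarrow> ((int^'d) \<Rightarrow> 'm) \<Rightarrow> complex"
  assumes "quantum_interaction \<Phi>" "selfadjoint X"
  shows "spin_system \<Phi> (site_proj X)"
proof
  show "\<Phi> A \<sigma> \<tau> = cnj (\<Phi> A \<tau> \<sigma>)" if "finite A" "\<sigma> \<in> cfg A" "\<tau> \<in> cfg A" for A \<sigma> \<tau>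
  proof -
    have "\<forall>A. finite A \<longrightarrow> (\<forall>\<sigma>\<in>cfg A. \<forall>\<tau>\<in>cfg A. \<Phi> A \<sigma> \<tau> = cnj (\<Phi> A \<tau> \<sigma>))"
      using assms(1) unfolding quantum_interaction_def by (elim conjE)
    from this[rule_format, OF that] show ?thesis .
  qed
  fix l
  consider "site_proj X l = kid" | x where "x \<in> spec X" "site_proj X l = specproj X x"
  proof (cases "\<exists>x\<in>spec X. l = Some x")
    case True
    then obtain x where "x \<in> spec X" "l = Some x" by blast
    then show thesis using that(2)[of x] by (simp add: site_proj_def)
  next
    case False
    then have "site_proj X l = kid" by (cases l) (auto simp: site_proj_def)
    then show thesis by (rule that(1))
  qed
  then have "(\<forall>a b. site_proj X l a b = cnj (site_proj X l b a)) \<and>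
      kmult UNIV (site_proj X l) (site_proj X l) = site_proj X l \<and> (\<exists>a b. site_proj X l a b \<noteq> 0)"
  proof cases
    case 1
    have "kmult UNIV kid kid = (kid :: 'm \<Rightarrow> 'm \<Rightarrow> complex)" by (intro ext) (simp add: kmult_kid_left)
    moreover have "\<forall>a b. kid a b = cnj (kid b a :: complex)" by (simp add: kid_def)
    moreover have "\<exists>a b :: 'm. kid a b \<noteq> 0" by (auto simp: kid_def)
    ultimately show ?thesis unfolding 1 by blast
  next
    case 2
    show ?thesis unfolding 2(2)
      by (intro conjI allI spectral_resolution(2,3,4)[OF assms(2) 2(1)])
  qed
  note * = this
  show "site_proj X l a b = cnj (site_proj X l b a)" for a b by (rule conjunct1[OF *, rule_format])
  show "kmult UNIV (site_proj X l) (site_proj X l) = site_proj X l" by (rule conjunct1[OF conjunct2[OF *]])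
  show "\<exists>a b. site_proj X l a b \<noteq> 0" by (rule conjunct2[OF conjunct2[OF *]])
qed

section \<open>The classical restriction\<close>

lemma hamiltonian_eq_fam_ham:
  fixes \<Phi> :: "(int^'d) set \<Rightarrow> ((int^'d) \<Rightarrow> 'm::finite) \<Rightarrow> ((int^'d) \<Rightarrow> 'm) \<Rightarrow> complex"
  assumes "spin_system \<Phi> P" "quantum_interaction \<Phi>" "finite \<Lambda>"
  shows "hamiltonian \<Phi> \<Lambda> \<sigma> \<tau> = spin_system.fam_ham \<Phi> \<Lambda> (nePow \<Lambda>) \<sigma> \<tau>"
proof -
  interpret spin_system \<Phi> P by fact
  have "\<forall>\<sigma>\<in>cfg {}. \<forall>\<tau>\<in>cfg {}. \<Phi> {} \<sigma> \<tau> = 0"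
    using assms(2) unfolding quantum_interaction_def by (elim conjE)
  then have "\<Phi> {} (restrict \<sigma> {}) (restrict \<tau> {}) = 0" using restrict_in_cfg by blast
  then have z: "emb {} \<Lambda> (\<Phi> {}) \<sigma> \<tau> = 0" unfolding emb_def by simp
  show ?thesis unfolding hamiltonian_def fam_ham_def nePow_def
    by (rule sum.mono_neutral_right) (use assms(3) z in auto)
qed

text \<open>N y is the trace of \<open>exp (- \<beta> H)\<close> against the projections named by y.
  \<open>None\<close> off V makes these the embedded \<open>QLam\<close>, and \<open>None\<close>
  everywhere the identity, so numerator and partition function are both values of N.\<close>

lemma gibbs_state_eq:
  fixes \<Phi> :: "(int^'d) set \<Rightarrow> ((int^'d) \<Rightarrow> 'm::finite) \<Rightarrow> ((int^'d) \<Rightarrow> 'm) \<Rightarrow> complex" and \<beta> :: real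
  assumes qi: "quantum_interaction \<Phi>" and sa: "selfadjoint X" and V: "finite \<Lambda>" "V \<subseteq> \<Lambda>" "\<xi> \<in> V \<rightarrow>\<^sub>E spec X"
  defines "N \<equiv> \<lambda>y. (\<Prod>i\<in>\<Lambda>. spin_system.tr (site_proj X) (y i)) * spin_system.fam_weight \<Phi> (site_proj X) \<beta> y (nePow \<Lambda>)"
  shows "gibbs_state \<beta> \<Phi> \<Lambda> (emb V \<Lambda> (QLam X V \<xi>)) = complex_of_real (N (labels V \<xi>) / N (\<lambda>_. None))"
proof -
  interpret spin_system \<Phi> "site_proj X" by (rule spin_system_site_proj[OF qi sa])
  let ?S = "cfg \<Lambda> :: ((int^'d) \<Rightarrow> 'm) set"
  let ?H = "\<lambda>\<sigma> \<tau>. - complex_of_real \<beta> * hamiltonian \<Phi> \<Lambda> \<sigma> \<tau>"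
  have H: "?H \<sigma> \<tau> = - complex_of_real \<beta> * fam_ham \<Lambda> (nePow \<Lambda>) \<sigma> \<tau>" for \<sigma> \<tau>
    by (simp add: hamiltonian_eq_fam_ham[OF spin_system_axioms qi V(1)])
  have fin: "finite (nePow \<Lambda>)" "\<Union>(nePow \<Lambda>) \<subseteq> \<Lambda>" using V(1) by (auto simp: Union_nePow)
  have B: "emb V \<Lambda> (QLam X V \<xi>) \<sigma> \<tau> = local_proj (labels V \<xi>) \<Lambda> \<sigma> \<tau>" for \<sigma> \<tau>
  proof -
    have "local_proj (labels V \<xi>) \<Lambda> \<sigma> \<tau> = (\<Prod>i\<in>V. site_proj X (labels V \<xi> i) (\<sigma> i) (\<tau> i)) * (\<Prod>i\<in>\<Lambda> - V. site_proj X (labels V \<xi> i) (\<sigma> i) (\<tau> i))"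
      unfolding local_proj_def using prod.subset_diff[OF V(2,1)] by (simp add: mult.commute)
    also have "(\<Prod>i\<in>V. site_proj X (labels V \<xi> i) (\<sigma> i) (\<tau> i)) = QLam X V \<xi> (restrict \<sigma> V) (restrict \<tau> V)"
      unfolding QLam_def by (intro prod.cong refl) (use V(3) in \<open>auto simp: labels_def site_proj_def\<close>)
    also have "(\<Prod>i\<in>\<Lambda> - V. site_proj X (labels V \<xi> i) (\<sigma> i) (\<tau> i)) = (\<Prod>i\<in>\<Lambda> - V. if \<sigma> i = \<tau> i then 1 else 0)"
      by (intro prod.cong refl) (auto simp: labels_def site_proj_def kid_def)
    also have "\<dots> = (if \<forall>i\<in>\<Lambda> - V. \<sigma> i = \<tau> i then 1 else 0)"
      using V(1) by (auto simp: prod_zero_iff)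
    finally show ?thesis unfolding emb_def by (rule sym)
  qed
  have num: "ktrace ?S (kmult ?S (kexp ?S ?H) (emb V \<Lambda> (QLam X V \<xi>))) = complex_of_real (N (labels V \<xi>))"
    unfolding N_def by (rule ktrace_kexp[OF V(1) fin]) (rule H, rule B)
  have K: "kid \<sigma> \<tau> = local_proj (\<lambda>_. None) \<Lambda> \<sigma> \<tau>" if "\<sigma> \<in> ?S" "\<tau> \<in> ?S" for \<sigma> \<tau>
  proof -
    have "local_proj (\<lambda>_. None) \<Lambda> \<sigma> \<tau> = (\<Prod>i\<in>\<Lambda>. if \<sigma> i = \<tau> i then 1 else 0)"
      unfolding local_proj_def by (intro prod.cong refl) (auto simp: site_proj_def kid_def)
    also have "\<dots> = (if \<forall>i\<in>\<Lambda>. \<sigma> i = \<tau> i then 1 else 0)"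
      using V(1) by (auto simp: prod_zero_iff)
    also have "(\<forall>i\<in>\<Lambda>. \<sigma> i = \<tau> i) \<longleftrightarrow> \<sigma> = \<tau>" using that PiE_ext unfolding cfg_def by blast
    finally show ?thesis by (simp add: kid_def)
  qed
  have "ktrace ?S (kexp ?S ?H) = ktrace ?S (kmult ?S (kexp ?S ?H) kid)"
    unfolding ktrace_def by (intro sum.cong refl) (use V(1) in \<open>simp add: kmult_kid_right\<close>)
  also have "\<dots> = complex_of_real (N (\<lambda>_. None))"
    unfolding N_def by (rule ktrace_kexp[OF V(1) fin]) (rule H, rule K)
  finally have den: "ktrace ?S (kexp ?S ?H) = complex_of_real (N (\<lambda>_. None))" .
  show ?thesis unfolding gibbs_state_def Let_def num den by (rule of_real_divide[symmetric])
qed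

text \<open>The projections of X sum to the identity at site i, and the trace is linear in the
  factor at that site.\<close>

lemma weight_sum_label:
  fixes \<Phi> :: "(int^'d) set \<Rightarrow> ((int^'d) \<Rightarrow> 'm::finite) \<Rightarrow> ((int^'d) \<Rightarrow> 'm) \<Rightarrow> complex" and \<beta> :: real
  assumes qi: "quantum_interaction \<Phi>" and sa: "selfadjoint X" and L: "finite \<Lambda>" "i \<in> \<Lambda>"
  defines "N \<equiv> \<lambda>y. (\<Prod>i\<in>\<Lambda>. spin_system.tr (site_proj X) (y i)) * spin_system.fam_weight \<Phi> (site_proj X) \<beta> y (nePow \<Lambda>)"
  shows "N (y(i := None)) = (\<Sum>v\<in>spec X. N (y(i := Some v)))"
proof -
  interpret spin_system \<Phi> "site_proj X" by (rule spin_system_site_proj[OF qi sa])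
  let ?S = "cfg \<Lambda> :: ((int^'d) \<Rightarrow> 'm) set"
  let ?E = "kexp ?S (\<lambda>\<sigma> \<tau>. - complex_of_real \<beta> * fam_ham \<Lambda> (nePow \<Lambda>) \<sigma> \<tau>)"
  have fin: "finite (nePow \<Lambda>)" "\<Union>(nePow \<Lambda>) \<subseteq> \<Lambda>" using L(1) by (auto simp: Union_nePow)
  have N: "complex_of_real (N y) = ktrace ?S (kmult ?S ?E (local_proj y \<Lambda>))" for y
    unfolding N_def by (rule ktrace_kexp[OF L(1) fin, symmetric]) simp_all
  have split: "local_proj (y(i := l)) \<Lambda> \<sigma> \<tau> = site_proj X l (\<sigma> i) (\<tau> i) * (\<Prod>j\<in>\<Lambda> - {i}. site_proj X (y j) (\<sigma> j) (\<tau> j))" for l \<sigma> \<tau>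
    unfolding local_proj_def prod.remove[OF L] by (auto intro!: prod.cong)
  have P: "local_proj (y(i := None)) \<Lambda> \<sigma> \<tau> = (\<Sum>v\<in>spec X. local_proj (y(i := Some v)) \<Lambda> \<sigma> \<tau>)" for \<sigma> \<tau>
    unfolding split sum_distrib_right[symmetric]
    using spectral_resolution(5)[OF sa, of "\<sigma> i" "\<tau> i"] by (simp add: site_proj_def)
  have "complex_of_real (N (y(i := None))) = (\<Sum>\<sigma>\<in>?S. \<Sum>\<rho>\<in>?S. \<Sum>v\<in>spec X. ?E \<sigma> \<rho> * local_proj (y(i := Some v)) \<Lambda> \<rho> \<sigma>)"
    unfolding N ktrace_def kmult_def P sum_distrib_left ..
  also have "\<dots> = (\<Sum>\<sigma>\<in>?S. \<Sum>v\<in>spec X. \<Sum>\<rho>\<in>?S. ?E \<sigma> \<rho> * local_proj (y(i := Some v)) \<Lambda> \<rho> \<sigma>)"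
    by (intro sum.cong refl sum.swap)
  also have "\<dots> = (\<Sum>v\<in>spec X. complex_of_real (N (y(i := Some v))))"
    unfolding N ktrace_def kmult_def by (rule sum.swap)
  finally show ?thesis by (simp only: of_real_sum[symmetric] of_real_eq_iff)
qed

text \<open>Joins the two halves: the polymer bound makes the coefficients of ln N summable, and the
  extended potential built from them yields the limit measure and its DLR equations.\<close>

lemma classical_restriction_gibbsian:
  fixes \<Phi> :: "(int^'d) set \<Rightarrow> ((int^'d) \<Rightarrow> 'm::finite) \<Rightarrow> ((int^'d) \<Rightarrow> 'm) \<Rightarrow> complex" and a e \<beta> :: real
  assumes qi: "quantum_interaction \<Phi>" and sa: "selfadjoint X"
    and "0 \<le> \<beta>" "0 \<le> a" "0 \<le> e" "exp e \<le> 2 - exp (- a)"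
    and v_sum: "\<And>L y. finite L \<Longrightarrow>
      (\<Sum>A\<in>{A\<in>Pow L. y \<in> A}. (exp (\<beta> * kopnorm (cfg A) (\<Phi> A)) - 1) * exp ((a + e) * card A)) \<le> e"
  shows "\<exists>\<mu>. prob_space \<mu> \<and> sets \<mu> = sets (Omega_alg (spec X)) \<and>
     (\<forall>\<Lambda>. finite \<Lambda> \<longrightarrow> (\<forall>\<xi>\<in>\<Lambda> \<rightarrow>\<^sub>E spec X.
        (\<lambda>n. gibbs_state \<beta> \<Phi> (box n) (emb \<Lambda> (box n) (QLam X \<Lambda> \<xi>)))
          \<longlonglongrightarrow> complex_of_real (measure \<mu> (cyl (spec X) \<Lambda> \<xi>)))) \<and>
     gibbsian (spec X) \<mu>"
proof -
  interpret Q: spin_system \<Phi> "site_proj X" by (rule spin_system_site_proj[OF qi sa])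
  interpret F: family_gas "Q.fam_weight \<beta>" "\<lambda>A. if finite A then exp (\<beta> * Q.hnorm A) - 1 else 0" a e
    by (rule Q.family_gas_fam_weight[OF assms(3-6)]) (unfold Q.hnorm_def, rule v_sum)
  define N where "N B y = (\<Prod>i\<in>B. Q.tr (y i)) * Q.fam_weight \<beta> y (nePow B)" for B y
  define lZ where "lZ y B = ln (Q.fam_weight \<beta> y (nePow B))" for y B
  define \<psi> where "\<psi> A y = mob (\<lambda>B. ln (N B y)) A" for A y
  have N_pos: "N B y > 0" if "finite B" for B y
    unfolding N_def using F.Z_pos[OF that] by (intro mult_pos_pos prod_pos) (auto simp: Q.tr_pos)
  have exp_psi: "exp (\<Sum>A\<in>Pow L. \<psi> A y) = N L y" if "finite L" for L y
    using N_pos[OF that] by (simp add: \<psi>_def sum_mob[OF that])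
  \<comment> \<open>The polymer bound controls only the normalised weights; the traces contribute an
    additive set function, visible at singletons alone.\<close>
  have psi_eq: "\<psi> A y = mob (lZ y) A + (if is_singleton A then ln (Q.tr (y (the_elem A))) else 0)"
    if A: "finite A" for A y
  proof -
    have "\<psi> A y = mob (\<lambda>B. lZ y B + (\<Sum>i\<in>B. ln (Q.tr (y i)))) A"
      unfolding \<psi>_def
    proof (rule mob_cong)
      fix B assume "B \<subseteq> A"
      then have B: "finite B" using finite_subset[OF _ A] by blast
      have "ln (N B y) = ln (\<Prod>i\<in>B. Q.tr (y i)) + lZ y B"
        unfolding N_def lZ_def using F.Z_pos[OF B] by (intro ln_mult_pos prod_pos) (auto simp: Q.tr_pos)
      also have "ln (\<Prod>i\<in>B. Q.tr (y i)) = (\<Sum>i\<in>B. ln (Q.tr (y i)))"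
        by (rule ln_prod[OF B]) (use Q.tr_pos in \<open>simp add: less_imp_neq[symmetric]\<close>)
      finally show "ln (N B y) = lZ y B + (\<Sum>i\<in>B. ln (Q.tr (y i)))" by simp
    qed
    then show ?thesis unfolding mob_add mob_additive[OF A] .
  qed
  \<comment> \<open>\<open>site_proj\<close> takes finitely many values because the spectrum is
    finite, so the logarithms of the traces are bounded.\<close>
  obtain T where T: "\<And>l. \<bar>ln (Q.tr l)\<bar> \<le> T"
  proof
    let ?R = "(\<lambda>p. \<bar>ln (Re (ktrace UNIV p))\<bar>) ` insert kid (specproj X ` spec X)"
    fix l
    have "site_proj X l \<in> insert kid (specproj X ` spec X)"
      unfolding site_proj_def by (cases l) auto
    then have "\<bar>ln (Q.tr l)\<bar> \<in> ?R" unfolding Q.tr_def by blast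
    then show "\<bar>ln (Q.tr l)\<bar> \<le> Max ?R"
      using spectral_resolution(1)[OF sa] by (intro Max_ge) auto
  qed
  have T0: "0 \<le> T" using T[of None] by linarith
  \<comment> \<open>The summable bound must not depend on the configuration, hence the supremum over
    all labellings; it is finite since the polymer majorant is common to all of them.\<close>
  define s1 where "s1 A = (SUP y. \<bar>mob (lZ y) A\<bar>)" for A
  define s where "s A = s1 A + T * of_bool (is_singleton A)" for A
  have majorant: "\<exists>g. (\<forall>y. \<forall>A\<subseteq>L. \<bar>mob (lZ y) (insert x A)\<bar> \<le> g A) \<and> (\<Sum>A\<in>Pow L. g A) \<le> a"
    if "finite L" "x \<notin> L" for x L
    using F.mob_ln_majorant[OF that] unfolding lZ_def by metis
  have bdd: "bdd_above (range (\<lambda>y. \<bar>mob (lZ y) A\<bar>))" if A: "finite A" for A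
  proof (cases "A = {}")
    case True
    have "mob (lZ y) A = 0" for y
      by (simp add: True mob_def lZ_def nePow_def Q.fam_weight_empty)
    then show ?thesis by simp
  next
    case False
    then obtain x where x: "x \<in> A" by blast
    obtain g where g: "\<And>y B. B \<subseteq> A - {x} \<Longrightarrow> \<bar>mob (lZ y) (insert x B)\<bar> \<le> g B"
      using majorant[of "A - {x}" x] A by blast
    have "insert x (A - {x}) = A" using x by blast
    then have "\<bar>mob (lZ y) A\<bar> \<le> g (A - {x})" for y using g[of "A - {x}" y] by simp
    then show ?thesis by (rule bdd_aboveI2)
  qed
  have s1_ge: "\<bar>mob (lZ y) A\<bar> \<le> s1 A" if "finite A" for A y
    unfolding s1_def by (rule cSUP_upper[OF UNIV_I bdd[OF that]])
  have s1_summable: "s1 summable_on {A. finite A \<and> x \<in> A}" for x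
  proof (rule nonneg_bdd_above_summable_on)
    show "0 \<le> s1 A" if "A \<in> {A. finite A \<and> x \<in> A}" for A
      using s1_ge[of A undefined] that by auto
    show "bdd_above (sum s1 ` {F. F \<subseteq> {A. finite A \<and> x \<in> A} \<and> finite F})"
    proof (rule bdd_aboveI2)
      fix F assume "F \<in> {F. F \<subseteq> {A. finite A \<and> x \<in> A} \<and> finite F}"
      then have F: "finite F" "\<And>A. A \<in> F \<Longrightarrow> finite A" "\<And>A. A \<in> F \<Longrightarrow> x \<in> A" by auto
      \<comment> \<open>All members of F contain x and lie in \<open>insert x ?L\<close>, so one
        application of the majorant at x bounds the whole finite sum by a, independently of
        F.\<close>
      let ?L = "\<Union>F - {x}"
      have L: "finite ?L" "x \<notin> ?L" using F(1,2) by auto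
      obtain g where g: "\<And>y A. A \<subseteq> ?L \<Longrightarrow> \<bar>mob (lZ y) (insert x A)\<bar> \<le> g A" "(\<Sum>A\<in>Pow ?L. g A) \<le> a"
        using majorant[OF L] by blast
      have g0: "0 \<le> g A" if "A \<subseteq> ?L" for A using g(1)[OF that, of undefined] by linarith
      have "sum s1 F \<le> (\<Sum>A\<in>F. g (A - {x}))"
      proof (rule sum_mono)
        fix A assume A: "A \<in> F"
        have "insert x (A - {x}) = A" "A - {x} \<subseteq> ?L" using A F(3) by auto
        then show "s1 A \<le> g (A - {x})"
          unfolding s1_def using g(1)[of "A - {x}"] by (intro cSUP_least) auto
      qed
      also have "\<dots> = (\<Sum>B\<in>(\<lambda>A. A - {x}) ` F. g B)"
      proof (subst sum.reindex)
        show "inj_on (\<lambda>A. A - {x}) F"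
        proof (rule inj_onI)
          fix A B assume "A \<in> F" "B \<in> F" "A - {x} = B - {x}"
          then show "A = B" using F(3) by (metis insert_Diff)
        qed
      qed simp
      also have "\<dots> \<le> (\<Sum>B\<in>Pow ?L. g B)"
        by (rule sum_mono2) (use L g0 in auto)
      also have "\<dots> \<le> a" by (rule g(2))
      finally show "sum s1 F \<le> a" .
    qed
  qed
  interpret G: extended_potential "spec X" \<psi> s
  proof
    show "finite (spec X)" by (rule spectral_resolution(1)[OF sa])
    show "spec X \<noteq> {}"
    proof
      assume "spec X = {}"
      then show False using spectral_resolution(5)[OF sa, of undefined undefined] by (simp add: kid_def)
    qed
    show "\<psi> A y = \<psi> A y'" if eq: "\<And>i. i \<in> A \<Longrightarrow> y i = y' i" for A y y'
      unfolding \<psi>_def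
    proof (rule mob_cong)
      fix B assume "B \<subseteq> A"
      then have eqB: "y i = y' i" if "i \<in> B" for i using eq that by blast
      have "Q.fam_weight \<beta> y (nePow B) = Q.fam_weight \<beta> y' (nePow B)"
        by (rule Q.fam_weight_cong) (simp add: Union_nePow eqB)
      moreover have "(\<Prod>i\<in>B. Q.tr (y i)) = (\<Prod>i\<in>B. Q.tr (y' i))" by (intro prod.cong refl) (simp add: eqB)
      ultimately show "ln (N B y) = ln (N B y')" by (simp add: N_def)
    qed
    show "\<psi> {} y = 0" for y by (simp add: psi_eq mob_def lZ_def nePow_def Q.fam_weight_empty is_singleton_def)
    show "\<bar>\<psi> A y\<bar> \<le> s A" if A: "finite A" for A y
    proof -
      have "\<bar>if is_singleton A then ln (Q.tr (y (the_elem A))) else 0\<bar> \<le> T * of_bool (is_singleton A)"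
        using T by simp
      then show ?thesis unfolding psi_eq[OF A] s_def using s1_ge[OF A, of y] by linarith
    qed
    show "s summable_on {A. finite A \<and> x \<in> A}" for x
      unfolding s_def
    proof (rule summable_on_add[OF s1_summable])
      have "(\<lambda>A. T * of_bool (is_singleton A)) summable_on {{x}}" by (rule summable_on_finite) simp
      moreover have "(\<lambda>A. T * of_bool (is_singleton A)) summable_on {{x}} \<longleftrightarrow>
          (\<lambda>A. T * of_bool (is_singleton A)) summable_on {A. finite A \<and> x \<in> A}"
        by (rule summable_on_cong_neutral) (auto simp: is_singleton_def)
      ultimately show "(\<lambda>A. T * of_bool (is_singleton A)) summable_on {A. finite A \<and> x \<in> A}" by blast
    qed
    show "\<psi> (transl i A) y = \<psi> A (\<lambda>j. y (j + i))" if A: "finite A" for i A y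
    proof -
      have "\<psi> (transl i A) y = mob (\<lambda>B. ln (N (transl i B) y)) A"
        unfolding \<psi>_def transl_def by (rule mob_image[OF A inj_on_shift])
      also have "\<dots> = \<psi> A (\<lambda>j. y (j + i))"
        unfolding \<psi>_def
      proof (rule mob_cong)
        fix B assume "B \<subseteq> A"
        then have B: "finite B" using finite_subset[OF _ A] by blast
        have "(\<Prod>k\<in>transl i B. Q.tr (y k)) = (\<Prod>j\<in>B. Q.tr (y (j + i)))"
          unfolding transl_def by (subst prod.reindex[OF inj_on_shift]) simp
        then show "ln (N (transl i B) y) = ln (N B (\<lambda>j. y (j + i)))"
          unfolding N_def using fam_weight_transl[OF Q.spin_system_axioms qi B, of \<beta> y i] by simp
      qed
      finally show ?thesis .
    qed
    show "exp (\<Sum>A\<in>Pow L. \<psi> A (y(i := None))) = (\<Sum>v\<in>spec X. exp (\<Sum>A\<in>Pow L. \<psi> A (y(i := Some v))))"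
      if L: "finite L" "i \<in> L" for L i y
      unfolding exp_psi[OF L(1)] N_def by (rule weight_sum_label[OF qi sa L])
  qed
  obtain \<mu> where \<mu>: "prob_space \<mu>" "sets \<mu> = sets (Omega_alg (spec X))" "gibbsian (spec X) \<mu>"
    and lim: "\<And>\<Lambda> \<xi>. finite \<Lambda> \<Longrightarrow> \<xi> \<in> \<Lambda> \<rightarrow>\<^sub>E spec X \<Longrightarrow>
       (\<lambda>n. G.weight (box n) (labels \<Lambda> \<xi>) / G.weight (box n) (\<lambda>_. None)) \<longlonglongrightarrow> measure \<mu> (cyl (spec X) \<Lambda> \<xi>)"
    using G.gibbs_measure_exists by blast
  have weight: "G.weight (box n) y = N (box n) y" for n y unfolding G.weight_def by (rule exp_psi[OF finite_box])
  have "(\<lambda>n. gibbs_state \<beta> \<Phi> (box n) (emb \<Lambda> (box n) (QLam X \<Lambda> \<xi>)))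
          \<longlonglongrightarrow> complex_of_real (measure \<mu> (cyl (spec X) \<Lambda> \<xi>))" if \<Lambda>: "finite \<Lambda>" "\<xi> \<in> \<Lambda> \<rightarrow>\<^sub>E spec X" for \<Lambda> \<xi>
  proof (rule Lim_transform_eventually[OF tendsto_of_real[OF lim[OF \<Lambda>]]])
    show "eventually (\<lambda>n. complex_of_real (G.weight (box n) (labels \<Lambda> \<xi>) / G.weight (box n) (\<lambda>_. None))
        = gibbs_state \<beta> \<Phi> (box n) (emb \<Lambda> (box n) (QLam X \<Lambda> \<xi>))) sequentially"
    proof (rule eventually_mono[OF eventually_subset_box[OF \<Lambda>(1)]])
      fix n assume "\<Lambda> \<subseteq> box n"
      from gibbs_state_eq[OF qi sa finite_box this \<Lambda>(2), of \<beta>]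
      show "complex_of_real (G.weight (box n) (labels \<Lambda> \<xi>) / G.weight (box n) (\<lambda>_. None))
        = gibbs_state \<beta> \<Phi> (box n) (emb \<Lambda> (box n) (QLam X \<Lambda> \<xi>))" unfolding weight N_def by (rule sym)
    qed
  qed
  with \<mu> show ?thesis by blast
qed

theorem theorem1:
  fixes \<Phi> :: "(int^'d) set \<Rightarrow> ((int^'d) \<Rightarrow> 'm::finite) \<Rightarrow> ((int^'d) \<Rightarrow> 'm) \<Rightarrow> complex"
    and \<kappa> :: real
  assumes "CARD('m) \<ge> 2"
    and "quantum_interaction \<Phi>"
    and "\<kappa> > 0"
    and "interaction_norm_finite \<kappa> \<Phi>"
  shows "\<exists>\<beta>max>0. \<forall>\<beta>. 0 < \<beta> \<and> \<beta> \<le> \<beta>max \<longrightarrow>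
           (\<forall>X :: 'm \<Rightarrow> 'm \<Rightarrow> complex. selfadjoint X \<longrightarrow>
              (\<exists>\<mu>. prob_space \<mu> \<and> sets \<mu> = sets (Omega_alg (spec X)) \<and>
                 (\<forall>\<Lambda>. finite \<Lambda> \<longrightarrow> (\<forall>\<xi>\<in>\<Lambda> \<rightarrow>\<^sub>E spec X.
                    (\<lambda>n. gibbs_state \<beta> \<Phi> (box n) (emb \<Lambda> (box n) (QLam X \<Lambda> \<xi>)))
                      \<longlonglongrightarrow> complex_of_real (measure \<mu> (cyl (spec X) \<Lambda> \<xi>)))) \<and>
                 gibbsian (spec X) \<mu>))"
proof -
  \<comment> \<open>\<kappa> is split in halves: a + e \<le> \<kappa> lets the interaction norm
    absorb both exponential factors, and the second bound on e gives exp(e) \<le> 2 -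
    exp(-a).\<close>
  define a where "a = \<kappa> / 2"
  define e where "e = min (\<kappa> / 2) (ln (2 - exp (- a)))"
  define M where "M = (\<Sum>\<^sub>\<infinity>A\<in>{A. finite A \<and> 0 \<in> A}. exp (\<kappa> * card A) * kopnorm (cfg A) (\<Phi> A))"
  \<comment> \<open>\<beta> \<le> 1 gives
    \<open>exp (\<beta> * ?n A) - 1 \<le> \<beta> * ?n A * exp M\<close>, so the activity sum is at
    most \<beta> exp(M) M. The second bound makes this at most e; M + 1 keeps the quotient defined
    when M = 0. Nothing here involves X.\<close>
  define \<beta>max where "\<beta>max = min 1 (e / (exp M * (M + 1)))"
  let ?n = "\<lambda>A. kopnorm (cfg A) (\<Phi> A)"
  have a: "0 < a" using assms(3) by (simp add: a_def)
  then have ea: "exp (- a) < 1" by simp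
  then have "0 < ln (2 - exp (- a))" by (intro ln_gt_zero) simp
  then have e: "0 < e" "e \<le> \<kappa> / 2" "e \<le> ln (2 - exp (- a))" using assms(3) by (auto simp: e_def)
  have "exp e \<le> exp (ln (2 - exp (- a)))" using e(3) by simp
  also have "\<dots> = 2 - exp (- a)" using ea by (intro exp_ln) linarith
  finally have e2: "exp e \<le> 2 - exp (- a)" .
  have M0: "0 \<le> M"
    unfolding M_def by (rule infsum_nonneg) (auto intro!: mult_nonneg_nonneg kopnorm_nonneg)
  have \<beta>0: "0 < \<beta>max" using e(1) M0 by (simp add: \<beta>max_def)
  have small: "(\<Sum>A\<in>{A\<in>Pow L. y \<in> A}. (exp (\<beta> * ?n A) - 1) * exp ((a + e) * card A)) \<le> e"
    if \<beta>: "0 < \<beta>" "\<beta> \<le> \<beta>max" and L: "finite L" for \<beta> L and y :: "int^'d"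
  proof -
    let ?F = "{A\<in>Pow L. y \<in> A}"
    have fin: "finite A" if "A \<in> ?F" for A using that finite_subset[OF _ L] by auto
    have n0: "0 \<le> ?n A" if "A \<in> ?F" for A using fin[OF that] by (simp add: kopnorm_nonneg)
    have sumM: "(\<Sum>A\<in>?F. exp (\<kappa> * card A) * ?n A) \<le> M"
      unfolding M_def by (rule interaction_sum_le[OF assms(2,4) L])
    have nM: "?n A \<le> M" if A: "A \<in> ?F" for A
    proof -
      have "1 * ?n A \<le> exp (\<kappa> * card A) * ?n A"
        using assms(3) n0[OF A] by (intro mult_right_mono) auto
      also have "\<dots> \<le> (\<Sum>A\<in>?F. exp (\<kappa> * card A) * ?n A)"
        by (rule member_le_sum[OF A]) (use n0 L in auto)
      finally show ?thesis using sumM by simp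
    qed
    have "(\<Sum>A\<in>?F. (exp (\<beta> * ?n A) - 1) * exp ((a + e) * card A))
        \<le> (\<Sum>A\<in>?F. (\<beta> * exp M) * (exp (\<kappa> * card A) * ?n A))"
    proof (rule sum_mono)
      fix A assume A: "A \<in> ?F"
      have "\<beta> * ?n A \<le> 1 * M" using \<beta> nM[OF A] n0[OF A] by (intro mult_mono) (auto simp: \<beta>max_def)
      then have "exp (\<beta> * ?n A) - 1 \<le> (\<beta> * ?n A) * exp M"
        using exp_minus_one_le[of "\<beta> * ?n A"] \<beta> n0[OF A]
        by (intro order_trans[OF exp_minus_one_le] mult_left_mono) auto
      moreover have "exp ((a + e) * card A) \<le> exp (\<kappa> * card A)"
        using e(2) by (simp add: a_def mult_right_mono)
      ultimately have "(exp (\<beta> * ?n A) - 1) * exp ((a + e) * card A) \<le> ((\<beta> * ?n A) * exp M) * exp (\<kappa> * card A)"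
        using \<beta> n0[OF A] by (intro mult_mono) auto
      then show "(exp (\<beta> * ?n A) - 1) * exp ((a + e) * card A) \<le> (\<beta> * exp M) * (exp (\<kappa> * card A) * ?n A)"
        by (simp add: mult_ac)
    qed
    also have "\<dots> = (\<beta> * exp M) * (\<Sum>A\<in>?F. exp (\<kappa> * card A) * ?n A)" by (simp add: sum_distrib_left)
    also have "\<dots> \<le> (\<beta> * exp M) * (M + 1)" using \<beta> sumM by (intro mult_left_mono) auto
    also have "\<dots> \<le> e"
    proof -
      have "\<beta> \<le> e / (exp M * (M + 1))" using \<beta> by (simp add: \<beta>max_def)
      then have "\<beta> * (exp M * (M + 1)) \<le> e" using M0 by (subst (asm) pos_le_divide_eq) auto
      then show ?thesis by (simp add: mult.assoc)
    qed
    finally show ?thesis .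
  qed
  show ?thesis
  proof (intro exI[of _ \<beta>max] conjI allI impI)
    fix \<beta> :: real and X :: "'m \<Rightarrow> 'm \<Rightarrow> complex" assume \<beta>: "0 < \<beta> \<and> \<beta> \<le> \<beta>max" and X: "selfadjoint X"
    show "\<exists>\<mu>. prob_space \<mu> \<and> sets \<mu> = sets (Omega_alg (spec X)) \<and>
                 (\<forall>\<Lambda>. finite \<Lambda> \<longrightarrow> (\<forall>\<xi>\<in>\<Lambda> \<rightarrow>\<^sub>E spec X.
                    (\<lambda>n. gibbs_state \<beta> \<Phi> (box n) (emb \<Lambda> (box n) (QLam X \<Lambda> \<xi>)))
                      \<longlonglongrightarrow> complex_of_real (measure \<mu> (cyl (spec X) \<Lambda> \<xi>)))) \<and>
                 gibbsian (spec X) \<mu>"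
      by (rule classical_restriction_gibbsian[OF assms(2) X, of \<beta> a e])
         (use \<beta> a e e2 small in auto)
  qed (rule \<beta>0)
qed

end
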